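(* Under Assumptions A, B, C1, C2, C3 (stated in the context), as $c\to0$ (with $c>0$), $$c^{2/3}\,\mathrm{argmin}_h\,\Lambda_c(h)\ \rightarrow_d\ L\equiv\mathrm{argmin}_h\,[a_0W(h)+b_0h^2],$$ where $W$ is standard two-sided Brownian motion on $\mathbb{R}$ starting from $0$, $a_0=\sqrt{\sigma^2p_X(\theta^0)}$ and $b_0=p_X(\theta^0)f'(\xi^0)/2$.
   Context: Setting. Fix $\theta^0\in(0,1)$ and a smooth bounded monotone (increasing) function $f:\mathbb{R}\to\mathbb{R}$; write $\beta_l^0=f(-\infty)$ and $\beta_u^0=f(\infty)$ for its limits. Let $\alpha_n>0$, $\alpha_n\to\infty$, and $f_n(x)=f(\alpha_n(x-\theta^0))$. At stage $n$, $Y=f_n(X)+\epsilon$, where $X$ takes values in $[0,1]$ with density $p_X$, and $\epsilon$ is independent of $X$ with $E\epsilon=0$ and finite variance $\sigma^2$. It is assumed that $(\theta,\beta_l,\beta_u)\mapsto E\{Y-\beta_l1(X\le\theta)-\beta_u1(X>\theta)\}^2$ (expectation at stage $n$) has a unique minimizer $(\theta^n,\beta_l^n,\beta_u^n)$, with $\beta_l^n\ne\beta_u^n$. Put $\xi^n=\alpha_n(\theta^n-\theta^0)$ and $\xi^0=f^{-1}((\beta_l^0+\beta_u^0)/2)$. Assumptions. A. $f$ is continuously differentiable in an open neighborhood of $\xi^0$ with $f'(\xi^0)>0$. B. $p_X$ does not vanish and is continuously differentiable in a neighborhood of $\theta^0$. C1. $\inf_n\liminf_{|h_1|\to\infty}\frac1{|h_1|}\int_0^{h_1}[f(t+\xi^n)-f(\xi^n)]\,dt>0$.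 C2. For every constant $K>0$, $\inf_n\inf_{u\in[-K+\xi^n,K+\xi^n]}f'(u)>0$. C3. The integrals $\xi^l=\int_{-\infty}^{\xi^0}(f(t)-\beta_l^0)\,dt$ and $\xi^u=\int_{\xi^0}^{\infty}(f(t)-\beta_u^0)\,dt$ exist. Processes. Let $\nu^+$ be a homogeneous Poisson process on $[0,\infty)$ with rate $p_X(\theta^0)$ and right-continuous sample paths with left limits, with arrival times $S_1<S_2<\cdots$; $\nu^-$ a homogeneous Poisson process on $[0,\infty)$ with rate $p_X(\theta^0)$ and left-continuous sample paths with right limits, with arrival times $\tilde S_1<\tilde S_2<\cdots$; $\{\epsilon_j\}_{j\ge1}$ and $\{\tilde\epsilon_j\}_{j\ge1}$ i.i.d. copies of $\epsilon$; all four are independent. For $c>0$ (empty sums are zero), $$\Lambda_c(h)=\left\{\sum_{j=1}^{\nu^+(h)}\left(\epsilon_j+f(\xi^0+cS_j)-f(\xi^0)\right)\right\}1(h\ge0)+\left\{\sum_{j=1}^{\nu^-(-h)}\left(-\tilde\epsilon_j+f(\xi^0)-f(\xi^0-c\tilde S_j)\right)\right\}1(h<0).$$ The argmin of $\Lambda_c$ means its smallest minimizer. *)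

theory Defs
  imports "HOL-Probability.Probability"
begin

definition is_minimizer :: "('x \<Rightarrow> real) \<Rightarrow> 'x \<Rightarrow> bool" where
  "is_minimizer g x \<longleftrightarrow> (\<forall>y. g x \<le> g y)"

definition is_smallest_minimizer :: "(real \<Rightarrow> real) \<Rightarrow> real \<Rightarrow> bool" where
  "is_smallest_minimizer g h \<longleftrightarrow> is_minimizer g h \<and> (\<forall>k. is_minimizer g k \<longrightarrow> h \<le> k)"

text \<open>The smallest minimizer; an unspecified constant, the same for all such \<open>g\<close>,
  if there is none.\<close>

definition argmin :: "(real \<Rightarrow> real) \<Rightarrow> real" where
  "argmin g = (LEAST h. is_minimizer g h)"

text \<open>Mean squared error of the stump with split point \<open>\<theta>\<close> and levels \<open>\<beta>l\<close>, \<open>\<beta>u\<close>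
  for the response \<open>Y\<close>.\<close>

definition stump_risk ::
  "'p measure \<Rightarrow> ('p \<Rightarrow> real) \<Rightarrow> ('p \<Rightarrow> real) \<Rightarrow> real \<times> real \<times> real \<Rightarrow> real" where
  "stump_risk P X Y = (\<lambda>(\<theta>, \<beta>l, \<beta>u).
     \<integral>\<omega>. (Y \<omega> - \<beta>l * indicator {..\<theta>} (X \<omega>) - \<beta>u * indicator {\<theta><..} (X \<omega>))\<^sup>2 \<partial>P)"

definition generated_events ::
  "'m measure \<Rightarrow> 'v measure \<Rightarrow> 'i set \<Rightarrow> ('i \<Rightarrow> 'm \<Rightarrow> 'v) \<Rightarrow> 'm set set" where
  "generated_events M N I X =
     sigma_sets (space M) (\<Union>i\<in>I. {X i -` A \<inter> space M | A. A \<in> sets N})"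

definition independent_increments :: "'m measure \<Rightarrow> real set \<Rightarrow> (real \<Rightarrow> 'm \<Rightarrow> real) \<Rightarrow> bool" where
  "independent_increments M T Z \<longleftrightarrow>
     (\<forall>(t :: nat \<Rightarrow> real) n. range t \<subseteq> T \<longrightarrow> strict_mono t \<longrightarrow>
        prob_space.indep_vars M (\<lambda>_. borel) (\<lambda>i \<omega>. Z (t (Suc i)) \<omega> - Z (t i) \<omega>) {..<n})"

text \<open>Homogeneous Poisson process on \<open>[0,\<infinity>)\<close>. The one-sided continuity of the paths is left
  open, since both the right- and the left-continuous version are needed. The values
  \<open>N t\<close> for \<open>t < 0\<close> are irrelevant.\<close>

definition poisson_process :: "'m measure \<Rightarrow> real \<Rightarrow> (real \<Rightarrow> 'm \<Rightarrow> nat) \<Rightarrow> bool" where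
  "poisson_process M r N \<longleftrightarrow>
     (\<forall>t\<ge>0. N t \<in> measurable M (count_space UNIV)) \<and>
     (\<forall>\<omega>\<in>space M. N 0 \<omega> = 0 \<and> mono_on {0..} (\<lambda>t. N t \<omega>)) \<and>
     independent_increments M {0..} (\<lambda>t \<omega>. real (N t \<omega>)) \<and>
     (\<forall>s t. 0 \<le> s \<and> s < t \<longrightarrow>
        distr M (count_space UNIV) (\<lambda>\<omega>. N t \<omega> - N s \<omega>) = measure_pmf (poisson_pmf (r * (t - s))))"

definition right_cont_left_limits :: "(real \<Rightarrow> nat) \<Rightarrow> bool" where
  "right_cont_left_limits x \<longleftrightarrow>
     (\<forall>t\<ge>0. (x \<longlongrightarrow> x t) (at_right t)) \<and> (\<forall>t>0. \<exists>l. (x \<longlongrightarrow> l) (at_left t))"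

definition left_cont_right_limits :: "(real \<Rightarrow> nat) \<Rightarrow> bool" where
  "left_cont_right_limits x \<longleftrightarrow>
     (\<forall>t>0. (x \<longlongrightarrow> x t) (at_left t)) \<and> (\<forall>t\<ge>0. \<exists>l. (x \<longlongrightarrow> l) (at_right t))"

text \<open>The time of the \<open>j\<close>-th arrival, \<open>j \<ge> 1\<close>. For a left-continuous path the infimum
  is not attained: the path reaches level \<open>j\<close> immediately after it.\<close>

definition arrival_time :: "(real \<Rightarrow> 'm \<Rightarrow> nat) \<Rightarrow> nat \<Rightarrow> 'm \<Rightarrow> real" where
  "arrival_time N j \<omega> = Inf {t. 0 \<le> t \<and> j \<le> N t \<omega>}"

definition two_sided_brownian_motion :: "'b measure \<Rightarrow> (real \<Rightarrow> 'b \<Rightarrow> real) \<Rightarrow> bool" where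
  "two_sided_brownian_motion B W \<longleftrightarrow>
     (\<forall>t. W t \<in> borel_measurable B) \<and>
     (\<forall>\<omega>\<in>space B. W 0 \<omega> = 0 \<and> continuous_on UNIV (\<lambda>t. W t \<omega>)) \<and>
     independent_increments B UNIV W \<and>
     (\<forall>s t. s < t \<longrightarrow>
        distributed B lborel (\<lambda>\<omega>. W t \<omega> - W s \<omega>) (normal_density 0 (sqrt (t - s))))"

definition Lambda ::
  "(real \<Rightarrow> real) \<Rightarrow> real \<Rightarrow> (real \<Rightarrow> 'm \<Rightarrow> nat) \<Rightarrow> (real \<Rightarrow> 'm \<Rightarrow> nat) \<Rightarrow>
   (nat \<Rightarrow> 'm \<Rightarrow> real) \<Rightarrow> (nat \<Rightarrow> 'm \<Rightarrow> real) \<Rightarrow> real \<Rightarrow> 'm \<Rightarrow> real \<Rightarrow> real" where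
  "Lambda f \<xi>0 \<nu>p \<nu>m \<epsilon>p \<epsilon>m c \<omega> h =
     (if 0 \<le> h
      then \<Sum>j = 1..\<nu>p h \<omega>. \<epsilon>p j \<omega> + f (\<xi>0 + c * arrival_time \<nu>p j \<omega>) - f \<xi>0
      else \<Sum>j = 1..\<nu>m (- h) \<omega>. - \<epsilon>m j \<omega> + f \<xi>0 - f (\<xi>0 - c * arrival_time \<nu>m j \<omega>))"

end

theory Submission
  imports Defs "HOL-Real_Asymp.Real_Asymp"
begin

text \<open>Measure time in units of \<open>T = c powr (-2/3)\<close> and put \<open>r = p\<^sub>X \<theta>0\<close>. There are about
  \<open>r u T\<close> arrivals in \<open>[0, u T]\<close>. Their noise is a random walk of size \<open>sqrt T\<close>, and their drift is
  a Riemann sum of \<open>f (\<xi>0 + c s) - f \<xi>0\<close>, which is close to \<open>deriv f \<xi>0 * c s\<close>; it amounts to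
  \<open>r * deriv f \<xi>0 * c (u T)\<^sup>2 / 2 = sqrt T * b0 u\<^sup>2\<close>. So \<open>\<Lambda> c (u T) / sqrt T\<close> looks like
  \<open>a0 W u + b0 u\<^sup>2\<close>, and \<open>argmin (\<Lambda> c) / T\<close> should converge in law to the minimizer of the limit.

  The minimizer is compared directly, without a limit theorem in a function space. Three facts
  about \<open>\<Lambda>\<close> make this possible, all of them up to events of small probability. First, the minimizer
  stays in a window of length of order \<open>T\<close>, because \<open>\<Lambda>\<close> is positive outside
  (\<open>walk_positive_tail\<close>): on dyadic time intervals the drift exceeds the bound that a maximal
  inequality gives for the noise. Secondly, on that window \<open>\<Lambda>\<close> is close to its
  values on a grid of mesh \<open>\<delta> T\<close>, and these are the noise at multiples of a fixed number of steps
  plus the parabola (\<open>eventually_walk_near_blocks\<close>). Here the law of large numbers for the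
  arrival counts turns times into numbers of steps. The noise within all blocks is
  controlled by Ottaviani's inequality together with the fourth moment of the Gaussian limit: one
  block of relative length \<open>\<delta>\<close> fails with probability of order \<open>\<delta>\<^sup>2\<close>, and there are only of order
  \<open>1/\<delta>\<close> blocks. Thirdly, the increments over the blocks are independent, on both sides of \<open>0\<close>
  jointly, and each of them obeys the central limit theorem. Skorohod's representation, applied
  coordinatewise, then yields \<open>limsup\<close> bounds for the probability of closed conditions on the grid
  values (\<open>eventually_prob_less_indep_weak_conv\<close>).

  For the limit \<open>Z h = a0 W h + b0 h\<^sup>2\<close> the minimizer exists because \<open>W\<close> grows more slowly than a
  parabola (\<open>AE_W_le_square\<close>), and it is unique because the difference of the minima over two
  separated intervals contains an independent Gaussian increment and hence has no atom
  (\<open>AE_no_tie\<close>). Let \<open>C\<close> be \<open>{..x}\<close> or \<open>{x..}\<close>. If the minimizer of \<open>Z\<close> is outside \<open>C\<close>, then for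
  a large window, a fine grid and a small tolerance no grid point in \<open>C\<close> is nearly minimal
  (\<open>eventually_not_in_grid_event\<close>). This gives \<open>limsup\<close> of the probability that
  \<open>argmin (\<Lambda> c) / T \<in> C\<close> at most the probability that \<open>argmin Z \<in> C\<close>, for both kinds of \<open>C\<close>
  (\<open>eventually_prob_argmin_in_less\<close>), and the two bounds together are convergence of the
  distribution functions at continuity points.\<close>

section \<open>Limits of probabilities and a maximal inequality\<close>

text \<open>Dominated convergence for the indicators of \<open>E k - A\<close>. This turns almost sure statements
  into bounds on \<open>limsup prob (E k)\<close>.\<close>

lemma (in prob_space) eventually_prob_less:
  assumes [measurable]: "\<And>k::nat. E k \<in> events" "A \<in> events"
    and ev: "AE \<omega> in M. (\<forall>\<^sub>F k in sequentially. \<omega> \<notin> E k) \<or> \<omega> \<in> A"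
    and "0 < e"
  shows "\<forall>\<^sub>F k in sequentially. prob (E k) < prob A + e"
proof -
  have "(\<lambda>k. \<integral>\<omega>. indicator (E k - A) \<omega> \<partial>M) \<longlonglongrightarrow> (\<integral>\<omega>. 0 \<partial>M :: real)"
  proof (rule integral_dominated_convergence[where w="\<lambda>_. 1"])
    show "AE \<omega> in M. (\<lambda>k. indicator (E k - A) \<omega> :: real) \<longlonglongrightarrow> 0"
      using ev
    proof eventually_elim
      case (elim \<omega>)
      then have "\<forall>\<^sub>F k in sequentially. (indicator (E k - A) \<omega> :: real) = 0"
        by (auto elim!: eventually_mono)
      then show ?case by (rule tendsto_eventually)
    qed
  qed (auto simp: indicator_def)
  then have "(\<lambda>k. prob (E k - A)) \<longlonglongrightarrow> 0" by simp
  then have "\<forall>\<^sub>F k in sequentially. prob (E k - A) < e"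
    using \<open>0 < e\<close> by (rule order_tendstoD)
  then show ?thesis
  proof eventually_elim
    case (elim k)
    have "prob (E k) \<le> prob (A \<union> (E k - A))" by (intro finite_measure_mono) auto
    also have "\<dots> \<le> prob A + prob (E k - A)" by (intro measure_Un_le) auto
    finally show ?case using elim by simp
  qed
qed

text \<open>Ottaviani's inequality: stop at the first \<open>k\<close> with a large partial sum; the remaining sum
  is independent of the past and small with probability at least one half, and then the full sum
  is large as well. Unlike Kolmogorov's inequality it bounds the maximum by a tail probability
  of the last sum, so that the Gaussian tail of the limit becomes available for it.\<close>

lemma (in prob_space) ottaviani:
  fixes X :: "nat \<Rightarrow> 'a \<Rightarrow> real"
    and l :: real
  assumes X: "indep_vars (\<lambda>_. borel) X {..<n}"
    and half: "\<And>k. k \<le> n \<Longrightarrow> prob {\<omega> \<in> space M. l < \<bar>\<Sum>i=k..<n. X i \<omega>\<bar>} \<le> 1/2"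
  shows "prob {\<omega> \<in> space M. \<exists>k\<le>n. 2 * l \<le> \<bar>\<Sum>i<k. X i \<omega>\<bar>}
    \<le> 2 * prob {\<omega> \<in> space M. l \<le> \<bar>\<Sum>i<n. X i \<omega>\<bar>}"
proof -
  have Xm[measurable]: "random_variable borel (X i)" if "i < n" for i
    using X that by (auto simp: indep_vars_def)
  have Sm[measurable]: "(\<lambda>\<omega>. \<Sum>i<min k n. X i \<omega>) \<in> borel_measurable M" for k
    by (intro borel_measurable_sum) auto
  have Rm[measurable]: "(\<lambda>\<omega>. \<Sum>i=k..<n. X i \<omega>) \<in> borel_measurable M" for k
    by (intro borel_measurable_sum) auto
  define E where "E k = {\<omega> \<in> space M. 2 * l \<le> \<bar>\<Sum>i<k. X i \<omega>\<bar> \<and> (\<forall>j<k. \<bar>\<Sum>i<j. X i \<omega>\<bar> < 2 * l)}" for k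
  define F where "F k = {\<omega> \<in> space M. \<bar>\<Sum>i=k..<n. X i \<omega>\<bar> \<le> l}" for k
  have Em[measurable]: "E k \<in> events" if "k \<le> n" for k
  proof -
    have "{\<omega> \<in> space M. 2 * l \<le> \<bar>\<Sum>i<min k n. X i \<omega>\<bar> \<and> (\<forall>j\<in>{..<k}. \<bar>\<Sum>i<min j n. X i \<omega>\<bar> < 2 * l)} \<in> events"
      by measurable
    also have "{\<omega> \<in> space M. 2 * l \<le> \<bar>\<Sum>i<min k n. X i \<omega>\<bar> \<and> (\<forall>j\<in>{..<k}. \<bar>\<Sum>i<min j n. X i \<omega>\<bar> < 2 * l)} = E k"
      using that by (auto simp: E_def min_def split: if_splits)
    finally show ?thesis .
  qed
  have Fm[measurable]: "F k \<in> events" for k unfolding F_def by measurable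
  have "E j \<inter> E k = {}" if "j < k" for j k
    using that by (fastforce simp: E_def)
  then have disj: "disjoint_family_on E {..n}"
    unfolding disjoint_family_on_def by (metis inf_commute linorder_neqE_nat)
  have un: "{\<omega> \<in> space M. \<exists>k\<le>n. 2 * l \<le> \<bar>\<Sum>i<k. X i \<omega>\<bar>} = (\<Union>k\<le>n. E k)"
  proof (intro equalityI subsetI)
    fix \<omega> assume "\<omega> \<in> {\<omega> \<in> space M. \<exists>k\<le>n. 2 * l \<le> \<bar>\<Sum>i<k. X i \<omega>\<bar>}"
    then obtain k0 where k0: "\<omega> \<in> space M" "k0 \<le> n" "2 * l \<le> \<bar>\<Sum>i<k0. X i \<omega>\<bar>" by auto
    define k where "k = (LEAST k. 2 * l \<le> \<bar>\<Sum>i<k. X i \<omega>\<bar>)"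
    have "2 * l \<le> \<bar>\<Sum>i<k. X i \<omega>\<bar>" using LeastI[where P="\<lambda>k. 2 * l \<le> \<bar>\<Sum>i<k. X i \<omega>\<bar>", OF k0(3)] unfolding k_def .
    moreover have "k \<le> k0" using Least_le[where P="\<lambda>k. 2 * l \<le> \<bar>\<Sum>i<k. X i \<omega>\<bar>", OF k0(3)] unfolding k_def .
    moreover have "\<bar>\<Sum>i<j. X i \<omega>\<bar> < 2 * l" if "j < k" for j
      using not_less_Least[OF that[unfolded k_def]] by simp
    ultimately show "\<omega> \<in> (\<Union>k\<le>n. E k)" using k0 by (auto simp: E_def intro!: bexI[of _ k])
  qed (auto simp: E_def)
  have ind: "prob (E k \<inter> F k) = prob (E k) * prob (F k)" if k: "k \<le> n" for k
  proof -
    let ?Xa = "{x \<in> space (PiM {..<k} (\<lambda>_. borel)). 2 * l \<le> \<bar>\<Sum>i<k. x i\<bar> \<and> (\<forall>j\<in>{..<k}. \<bar>\<Sum>i<min j k. x i\<bar> < 2 * l)}"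
    let ?Xb = "{x \<in> space (PiM {k..<n} (\<lambda>_. borel)). \<bar>\<Sum>i=k..<n. x i\<bar> \<le> l}"
    let ?f = "\<lambda>\<omega>. restrict (\<lambda>i. X i \<omega>) {..<k}" and ?g = "\<lambda>\<omega>. restrict (\<lambda>i. X i \<omega>) {k..<n}"
    have iv: "indep_var (PiM {..<k} (\<lambda>_. borel)) ?f (PiM {k..<n} (\<lambda>_. borel)) ?g"
      by (rule indep_var_restrict[OF X]) (use k in auto)
    have m[measurable]: "(\<lambda>x. \<Sum>i<min j k. x i) \<in> borel_measurable (PiM {..<k} (\<lambda>_. borel :: real measure))" for j
      by (intro borel_measurable_sum measurable_component_singleton) auto
    note m[of k, simplified, measurable]
    have a: "?Xa \<in> sets (PiM {..<k} (\<lambda>_. borel))"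
      by measurable
    have b: "?Xb \<in> sets (PiM {k..<n} (\<lambda>_. borel))" by measurable
    have e1: "?f -` ?Xa \<inter> space M = E k"
      by (auto simp: E_def space_PiM min_def)
    have e2: "?g -` ?Xb \<inter> space M = F k"
      by (auto simp: F_def space_PiM)
    have "prob ((\<lambda>x. (?f x, ?g x)) -` (?Xa \<times> ?Xb) \<inter> space M)
        = prob (?f -` ?Xa \<inter> space M) * prob (?g -` ?Xb \<inter> space M)"
      using indep_varD[OF iv a b] .
    moreover have "(\<lambda>x. (?f x, ?g x)) -` (?Xa \<times> ?Xb) \<inter> space M
        = (?f -` ?Xa \<inter> space M) \<inter> (?g -` ?Xb \<inter> space M)" by auto
    ultimately show ?thesis unfolding e1 e2 by simp
  qed
  have Fhalf: "1/2 \<le> prob (F k)" if k: "k \<le> n" for k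
  proof -
    have "{\<omega> \<in> space M. l < \<bar>\<Sum>i=k..<n. X i \<omega>\<bar>} = space M - F k" by (auto simp: F_def)
    then show ?thesis using half[OF k] prob_compl[of "F k"] by simp
  qed
  have sub: "(\<Union>k\<le>n. E k \<inter> F k) \<subseteq> {\<omega> \<in> space M. l \<le> \<bar>\<Sum>i<n. X i \<omega>\<bar>}"
  proof
    fix \<omega> assume "\<omega> \<in> (\<Union>k\<le>n. E k \<inter> F k)"
    then obtain k where k: "k \<le> n" "\<omega> \<in> E k" "\<omega> \<in> F k" by auto
    have "(\<Sum>i<n. X i \<omega>) = (\<Sum>i<k. X i \<omega>) + (\<Sum>i=k..<n. X i \<omega>)"
      using k(1) by (metis atLeast0LessThan le0 sum.atLeastLessThan_concat)
    then show "\<omega> \<in> {\<omega> \<in> space M. l \<le> \<bar>\<Sum>i<n. X i \<omega>\<bar>}" using k(2,3) by (auto simp: E_def F_def)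
  qed
  have "prob (\<Union>k\<le>n. E k) = (\<Sum>k\<le>n. prob (E k))"
    by (rule finite_measure_finite_Union) (use disj in auto)
  also have "\<dots> \<le> (\<Sum>k\<le>n. 2 * prob (E k \<inter> F k))"
  proof (rule sum_mono)
    fix k assume "k \<in> {..n}"
    then have "prob (E k) * (1/2) \<le> prob (E k) * prob (F k)" by (intro mult_left_mono Fhalf) auto
    then show "prob (E k) \<le> 2 * prob (E k \<inter> F k)" using ind[of k] \<open>k \<in> {..n}\<close> by simp
  qed
  also have "\<dots> = 2 * prob (\<Union>k\<le>n. E k \<inter> F k)"
    unfolding sum_distrib_left[symmetric]
    by (subst finite_measure_finite_Union) (use disj in \<open>auto simp: disjoint_family_on_def\<close>)
  also have "\<dots> \<le> 2 * prob {\<omega> \<in> space M. l \<le> \<bar>\<Sum>i<n. X i \<omega>\<bar>}"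
    by (intro mult_left_mono finite_measure_mono sub) auto
  finally show ?thesis unfolding un .
qed

lemma (in prob_space) expectation_sum_square:
  fixes X :: "'i \<Rightarrow> 'a \<Rightarrow> real"
    and v :: real
  assumes "finite I" "indep_vars (\<lambda>_. borel) X I"
    and "\<And>i. i \<in> I \<Longrightarrow> integrable M (\<lambda>\<omega>. (X i \<omega>)\<^sup>2)" "\<And>i. i \<in> I \<Longrightarrow> expectation (X i) = 0"
    and "\<And>i. i \<in> I \<Longrightarrow> expectation (\<lambda>\<omega>. (X i \<omega>)\<^sup>2) = v"
  shows "integrable M (\<lambda>\<omega>. (\<Sum>i\<in>I. X i \<omega>)\<^sup>2)"
    and "expectation (\<lambda>\<omega>. (\<Sum>i\<in>I. X i \<omega>)\<^sup>2) = card I * v"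
proof -
  have "integrable M (\<lambda>\<omega>. (\<Sum>i\<in>I. X i \<omega>)\<^sup>2) \<and> expectation (\<lambda>\<omega>. (\<Sum>i\<in>I. X i \<omega>)\<^sup>2) = card I * v"
    using assms
  proof (induction I rule: finite_induct)
    case (insert j I)
    have rv[measurable]: "random_variable borel (X i)" if "i \<in> insert j I" for i
      using insert.prems(1) that by (auto simp: indep_vars_def)
    have Xj: "integrable M (\<lambda>\<omega>. (X j \<omega>)\<^sup>2)" "expectation (\<lambda>\<omega>. (X j \<omega>)\<^sup>2) = v" "expectation (X j) = 0"
      using insert.prems(2,4,3)[of j] by simp_all
    have iX: "integrable M (X i)" if "i \<in> insert j I" for i
      by (rule square_integrable_imp_integrable[OF rv[OF that] insert.prems(2)[OF that]])
    have IH: "integrable M (\<lambda>\<omega>. (\<Sum>i\<in>I. X i \<omega>)\<^sup>2)" "expectation (\<lambda>\<omega>. (\<Sum>i\<in>I. X i \<omega>)\<^sup>2) = card I * v"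
    proof -
      have "indep_vars (\<lambda>_. borel) X I" by (rule indep_vars_subset[OF insert.prems(1)]) auto
      from insert.IH[OF this insert.prems(2-4)]
      show "integrable M (\<lambda>\<omega>. (\<Sum>i\<in>I. X i \<omega>)\<^sup>2)" "expectation (\<lambda>\<omega>. (\<Sum>i\<in>I. X i \<omega>)\<^sup>2) = card I * v"
        by simp_all
    qed
    have iv: "indep_var borel (X j) borel (\<lambda>\<omega>. \<Sum>i\<in>I. X i \<omega>)"
      using insert.hyps insert.prems(1) by (intro indep_vars_sum) auto
    have iS: "integrable M (\<lambda>\<omega>. \<Sum>i\<in>I. X i \<omega>)" using iX by (intro Bochner_Integration.integrable_sum) auto
    have prod: "integrable M (\<lambda>\<omega>. X j \<omega> * (\<Sum>i\<in>I. X i \<omega>))" "expectation (\<lambda>\<omega>. X j \<omega> * (\<Sum>i\<in>I. X i \<omega>)) = 0"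
      using indep_var_integrable[OF iv iX iS] indep_var_lebesgue_integral[OF iv iX iS] Xj(3)
      by simp_all
    have eq: "(\<Sum>i\<in>insert j I. X i \<omega>)\<^sup>2
        = (X j \<omega>)\<^sup>2 + 2 * (X j \<omega> * (\<Sum>i\<in>I. X i \<omega>)) + (\<Sum>i\<in>I. X i \<omega>)\<^sup>2" for \<omega>
      using insert.hyps by (simp add: power2_sum algebra_simps)
    have i2: "integrable M (\<lambda>\<omega>. (X j \<omega>)\<^sup>2 + 2 * (X j \<omega> * (\<Sum>i\<in>I. X i \<omega>)))"
      by (intro Bochner_Integration.integrable_add Xj(1) integrable_mult_right prod(1))
    have "expectation (\<lambda>\<omega>. (\<Sum>i\<in>insert j I. X i \<omega>)\<^sup>2) = v + 2 * 0 + card I * v"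
      unfolding eq by (simp only: Bochner_Integration.integral_add[OF i2 IH(1)] IH(2) prod(2) Xj(2)
        Bochner_Integration.integral_add[OF Xj(1) integrable_mult_right[OF prod(1)]] integral_mult_right_zero)
    moreover have "v + 2 * 0 + card I * v = card (insert j I) * v"
      using insert.hyps by (simp add: algebra_simps)
    moreover have "integrable M (\<lambda>\<omega>. (\<Sum>i\<in>insert j I. X i \<omega>)\<^sup>2)"
      unfolding eq by (intro Bochner_Integration.integrable_add i2 IH(1))
    ultimately show ?case by (simp only: simp_thms)
  qed simp
  then show "integrable M (\<lambda>\<omega>. (\<Sum>i\<in>I. X i \<omega>)\<^sup>2)"
    and "expectation (\<lambda>\<omega>. (\<Sum>i\<in>I. X i \<omega>)\<^sup>2) = card I * v" by auto
qed

lemma (in prob_space) prob_sum_ge: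
  fixes X :: "'i \<Rightarrow> 'a \<Rightarrow> real"
    and v l :: real
  assumes "finite I" "indep_vars (\<lambda>_. borel) X I"
    and "\<And>i. i \<in> I \<Longrightarrow> integrable M (\<lambda>\<omega>. (X i \<omega>)\<^sup>2)" "\<And>i. i \<in> I \<Longrightarrow> expectation (X i) = 0"
    and "\<And>i. i \<in> I \<Longrightarrow> expectation (\<lambda>\<omega>. (X i \<omega>)\<^sup>2) = v" and "0 < l"
  shows "prob {\<omega> \<in> space M. l \<le> \<bar>\<Sum>i\<in>I. X i \<omega>\<bar>} \<le> card I * v / l\<^sup>2"
proof -
  have rv[measurable]: "random_variable borel (X i)" if "i \<in> I" for i
    using assms(2) that by (auto simp: indep_vars_def)
  have iX: "integrable M (X i)" if "i \<in> I" for i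
    by (rule square_integrable_imp_integrable[OF rv[OF that] assms(3)[OF that]])
  have m[measurable]: "(\<lambda>\<omega>. \<Sum>i\<in>I. X i \<omega>) \<in> borel_measurable M" by measurable
  have e0: "expectation (\<lambda>\<omega>. \<Sum>i\<in>I. X i \<omega>) = 0"
    using assms(4) iX by (simp add: Bochner_Integration.integral_sum)
  have "prob {\<omega> \<in> space M. l \<le> \<bar>(\<Sum>i\<in>I. X i \<omega>) - expectation (\<lambda>\<omega>. \<Sum>i\<in>I. X i \<omega>)\<bar>}
      \<le> variance (\<lambda>\<omega>. \<Sum>i\<in>I. X i \<omega>) / l\<^sup>2"
    by (rule Chebyshev_inequality) (use expectation_sum_square(1)[OF assms(1-5)] \<open>0 < l\<close> in auto)
  then show ?thesis using e0 expectation_sum_square(2)[OF assms(1-5)] by simp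
qed

lemma (in prob_space) prob_max_sum_le_last:
  fixes X :: "nat \<Rightarrow> 'a \<Rightarrow> real"
    and v l :: real
  assumes X: "indep_vars (\<lambda>_. borel) X {..<n}"
    and "\<And>i. i < n \<Longrightarrow> integrable M (\<lambda>\<omega>. (X i \<omega>)\<^sup>2)" "\<And>i. i < n \<Longrightarrow> expectation (X i) = 0"
    and "\<And>i. i < n \<Longrightarrow> expectation (\<lambda>\<omega>. (X i \<omega>)\<^sup>2) = v" and "0 < l"
    and small: "n * v / l\<^sup>2 \<le> 1/2"
  shows "prob {\<omega> \<in> space M. \<exists>k\<le>n. 2 * l \<le> \<bar>\<Sum>i<k. X i \<omega>\<bar>}
    \<le> 2 * prob {\<omega> \<in> space M. l \<le> \<bar>\<Sum>i<n. X i \<omega>\<bar>}"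
proof (rule ottaviani[OF X])
  fix k assume "k \<le> n"
  have [measurable]: "random_variable borel (X i)" if "i < n" for i
    using X that by (auto simp: indep_vars_def)
  have ip: "indep_vars (\<lambda>_. borel) X {k..<n}" by (rule indep_vars_subset[OF X]) auto
  have "prob {\<omega> \<in> space M. l < \<bar>\<Sum>i=k..<n. X i \<omega>\<bar>} \<le> prob {\<omega> \<in> space M. l \<le> \<bar>\<Sum>i=k..<n. X i \<omega>\<bar>}"
    by (intro finite_measure_mono) auto
  also have "\<dots> \<le> card {k..<n} * v / l\<^sup>2"
    using prob_sum_ge[OF _ ip, where l=l and v=v] assms(2-5) by simp
  also have "\<dots> \<le> n * v / l\<^sup>2"
  proof (cases "n = 0")
    case False
    have "v = expectation (\<lambda>\<omega>. (X 0 \<omega>)\<^sup>2)" using assms(4)[of 0] False by simp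
    then have "0 \<le> v" by simp
    then show ?thesis by (intro divide_right_mono mult_right_mono) auto
  qed simp
  also note small
  finally show "prob {\<omega> \<in> space M. l < \<bar>\<Sum>i=k..<n. X i \<omega>\<bar>} \<le> 1/2" .
qed

text \<open>Beyond \<open>n * v / l\<^sup>2 = 1/2\<close>, where Chebyshev's inequality no longer supplies the one half for
  Ottaviani's inequality, the right-hand side exceeds \<open>1\<close>.\<close>

lemma (in prob_space) prob_max_sum_ge:
  fixes X :: "nat \<Rightarrow> 'a \<Rightarrow> real"
    and v l :: real
  assumes X: "indep_vars (\<lambda>_. borel) X {..<n}"
    and "\<And>i. i < n \<Longrightarrow> integrable M (\<lambda>\<omega>. (X i \<omega>)\<^sup>2)" "\<And>i. i < n \<Longrightarrow> expectation (X i) = 0"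
    and "\<And>i. i < n \<Longrightarrow> expectation (\<lambda>\<omega>. (X i \<omega>)\<^sup>2) = v" and "0 < l"
  shows "prob {\<omega> \<in> space M. \<exists>k\<le>n. 2 * l \<le> \<bar>\<Sum>i<k. X i \<omega>\<bar>} \<le> 2 * (n * v / l\<^sup>2)"
proof (cases "n * v / l\<^sup>2 \<le> 1/2")
  case True
  have "prob {\<omega> \<in> space M. l \<le> \<bar>\<Sum>i<n. X i \<omega>\<bar>} \<le> card {..<n} * v / l\<^sup>2"
    using prob_sum_ge[OF _ X, where l=l and v=v] assms(2-5) by simp
  then show ?thesis using prob_max_sum_le_last[OF assms True] by simp
next
  case False
  have "prob {\<omega> \<in> space M. \<exists>k\<le>n. 2 * l \<le> \<bar>\<Sum>i<k. X i \<omega>\<bar>} \<le> 1" by simp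
  also have "1 \<le> 2 * (n * v / l\<^sup>2)" using False by linarith
  finally show ?thesis .
qed

section \<open>Weak convergence of independent coordinates\<close>

lemma indep_vars_distr_PiM_component:
  assumes "finite I" "I \<noteq> {}" "\<And>i. i \<in> I \<Longrightarrow> prob_space (\<Omega> i)"
    and "\<And>i. i \<in> I \<Longrightarrow> f i \<in> borel_measurable (\<Omega> i)"
  shows "distr (PiM I \<Omega>) (PiM I (\<lambda>_. borel)) (\<lambda>w. \<lambda>i\<in>I. f i (w i))
    = PiM I (\<lambda>i. distr (\<Omega> i) borel (f i))"
proof -
  interpret P: prob_space "PiM I \<Omega>" by (rule prob_space_PiM) (use assms in auto)
  have comp: "distr (PiM I \<Omega>) (\<Omega> i) (\<lambda>w. w i) = \<Omega> i" if "i \<in> I" for i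
    using that assms(3) by (intro distr_PiM_component) auto
  have "distr (PiM I \<Omega>) (PiM I \<Omega>) (\<lambda>w. \<lambda>i\<in>I. w i) = distr (PiM I \<Omega>) (PiM I \<Omega>) (\<lambda>w. w)"
    by (rule distr_cong) (auto simp: space_PiM)
  also have "\<dots> = PiM I \<Omega>" by simp
  also have "\<dots> = PiM I (\<lambda>i. distr (PiM I \<Omega>) (\<Omega> i) (\<lambda>w. w i))"
    by (rule PiM_cong) (use comp in auto)
  finally have "P.indep_vars \<Omega> (\<lambda>i w. w i) I"
    using assms(2) by (subst P.indep_vars_iff_distr_eq_PiM') auto
  then have "P.indep_vars (\<lambda>_. borel) (\<lambda>i w. f i (w i)) I"
    by (rule P.indep_vars_compose2) (use assms in auto)
  moreover have m: "(\<lambda>w. f i (w i)) \<in> borel_measurable (PiM I \<Omega>)" if "i \<in> I" for i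
    by (rule measurable_compose[of "\<lambda>w. w i" _ "\<Omega> i" "f i"]) (use that assms(4) in auto)
  ultimately have "distr (PiM I \<Omega>) (PiM I (\<lambda>_. borel)) (\<lambda>w. \<lambda>i\<in>I. f i (w i))
      = PiM I (\<lambda>i. distr (PiM I \<Omega>) borel (\<lambda>w. f i (w i)))"
    using assms(2) P.indep_vars_iff_distr_eq_PiM'[where I=I and M'="\<lambda>_. borel" and X="\<lambda>i w. f i (w i)"] by auto
  also have "\<dots> = PiM I (\<lambda>i. distr (\<Omega> i) borel (f i))"
  proof (rule PiM_cong[OF refl])
    fix i assume i: "i \<in> I"
    have "distr (PiM I \<Omega>) borel (\<lambda>w. f i (w i)) = distr (distr (PiM I \<Omega>) (\<Omega> i) (\<lambda>w. w i)) borel (f i)"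
      using i assms(4) by (subst distr_distr) (auto simp: comp_def)
    then show "distr (PiM I \<Omega>) borel (\<lambda>w. f i (w i)) = distr (\<Omega> i) borel (f i)"
      using comp[OF i] by simp
  qed
  finally show ?thesis .
qed

text \<open>Half of the portmanteau theorem for vectors with independent coordinates. Skorohod's
  representation of each coordinate, on the product of the representing spaces, represents the
  whole vector, so that weak convergence of the coordinates may be replaced by pointwise
  convergence.\<close>

lemma eventually_prob_less_indep_weak_conv:
  fixes X :: "nat \<Rightarrow> 'i \<Rightarrow> 'a \<Rightarrow> real" and Y :: "'i \<Rightarrow> 'b \<Rightarrow> real"
  assumes M: "prob_space M" and Q: "prob_space Q" and I: "finite I" "I \<noteq> {}"
    and X: "\<And>n. prob_space.indep_vars M (\<lambda>_. borel) (X n) I"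
    and Y: "prob_space.indep_vars Q (\<lambda>_. borel) Y I"
    and conv: "\<And>i. i \<in> I \<Longrightarrow> weak_conv_m (\<lambda>n. distr M borel (X n i)) (distr Q borel (Y i))"
    and R: "{x \<in> space (PiM I (\<lambda>_. borel)). R x} \<in> sets (PiM I (\<lambda>_. borel))"
    and closed: "\<And>x xs. (\<And>i. i \<in> I \<Longrightarrow> (\<lambda>n. xs n i) \<longlonglongrightarrow> x i) \<Longrightarrow> \<not> R x \<Longrightarrow> \<forall>\<^sub>F n in sequentially. \<not> R (xs n)"
    and "0 < e"
  shows "\<forall>\<^sub>F n in sequentially. measure M {\<omega> \<in> space M. R (\<lambda>i\<in>I. X n i \<omega>)}
    < measure Q {\<omega> \<in> space Q. R (\<lambda>i\<in>I. Y i \<omega>)} + e"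
proof -
  interpret M: prob_space M by (rule M)
  interpret Q: prob_space Q by (rule Q)
  have Xm: "X n i \<in> borel_measurable M" if "i \<in> I" for n i
    using X[of n] that by (auto simp: M.indep_vars_def)
  have Ym: "Y i \<in> borel_measurable Q" if "i \<in> I" for i
    using Y that by (auto simp: Q.indep_vars_def)
  define rep where "rep i \<Omega> U V \<longleftrightarrow> prob_space (\<Omega> :: real measure) \<and> (\<forall>n::nat. U n \<in> borel_measurable \<Omega>) \<and>
      (\<forall>n. distr \<Omega> borel (U n) = distr M borel (X n i)) \<and> V \<in> borel_measurable \<Omega> \<and>
      distr \<Omega> borel V = distr Q borel (Y i) \<and> (\<forall>x\<in>space \<Omega>. (\<lambda>n. U n x) \<longlonglongrightarrow> V x)" for i \<Omega> U V
  have "\<forall>i\<in>I. \<exists>p. rep i (fst p) (fst (snd p)) (snd (snd p))"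
  proof
    fix i assume i: "i \<in> I"
    have "real_distribution (distr M borel (X n i))" for n
      by (rule M.real_distribution_distr) (rule Xm[OF i])
    moreover have "real_distribution (distr Q borel (Y i))"
      by (rule Q.real_distribution_distr) (rule Ym[OF i])
    ultimately have "\<exists>\<Omega> U V. rep i \<Omega> U V" unfolding rep_def using Skorohod[OF _ _ conv[OF i]] by simp
    then show "\<exists>p. rep i (fst p) (fst (snd p)) (snd (snd p))" by force
  qed
  then obtain p where p: "\<forall>i\<in>I. rep i (fst (p i)) (fst (snd (p i))) (snd (snd (p i)))"
    using bchoice by meson
  define \<Omega> where "\<Omega> i = fst (p i)" for i
  define U where "U i = fst (snd (p i))" for i
  define V where "V i = snd (snd (p i))" for i
  have rep: "rep i (\<Omega> i) (U i) (V i)" if "i \<in> I" for i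
    using p that by (simp add: \<Omega>_def U_def V_def)
  have \<Omega>: "\<And>i. i \<in> I \<Longrightarrow> prob_space (\<Omega> i)"
    and U: "\<And>i n. i \<in> I \<Longrightarrow> U i n \<in> borel_measurable (\<Omega> i)"
      "\<And>i n. i \<in> I \<Longrightarrow> distr (\<Omega> i) borel (U i n) = distr M borel (X n i)"
    and V: "\<And>i. i \<in> I \<Longrightarrow> V i \<in> borel_measurable (\<Omega> i)"
      "\<And>i. i \<in> I \<Longrightarrow> distr (\<Omega> i) borel (V i) = distr Q borel (Y i)"
    and UV: "\<And>i x. i \<in> I \<Longrightarrow> x \<in> space (\<Omega> i) \<Longrightarrow> (\<lambda>n. U i n x) \<longlonglongrightarrow> V i x"
    using rep unfolding rep_def by auto
  interpret P: prob_space "PiM I \<Omega>" by (rule prob_space_PiM) (rule \<Omega>)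
  let ?B = "PiM I (\<lambda>_. borel) :: ('i \<Rightarrow> real) measure" and ?R = "{x \<in> space (PiM I (\<lambda>_. borel)). R x}"
  have Um: "(\<lambda>w. \<lambda>i\<in>I. U i n (w i)) \<in> measurable (PiM I \<Omega>) ?B" for n
  proof (rule measurable_restrict)
    fix i assume i: "i \<in> I"
    show "(\<lambda>w. U i n (w i)) \<in> borel_measurable (PiM I \<Omega>)"
      by (rule measurable_compose[of "\<lambda>w. w i" _ "\<Omega> i" "U i n"]) (use i U(1) in auto)
  qed
  have Vm: "(\<lambda>w. \<lambda>i\<in>I. V i (w i)) \<in> measurable (PiM I \<Omega>) ?B"
  proof (rule measurable_restrict)
    fix i assume i: "i \<in> I"
    show "(\<lambda>w. V i (w i)) \<in> borel_measurable (PiM I \<Omega>)"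
      by (rule measurable_compose[of "\<lambda>w. w i" _ "\<Omega> i" "V i"]) (use i V(1) in auto)
  qed
  have XU: "measure M {\<omega> \<in> space M. R (\<lambda>i\<in>I. X n i \<omega>)} = P.prob ((\<lambda>w. \<lambda>i\<in>I. U i n (w i)) -` ?R \<inter> space (PiM I \<Omega>))" for n
  proof -
    have m: "(\<lambda>\<omega>. \<lambda>i\<in>I. X n i \<omega>) \<in> measurable M ?B" by (intro measurable_restrict Xm)
    have "distr M ?B (\<lambda>\<omega>. \<lambda>i\<in>I. X n i \<omega>) = PiM I (\<lambda>i. distr M borel (X n i))"
      using M.indep_vars_iff_distr_eq_PiM'[where I=I and M'="\<lambda>_. borel" and X="X n"] I X Xm by auto
    also have "\<dots> = PiM I (\<lambda>i. distr (\<Omega> i) borel (U i n))" by (rule PiM_cong) (use U in auto)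
    also have "\<dots> = distr (PiM I \<Omega>) ?B (\<lambda>w. \<lambda>i\<in>I. U i n (w i))"
      using I \<Omega> U by (intro indep_vars_distr_PiM_component[symmetric]) auto
    finally have "measure (distr M ?B (\<lambda>\<omega>. \<lambda>i\<in>I. X n i \<omega>)) ?R = measure (distr (PiM I \<Omega>) ?B (\<lambda>w. \<lambda>i\<in>I. U i n (w i))) ?R"
      by simp
    moreover have "(\<lambda>\<omega>. \<lambda>i\<in>I. X n i \<omega>) -` ?R \<inter> space M = {\<omega> \<in> space M. R (\<lambda>i\<in>I. X n i \<omega>)}"
      by (auto simp: space_PiM)
    ultimately show ?thesis using measure_distr[OF m R] measure_distr[OF Um R] by simp
  qed
  have YV: "measure Q {\<omega> \<in> space Q. R (\<lambda>i\<in>I. Y i \<omega>)} = P.prob ((\<lambda>w. \<lambda>i\<in>I. V i (w i)) -` ?R \<inter> space (PiM I \<Omega>))"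
  proof -
    have m: "(\<lambda>\<omega>. \<lambda>i\<in>I. Y i \<omega>) \<in> measurable Q ?B" by (intro measurable_restrict Ym)
    have "distr Q ?B (\<lambda>\<omega>. \<lambda>i\<in>I. Y i \<omega>) = PiM I (\<lambda>i. distr Q borel (Y i))"
      using Q.indep_vars_iff_distr_eq_PiM'[where I=I and M'="\<lambda>_. borel" and X=Y] I Y Ym by auto
    also have "\<dots> = PiM I (\<lambda>i. distr (\<Omega> i) borel (V i))" by (rule PiM_cong) (use V in auto)
    also have "\<dots> = distr (PiM I \<Omega>) ?B (\<lambda>w. \<lambda>i\<in>I. V i (w i))"
      using I \<Omega> V by (intro indep_vars_distr_PiM_component[symmetric]) auto
    finally have "measure (distr Q ?B (\<lambda>\<omega>. \<lambda>i\<in>I. Y i \<omega>)) ?R = measure (distr (PiM I \<Omega>) ?B (\<lambda>w. \<lambda>i\<in>I. V i (w i))) ?R"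
      by simp
    moreover have "(\<lambda>\<omega>. \<lambda>i\<in>I. Y i \<omega>) -` ?R \<inter> space Q = {\<omega> \<in> space Q. R (\<lambda>i\<in>I. Y i \<omega>)}"
      by (auto simp: space_PiM)
    ultimately show ?thesis using measure_distr[OF m R] measure_distr[OF Vm R] by simp
  qed
  show ?thesis unfolding XU YV
  proof (rule P.eventually_prob_less)
    show "AE w in PiM I \<Omega>. (\<forall>\<^sub>F n in sequentially. w \<notin> (\<lambda>w. \<lambda>i\<in>I. U i n (w i)) -` ?R \<inter> space (PiM I \<Omega>))
      \<or> w \<in> (\<lambda>w. \<lambda>i\<in>I. V i (w i)) -` ?R \<inter> space (PiM I \<Omega>)"
    proof (rule AE_I2)
      fix w assume w: "w \<in> space (PiM I \<Omega>)"
      have "(\<lambda>n. (\<lambda>i\<in>I. U i n (w i)) i) \<longlonglongrightarrow> (\<lambda>i\<in>I. V i (w i)) i" if "i \<in> I" for i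
        using UV[of i "w i"] that w by (auto simp: space_PiM)
      then have "\<not> R (\<lambda>i\<in>I. V i (w i)) \<Longrightarrow> \<forall>\<^sub>F n in sequentially. \<not> R (\<lambda>i\<in>I. U i n (w i))"
        by (rule closed)
      then show "(\<forall>\<^sub>F n in sequentially. w \<notin> (\<lambda>w. \<lambda>i\<in>I. U i n (w i)) -` ?R \<inter> space (PiM I \<Omega>))
          \<or> w \<in> (\<lambda>w. \<lambda>i\<in>I. V i (w i)) -` ?R \<inter> space (PiM I \<Omega>)"
        using w by (cases "R (\<lambda>i\<in>I. V i (w i))") (auto simp: space_PiM elim: eventually_mono)
    qed
  qed (use \<open>0 < e\<close> R Um Vm in \<open>auto intro: measurable_sets\<close>)
qed

text \<open>This joins the blocks of steps to the right and to the left of \<open>0\<close> to one independent family.\<close>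

lemma (in prob_space) indep_vars_Un:
  fixes X :: "'i \<Rightarrow> 'a \<Rightarrow> real"
  assumes X: "indep_vars (\<lambda>_. borel) X I" "indep_vars (\<lambda>_. borel) X J" and IJ: "I \<inter> J = {}"
    and FG: "indep_set F G" "sigma_algebra (space M) F" "sigma_algebra (space M) G"
    and F: "\<And>i A. i \<in> I \<Longrightarrow> A \<in> sets borel \<Longrightarrow> X i -` A \<inter> space M \<in> F"
    and G: "\<And>j A. j \<in> J \<Longrightarrow> A \<in> sets borel \<Longrightarrow> X j -` A \<inter> space M \<in> G"
  shows "indep_vars (\<lambda>_. borel) X (I \<union> J)"
proof -
  let ?S = "\<lambda>i. {X i -` A \<inter> space M |A. A \<in> sets borel}"
  have SI: "indep_sets ?S I" and SJ: "indep_sets ?S J" and rv: "\<And>i. i \<in> I \<union> J \<Longrightarrow> random_variable borel (X i)"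
    using X by (auto simp: indep_vars_def2)
  have "indep_sets ?S (I \<union> J)"
  proof (rule indep_setsI)
    show "?S i \<subseteq> events" if "i \<in> I \<union> J" for i using rv[OF that] by (auto intro: measurable_sets)
    fix A K assume K: "K \<noteq> {}" "K \<subseteq> I \<union> J" "finite K" and A: "\<forall>j\<in>K. A j \<in> ?S j"
    define K1 where "K1 = K \<inter> I" define K2 where "K2 = K \<inter> J"
    have KK: "K = K1 \<union> K2" "K1 \<inter> K2 = {}" "finite K1" "finite K2" "K1 \<subseteq> I" "K2 \<subseteq> J"
      using K IJ by (auto simp: K1_def K2_def)
    show "prob (\<Inter>j\<in>K. A j) = (\<Prod>j\<in>K. prob (A j))"
    proof (cases "K1 = {} \<or> K2 = {}")
      case True
      then show ?thesis
      proof
        assume "K1 = {}"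
        then have "K \<subseteq> J" using KK by simp
        then show ?thesis using indep_setsD[OF SJ _ K(1,3)] A by simp
      next
        assume "K2 = {}"
        then have "K \<subseteq> I" using KK by simp
        then show ?thesis using indep_setsD[OF SI _ K(1,3)] A by simp
      qed
    next
      case False
      interpret F: sigma_algebra "space M" F by (rule FG)
      interpret G: sigma_algebra "space M" G by (rule FG)
      have "A j \<in> F" if "j \<in> K1" for j
      proof -
        obtain B where "B \<in> sets borel" "A j = X j -` B \<inter> space M" using A KK(1) \<open>j \<in> K1\<close> by blast
        then show ?thesis using F[of j B] KK(5) that by auto
      qed
      then have "(\<Inter>j\<in>K1. A j) \<in> F" using False KK by (intro F.finite_INT) auto
      moreover have "A j \<in> G" if "j \<in> K2" for j
      proof -
        obtain B where "B \<in> sets borel" "A j = X j -` B \<inter> space M" using A KK(1) \<open>j \<in> K2\<close> by blast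
        then show ?thesis using G[of j B] KK(6) that by auto
      qed
      then have "(\<Inter>j\<in>K2. A j) \<in> G" using False KK by (intro G.finite_INT) auto
      ultimately have "prob ((\<Inter>j\<in>K1. A j) \<inter> (\<Inter>j\<in>K2. A j)) = prob (\<Inter>j\<in>K1. A j) * prob (\<Inter>j\<in>K2. A j)"
        by (rule indep_setD[OF FG(1)])
      also have "prob (\<Inter>j\<in>K1. A j) = (\<Prod>j\<in>K1. prob (A j))"
        using False KK A by (intro indep_setsD[OF SI]) auto
      also have "prob (\<Inter>j\<in>K2. A j) = (\<Prod>j\<in>K2. prob (A j))"
        using False KK A by (intro indep_setsD[OF SJ]) auto
      finally show ?thesis using KK by (simp add: INT_Un prod.union_disjoint)
    qed
  qed
  then show ?thesis using rv by (auto simp: indep_vars_def2)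
qed

section \<open>The central limit theorem for blocks of noise\<close>

lemma cdf_distr_scale:
  fixes Z :: "'c \<Rightarrow> real"
  assumes "0 < k" and [measurable]: "Z \<in> borel_measurable N"
  shows "cdf (distr N borel (\<lambda>\<omega>. k * Z \<omega>)) x = cdf (distr N borel Z) (x / k)"
proof -
  have "(\<lambda>\<omega>. k * Z \<omega>) -` {..x} \<inter> space N = Z -` {..x / k} \<inter> space N"
    using \<open>0 < k\<close> by (auto simp: field_simps)
  then show ?thesis unfolding cdf_def by (simp add: measure_distr)
qed

lemma weak_conv_m_scale:
  fixes X :: "nat \<Rightarrow> 'a \<Rightarrow> real" and Y :: "'b \<Rightarrow> real" and k :: real
  assumes conv: "weak_conv_m (\<lambda>n. distr M borel (X n)) (distr Q borel Y)" and "0 < k"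
    and [measurable]: "\<And>n. X n \<in> borel_measurable M" "Y \<in> borel_measurable Q"
  shows "weak_conv_m (\<lambda>n. distr M borel (\<lambda>\<omega>. k * X n \<omega>)) (distr Q borel (\<lambda>\<omega>. k * Y \<omega>))"
proof -
  note c = cdf_distr_scale[OF \<open>0 < k\<close> assms(3)] cdf_distr_scale[OF \<open>0 < k\<close> assms(4)]
  show ?thesis unfolding weak_conv_m_def weak_conv_def
  proof (intro allI impI)
    fix x assume "isCont (cdf (distr Q borel (\<lambda>\<omega>. k * Y \<omega>))) x"
    moreover have "cdf (distr Q borel (\<lambda>\<omega>. k * Y \<omega>)) = (\<lambda>x. cdf (distr Q borel Y) (x / k))"
      by (rule ext) (rule c)
    ultimately have "isCont (\<lambda>x. cdf (distr Q borel Y) (x / k)) (k * (x / k))"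
      using \<open>0 < k\<close> by simp
    then have "isCont (\<lambda>y. (\<lambda>x. cdf (distr Q borel Y) (x / k)) (k * y)) (x / k)"
      by (rule isCont_o2[where f="\<lambda>y. k * y", rotated]) simp
    then have "isCont (cdf (distr Q borel Y)) (x / k)" using \<open>0 < k\<close> by simp
    then show "(\<lambda>n. cdf (distr M borel (\<lambda>\<omega>. k * X n \<omega>)) x) \<longlonglongrightarrow> cdf (distr Q borel (\<lambda>\<omega>. k * Y \<omega>)) x"
      using conv by (simp add: c weak_conv_m_def weak_conv_def)
  qed
qed

lemma (in prob_space) indep_vars_sum_disjoint:
  fixes e :: "'i \<Rightarrow> 'a \<Rightarrow> real"
  assumes e: "indep_vars (\<lambda>_. borel) e I" and K: "\<And>j. j \<in> L \<Longrightarrow> K j \<subseteq> I" "disjoint_family_on K L"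
  shows "indep_vars (\<lambda>_. borel) (\<lambda>j \<omega>. \<Sum>i\<in>K j. e i \<omega>) L"
proof -
  have "indep_vars (\<lambda>_. borel) (\<lambda>j \<omega>. (\<lambda>x. \<Sum>i\<in>K j. x i) (restrict (\<lambda>i. e i \<omega>) (K j))) L"
    by (rule indep_vars_compose2[OF indep_vars_restrict[OF e K]])
      (auto intro!: borel_measurable_sum measurable_component_singleton)
  then show ?thesis by (simp cong: indep_vars_cong)
qed

lemma (in prob_space) distr_sum_iid:
  fixes e :: "nat \<Rightarrow> 'a \<Rightarrow> real"
  assumes I: "indep_vars (\<lambda>_. borel) e I" "finite I" and J: "indep_vars (\<lambda>_. borel) e J" "finite J"
    and "card I = card J" and \<mu>: "\<And>i. i \<in> I \<union> J \<Longrightarrow> distr M borel (e i) = \<mu>"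
  shows "distr M borel (\<lambda>\<omega>. \<Sum>i\<in>I. e i \<omega>) = distr M borel (\<lambda>\<omega>. \<Sum>i\<in>J. e i \<omega>)"
proof (rule Levy_uniqueness)
  have rv: "i \<in> I \<union> J \<Longrightarrow> random_variable borel (e i)" for i
    using I J by (auto simp: indep_vars_def)
  show "real_distribution (distr M borel (\<lambda>\<omega>. \<Sum>i\<in>I. e i \<omega>))"
    "real_distribution (distr M borel (\<lambda>\<omega>. \<Sum>i\<in>J. e i \<omega>))"
    using rv by (intro real_distribution_distr borel_measurable_sum; auto)+
  show "char (distr M borel (\<lambda>\<omega>. \<Sum>i\<in>I. e i \<omega>)) = char (distr M borel (\<lambda>\<omega>. \<Sum>i\<in>J. e i \<omega>))"
    using assms(5) \<mu> by (simp add: fun_eq_iff char_distr_sum[OF I(1)] char_distr_sum[OF J(1)])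
qed

text \<open>The blocks may start anywhere and need not be initial sections of the sequence of steps, but
  they have the law of such sections. If \<open>v = 0\<close>, both sides are concentrated at \<open>0\<close>.\<close>

lemma (in prob_space) weak_conv_block_sum:
  fixes e :: "nat \<Rightarrow> 'a \<Rightarrow> real" and k start :: "nat \<Rightarrow> nat" and a b s v :: real and Y :: "'b \<Rightarrow> real"
  assumes e: "indep_vars (\<lambda>_. borel) e {1..}" "\<And>i. 1 \<le> i \<Longrightarrow> distr M borel (e i) = \<mu>"
    and mom: "\<And>i. 1 \<le> i \<Longrightarrow> integrable M (\<lambda>\<omega>. (e i \<omega>)\<^sup>2)" "\<And>i. 1 \<le> i \<Longrightarrow> expectation (e i) = 0"
      "\<And>i. 1 \<le> i \<Longrightarrow> expectation (\<lambda>\<omega>. (e i \<omega>)\<^sup>2) = v"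
    and k: "filterlim k at_top sequentially" and Q: "prob_space Q"
    and Y: "distributed Q lborel Y (normal_density 0 s)" and "0 < s" "0 < a" and b: "b * s = a * sqrt v"
  shows "weak_conv_m (\<lambda>n. distr M borel (\<lambda>\<omega>. a / sqrt (k n) * (\<Sum>i = start n + 1..start n + k n. e i \<omega>)))
    (distr Q borel (\<lambda>\<omega>. b * Y \<omega>))"
proof -
  interpret Q: prob_space Q by (rule Q)
  have em: "e i \<in> borel_measurable M" if "1 \<le> i" for i
    using e(1) that by (auto simp: indep_vars_def)
  have Ym[measurable]: "Y \<in> borel_measurable Q"
    using Y by (simp add: distributed_def)
  have bm[measurable]: "(\<lambda>\<omega>. \<Sum>i = start n + 1..start n + k n. e i \<omega>) \<in> borel_measurable M" for n
    by (intro borel_measurable_sum em) auto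
  have sm[measurable]: "(\<lambda>\<omega>. \<Sum>i = 1..k n. e i \<omega>) \<in> borel_measurable M" for n
    by (intro borel_measurable_sum em) auto
  note bm[simplified, measurable] sm[simplified, measurable]
  have "0 \<le> v" by (subst mom(3)[OF order_refl, symmetric]) simp
  show ?thesis
  proof (cases "v = 0")
    case True
    then have "b = 0" using b \<open>0 < s\<close> by simp
    have "AE \<omega> in M. \<forall>i\<in>{1..}. e i \<omega> = 0"
    proof (rule AE_ball_countable')
      fix i :: nat assume i: "i \<in> {1..}"
      have "AE \<omega> in M. (e i \<omega>)\<^sup>2 = 0"
        using mom(1,3)[of i] i True by (subst integral_nonneg_eq_0_iff_AE[symmetric]) auto
      then show "AE \<omega> in M. e i \<omega> = 0" by simp
    qed auto
    then have "AE \<omega> in M. a / sqrt (k n) * (\<Sum>i = start n + 1..start n + k n. e i \<omega>) = 0" for n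
      by eventually_elim simp
    then have "distr M borel (\<lambda>\<omega>. a / sqrt (k n) * (\<Sum>i = start n + 1..start n + k n. e i \<omega>)) = distr M borel (\<lambda>\<omega>. 0)" for n
      by (intro distr_cong_AE borel_measurable_times borel_measurable_const bm) auto
    moreover have "distr M borel (\<lambda>\<omega>. 0::real) = distr Q borel (\<lambda>\<omega>. b * Y \<omega>)"
      using \<open>b = 0\<close> by (simp add: distr_const Q.distr_const)
    ultimately show ?thesis by (simp add: weak_conv_m_def weak_conv_def)
  next
    case False
    then have v: "0 < v" using \<open>0 \<le> v\<close> by simp
    have indS: "indep_vars (\<lambda>_. borel) (\<lambda>i. e (Suc i)) UNIV"
      using indep_vars_sum_disjoint[OF e(1), of UNIV "\<lambda>j. {Suc j}"] by (auto simp: disjoint_family_on_def)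
    have "weak_conv_m (\<lambda>n. distr M borel (\<lambda>\<omega>. (\<Sum>i<n. e (Suc i) \<omega>) / sqrt (n * (sqrt v)\<^sup>2))) std_normal_distribution"
      by (rule central_limit_theorem_zero_mean[where \<mu>=\<mu>, OF indS]) (use mom e(2) v in auto)
    then have "weak_conv_m (\<lambda>n. distr M borel (\<lambda>\<omega>. (\<Sum>i<k n. e (Suc i) \<omega>) / sqrt (k n * v))) std_normal_distribution"
      using v by (auto simp: weak_conv_m_def weak_conv_def intro: filterlim_compose[OF _ k])
    also have "(\<lambda>n. distr M borel (\<lambda>\<omega>. (\<Sum>i<k n. e (Suc i) \<omega>) / sqrt (k n * v)))
        = (\<lambda>n. distr M borel (\<lambda>\<omega>. (\<Sum>i=1..k n. e i \<omega>) / sqrt (k n * v)))"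
      by (simp add: sum.atLeast1_atMost_eq)
    also have "std_normal_distribution = distr Q borel (\<lambda>\<omega>. Y \<omega> / s)"
    proof -
      have "distributed Q lborel (\<lambda>\<omega>. (Y \<omega> - 0) / s) std_normal_density"
        using Y \<open>0 < s\<close> Q.normal_standard_normal_convert[of s Y 0] by simp
      from distributed_distr_eq_density[OF this] show ?thesis
        by (simp cong: distr_cong)
    qed
    finally have "weak_conv_m (\<lambda>n. distr M borel (\<lambda>\<omega>. (\<Sum>i=1..k n. e i \<omega>) / sqrt (k n * v))) (distr Q borel (\<lambda>\<omega>. Y \<omega> / s))" .
    then have "weak_conv_m (\<lambda>n. distr M borel (\<lambda>\<omega>. (a * sqrt v) * ((\<Sum>i=1..k n. e i \<omega>) / sqrt (k n * v))))
        (distr Q borel (\<lambda>\<omega>. (a * sqrt v) * (Y \<omega> / s)))"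
      by (rule weak_conv_m_scale) (use v \<open>0 < a\<close> in auto)
    also have "(\<lambda>\<omega>. (a * sqrt v) * (Y \<omega> / s)) = (\<lambda>\<omega>. b * Y \<omega>)"
      using \<open>0 < s\<close> by (auto simp: b[symmetric])
    also have "(\<lambda>n. distr M borel (\<lambda>\<omega>. (a * sqrt v) * ((\<Sum>i=1..k n. e i \<omega>) / sqrt (k n * v))))
      = (\<lambda>n. distr M borel (\<lambda>\<omega>. a / sqrt (k n) * (\<Sum>i = start n + 1..start n + k n. e i \<omega>)))"
    proof
      fix n
      have "distr M borel (\<lambda>\<omega>. \<Sum>i=1..k n. e i \<omega>) = distr M borel (\<lambda>\<omega>. \<Sum>i=start n + 1..start n + k n. e i \<omega>)"
        by (rule distr_sum_iid) (auto intro: indep_vars_subset[OF e(1)] e(2))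
      then have "distr (distr M borel (\<lambda>\<omega>. \<Sum>i=1..k n. e i \<omega>)) borel (\<lambda>x. a / sqrt (k n) * x)
          = distr (distr M borel (\<lambda>\<omega>. \<Sum>i=start n + 1..start n + k n. e i \<omega>)) borel (\<lambda>x. a / sqrt (k n) * x)"
        by simp
      moreover have "(\<lambda>\<omega>. (a * sqrt v) * ((\<Sum>i=1..k n. e i \<omega>) / sqrt (k n * v))) = (\<lambda>\<omega>. a / sqrt (k n) * (\<Sum>i=1..k n. e i \<omega>))"
        using v by (auto simp: real_sqrt_mult field_simps)
      ultimately show "distr M borel (\<lambda>\<omega>. (a * sqrt v) * ((\<Sum>i=1..k n. e i \<omega>) / sqrt (k n * v)))
        = distr M borel (\<lambda>\<omega>. a / sqrt (k n) * (\<Sum>i = start n + 1..start n + k n. e i \<omega>))"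
        by (simp add: distr_distr comp_def)
    qed
    finally show ?thesis .
  qed
qed

section \<open>Compound sums on a half line\<close>

text \<open>Chebyshev's inequality; \<open>l\<close> is the mean and the variance.\<close>

lemma poisson_pmf_deviation:
  fixes l a :: real
  assumes l: "0 < l" and a: "0 < a"
  shows "measure (poisson_pmf l) {k. a \<le> \<bar>real k - l\<bar>} \<le> l / a\<^sup>2"
proof -
  define w where "w k = l ^ k / fact k * exp (- l)" for k :: nat
  have pmf: "pmf (poisson_pmf l) k = w k" for k using l by (simp add: w_def)
  have w0: "0 \<le> w k" for k using l by (simp add: w_def)
  have wS: "real (Suc k) * w (Suc k) = l * w k" for k
    by (simp add: w_def field_simps del: of_nat_Suc)
  have s0: "w sums 1"
  proof -
    have "(\<lambda>k. l ^ k /\<^sub>R fact k * exp (- l)) sums (exp l * exp (- l))"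
      by (intro sums_mult2 exp_converges)
    then show ?thesis by (simp add: w_def[abs_def] exp_minus field_simps)
  qed
  have s1: "(\<lambda>k. k * w k) sums l"
    using sums_Suc[of "\<lambda>k. k * w k" l] sums_mult[OF s0, of l] by (simp add: wS del: of_nat_Suc)
  have s2: "(\<lambda>k. (real k)\<^sup>2 * w k) sums (l * l + l)"
  proof -
    have "(real (Suc k))\<^sup>2 * w (Suc k) = l * (k * w k) + l * w k" for k
    proof -
      have "(real (Suc k))\<^sup>2 * w (Suc k) = real (Suc k) * (real (Suc k) * w (Suc k))"
        by (simp only: power2_eq_square mult.assoc)
      also have "\<dots> = l * (k * w k) + l * w k" unfolding wS by (simp add: algebra_simps)
      finally show ?thesis .
    qed
    moreover have "(\<lambda>k. l * (k * w k) + l * w k) sums (l * l + l * 1)"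
      by (intro sums_add sums_mult s0 s1)
    ultimately show ?thesis
      using sums_Suc[of "\<lambda>k. (real k)\<^sup>2 * w k" "l * l + l"] by simp
  qed
  have int: "integrable (measure_pmf (poisson_pmf l)) g \<and> measure_pmf.expectation (poisson_pmf l) g = s"
    if "(\<lambda>k. g k * w k) sums s" "\<And>k. 0 \<le> g k" for g :: "nat \<Rightarrow> real" and s
  proof -
    have i: "integrable (count_space UNIV) (\<lambda>k. w k * g k)"
      using that w0 by (auto simp: integrable_count_space_nat_iff abs_mult mult.commute dest: sums_summable)
    have "measure_pmf.expectation (poisson_pmf l) g = (\<Sum>k. w k * g k)"
      using w0 unfolding measure_pmf_eq_density
      by (subst integral_real_density) (auto simp: pmf integral_count_space_nat[OF i])
    moreover have "integrable (measure_pmf (poisson_pmf l)) g"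
      using w0 i unfolding measure_pmf_eq_density by (subst integrable_real_density) (auto simp: pmf)
    ultimately show ?thesis using sums_unique[OF that(1)] by (simp add: mult.commute)
  qed
  have m: "measure_pmf.expectation (poisson_pmf l) real = l" using int[of real l] s1 by simp
  have sq: "integrable (measure_pmf (poisson_pmf l)) (\<lambda>k. (real k)\<^sup>2)"
    using int[of "\<lambda>k. (real k)\<^sup>2"] s2 by simp
  have "(\<lambda>k. (real k)\<^sup>2 * w k + - 2 * l * (k * w k) + l\<^sup>2 * w k) sums (l * l + l + - 2 * l * l + l\<^sup>2 * 1)"
    by (intro sums_add sums_mult s0 s1 s2)
  then have "(\<lambda>k. (real k - l)\<^sup>2 * w k) sums l"
    by (simp add: power2_eq_square algebra_simps)
  then have "measure_pmf.variance (poisson_pmf l) real = l" using int[of "\<lambda>k. (real k - l)\<^sup>2" l] m by simp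
  then show ?thesis
    using measure_pmf.Chebyshev_inequality[of real "poisson_pmf l" a] sq a m by simp
qed

lemma poisson_process_deviation:
  fixes N :: "real \<Rightarrow> 'm \<Rightarrow> nat" and r s t a :: real
  assumes "prob_space M" and N: "poisson_process M r N" and "0 < r" "0 \<le> s" "s < t" "0 < a"
  shows "measure M {\<omega> \<in> space M. a \<le> \<bar>real (N t \<omega>) - real (N s \<omega>) - r * (t - s)\<bar>} \<le> r * (t - s) / a\<^sup>2"
proof -
  have [measurable]: "N t \<in> measurable M (count_space UNIV)" "N s \<in> measurable M (count_space UNIV)"
    using assms by (auto simp: poisson_process_def)
  have m: "(\<lambda>\<omega>. N t \<omega> - N s \<omega>) \<in> measurable M (count_space UNIV)"
    by measurable
  have d: "distr M (count_space UNIV) (\<lambda>\<omega>. N t \<omega> - N s \<omega>) = measure_pmf (poisson_pmf (r * (t - s)))"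
    using N assms by (auto simp: poisson_process_def)
  have le: "N s \<omega> \<le> N t \<omega>" if "\<omega> \<in> space M" for \<omega>
    using N that assms by (auto simp: poisson_process_def mono_on_def)
  have "measure M {\<omega> \<in> space M. a \<le> \<bar>real (N t \<omega>) - real (N s \<omega>) - r * (t - s)\<bar>}
      = measure M ((\<lambda>\<omega>. N t \<omega> - N s \<omega>) -` {k. a \<le> \<bar>real k - r * (t - s)\<bar>} \<inter> space M)"
    using le by (intro arg_cong[where f="measure M"]) auto
  also have "\<dots> = measure (poisson_pmf (r * (t - s))) {k. a \<le> \<bar>real k - r * (t - s)\<bar>}"
    unfolding d[symmetric] by (rule measure_distr[OF m, symmetric]) simp
  also have "\<dots> \<le> r * (t - s) / a\<^sup>2"
    using assms by (intro poisson_pmf_deviation) auto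
  finally show ?thesis .
qed

text \<open>Each half of \<open>\<Lambda>\<close> is such a walk: a random walk with centred steps \<open>e j\<close> plus the increasing
  drift \<open>\<phi> (c * S j)\<close>. The estimates treat arrivals and steps one at a time, by a law of large
  numbers for the former and a maximal inequality for the latter.\<close>

locale compound_walk = prob_space M for M :: "'m measure" +
  fixes r v D :: real and N :: "real \<Rightarrow> 'm \<Rightarrow> nat" and e :: "nat \<Rightarrow> 'm \<Rightarrow> real" and \<phi> :: "real \<Rightarrow> real"
  assumes r_pos: "0 < r" and N: "poisson_process M r N"
    and e_indep: "indep_vars (\<lambda>_. borel) e {1..}"
    and e_square: "\<And>i. 1 \<le> i \<Longrightarrow> integrable M (\<lambda>\<omega>. (e i \<omega>)\<^sup>2)"
    and e_mean: "\<And>i. 1 \<le> i \<Longrightarrow> expectation (e i) = 0"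
    and e_variance: "\<And>i. 1 \<le> i \<Longrightarrow> expectation (\<lambda>\<omega>. (e i \<omega>)\<^sup>2) = v"
    and \<phi>_mono: "mono_on {0..} \<phi>" and \<phi>_0: "\<phi> 0 = 0"
    and \<phi>_deriv: "((\<lambda>x. \<phi> x / x) \<longlongrightarrow> D) (at_right 0)" and D_pos: "0 < D"
begin

definition noise :: "'m \<Rightarrow> nat \<Rightarrow> real" where "noise \<omega> n = (\<Sum>j=1..n. e j \<omega>)"

definition drift :: "real \<Rightarrow> 'm \<Rightarrow> real \<Rightarrow> real" where
  "drift c \<omega> h = (\<Sum>j=1..N h \<omega>. \<phi> (c * arrival_time N j \<omega>))"

definition walk :: "real \<Rightarrow> 'm \<Rightarrow> real \<Rightarrow> real" where
  "walk c \<omega> h = noise \<omega> (N h \<omega>) + drift c \<omega> h"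

lemma e_measurable[measurable]: "1 \<le> i \<Longrightarrow> e i \<in> borel_measurable M"
  using e_indep by (auto simp: indep_vars_def)

lemma N_measurable: "0 \<le> t \<Longrightarrow> N t \<in> measurable M (count_space UNIV)"
  using N by (auto simp: poisson_process_def)

lemma N_0: "\<omega> \<in> space M \<Longrightarrow> N 0 \<omega> = 0"
  using N by (auto simp: poisson_process_def)

lemma N_mono: "\<omega> \<in> space M \<Longrightarrow> 0 \<le> s \<Longrightarrow> s \<le> t \<Longrightarrow> N s \<omega> \<le> N t \<omega>"
  using N by (auto simp: poisson_process_def mono_on_def)

lemma arrival_time_le: "0 \<le> t \<Longrightarrow> j \<le> N t \<omega> \<Longrightarrow> arrival_time N j \<omega> \<le> t"
  unfolding arrival_time_def by (rule cInf_lower) (auto intro!: bdd_belowI[of _ 0])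

lemma arrival_time_ge:
  assumes "\<omega> \<in> space M" "0 \<le> s" "0 \<le> t" "N s \<omega> < j" "j \<le> N t \<omega>"
  shows "s \<le> arrival_time N j \<omega>"
  unfolding arrival_time_def
proof (rule cInf_greatest)
  show "s \<le> x" if "x \<in> {t. 0 \<le> t \<and> j \<le> N t \<omega>}" for x
  proof (rule ccontr)
    assume "\<not> s \<le> x"
    then have "N x \<omega> \<le> N s \<omega>" using that assms by (intro N_mono) auto
    then show False using that assms by auto
  qed
qed (use assms in auto)

lemma \<phi>_nonneg: "0 \<le> x \<Longrightarrow> 0 \<le> \<phi> x"
  using \<phi>_mono \<phi>_0 unfolding mono_on_def by (metis atLeast_iff order_refl)

lemma drift_increment:
  assumes "\<omega> \<in> space M" "0 \<le> s" "s \<le> t" "0 \<le> c"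
  shows "(real (N t \<omega>) - real (N s \<omega>)) * \<phi> (c * s) \<le> drift c \<omega> t - drift c \<omega> s"
    and "drift c \<omega> t - drift c \<omega> s \<le> (real (N t \<omega>) - real (N s \<omega>)) * \<phi> (c * t)"
proof -
  have le: "N s \<omega> \<le> N t \<omega>" using assms by (intro N_mono)
  have "{1..N t \<omega>} = {1..N s \<omega>} \<union> {N s \<omega><..N t \<omega>}" using le by auto
  then have eq: "drift c \<omega> t - drift c \<omega> s = (\<Sum>j\<in>{N s \<omega><..N t \<omega>}. \<phi> (c * arrival_time N j \<omega>))"
    unfolding drift_def by (simp only:) (subst sum.union_disjoint, auto)
  have b: "\<phi> (c * s) \<le> \<phi> (c * arrival_time N j \<omega>) \<and> \<phi> (c * arrival_time N j \<omega>) \<le> \<phi> (c * t)"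
    if "j \<in> {N s \<omega><..N t \<omega>}" for j
  proof -
    have "s \<le> arrival_time N j \<omega>" using that assms by (intro arrival_time_ge[of _ _ t]) auto
    moreover have "arrival_time N j \<omega> \<le> t" using that assms by (intro arrival_time_le) auto
    ultimately show ?thesis
      using assms by (auto intro!: mono_onD[OF \<phi>_mono] mult_left_mono mult_nonneg_nonneg)
  qed
  have card: "real (card {N s \<omega><..N t \<omega>}) = real (N t \<omega>) - real (N s \<omega>)" using le by simp
  show "(real (N t \<omega>) - real (N s \<omega>)) * \<phi> (c * s) \<le> drift c \<omega> t - drift c \<omega> s"
    unfolding eq card[symmetric] using b by (intro sum_bounded_below) auto
  show "drift c \<omega> t - drift c \<omega> s \<le> (real (N t \<omega>) - real (N s \<omega>)) * \<phi> (c * t)"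
    unfolding eq card[symmetric] using b by (intro sum_bounded_above) auto
qed

lemma drift_mono:
  assumes "\<omega> \<in> space M" "0 \<le> s" "s \<le> t" "0 \<le> c"
  shows "drift c \<omega> s \<le> drift c \<omega> t"
proof -
  have "0 \<le> (real (N t \<omega>) - real (N s \<omega>)) * \<phi> (c * s)"
    using N_mono[OF assms(1-3)] assms by (intro mult_nonneg_nonneg \<phi>_nonneg) auto
  then show ?thesis using drift_increment(1)[OF assms] by simp
qed

lemma drift_0: "\<omega> \<in> space M \<Longrightarrow> drift c \<omega> 0 = 0"
  by (simp add: drift_def N_0)

lemma drift_nonneg: "\<omega> \<in> space M \<Longrightarrow> 0 \<le> t \<Longrightarrow> 0 \<le> c \<Longrightarrow> 0 \<le> drift c \<omega> t"
  using drift_mono[of \<omega> 0 t c] drift_0 by simp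

text \<open>The slope at \<open>0\<close> gives linear growth up to some \<open>x0\<close>, and monotonicity preserves the level
  reached there.\<close>

lemma \<phi>_lower_bound: "\<exists>a>0. \<exists>x0>0. \<forall>x\<ge>0. a * min x x0 \<le> \<phi> x"
proof -
  have "\<forall>\<^sub>F x in at_right 0. D / 2 < \<phi> x / x"
    using \<phi>_deriv D_pos by (intro order_tendstoD) auto
  then obtain b where b: "0 < b" "\<And>x. 0 < x \<Longrightarrow> x < b \<Longrightarrow> D / 2 < \<phi> x / x"
    unfolding eventually_at_right_field by auto
  have small: "D / 2 * x \<le> \<phi> x" if "0 \<le> x" "x < b" for x
    using b(2)[of x] that \<phi>_0 by (cases "x = 0") (auto simp: field_simps)
  have "D / 2 * min x (b / 2) \<le> \<phi> x" if "0 \<le> x" for x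
  proof -
    have "D / 2 * min x (b / 2) \<le> \<phi> (min x (b / 2))" using that b(1) by (intro small) auto
    also have "\<dots> \<le> \<phi> x" using that b(1) by (intro mono_onD[OF \<phi>_mono]) auto
    finally show ?thesis .
  qed
  then show ?thesis using D_pos b(1) by (intro exI[of _ "D/2"] conjI exI[of _ "b/2"]) auto
qed

lemma prob_max_noise_ge:
  fixes n :: nat and l :: real
  assumes "0 < l"
  shows "prob {\<omega> \<in> space M. \<exists>k\<le>n. 2 * l \<le> \<bar>noise \<omega> k\<bar>} \<le> 2 * (n * v / l\<^sup>2)"
proof -
  have "indep_vars (\<lambda>_. borel) (\<lambda>i. e (Suc i)) {..<n}"
    using indep_vars_sum_disjoint[OF e_indep, of "{..<n}" "\<lambda>j. {Suc j}"] by (auto simp: disjoint_family_on_def)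
  from prob_max_sum_ge[OF this, of v l] show ?thesis
    using e_square e_mean e_variance assms by (simp add: noise_def sum.atLeast1_atMost_eq)
qed

lemma noise_measurable[measurable]: "(\<lambda>\<omega>. noise \<omega> k) \<in> borel_measurable M"
  unfolding noise_def by (intro borel_measurable_sum) auto

lemma v_nonneg: "0 \<le> v"
  by (subst e_variance[OF order_refl, symmetric]) simp

text \<open>On \<open>[t, 2 t]\<close> the arrivals of \<open>[t/2, t]\<close> alone, about \<open>r t / 2\<close> of them, contribute at least
  \<open>r t / 4 * \<phi> (c t / 2)\<close> to the drift, and the noise is unlikely to get that large.\<close>

lemma walk_positive_dyadic:
  assumes a: "0 < a" "0 < x0" "\<And>x. 0 \<le> x \<Longrightarrow> a * min x x0 \<le> \<phi> x" and c: "0 < c" and t: "0 < t"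
  shows "\<exists>B\<in>events. prob B \<le> (9 / r + 512 * v / (r * a\<^sup>2) * (4 + 1 / x0\<^sup>2)) * (1 / (c\<^sup>2 * t ^ 3) + 1 / t) \<and>
    (\<forall>\<omega>\<in>space M - B. \<forall>h. t \<le> h \<longrightarrow> h \<le> 2 * t \<longrightarrow> 0 < walk c \<omega> h)"
proof -
  define m where "m = min (c * t / 2) x0"
  define l where "l = r * t / 8 * (a * m)"
  define n where "n = nat \<lfloor>4 * r * t\<rfloor>"
  have m: "0 < m" using a c t by (simp add: m_def)
  have l: "0 < l" using a m t r_pos by (simp add: l_def)
  let ?B1 = "{\<omega> \<in> space M. r * t / 4 \<le> \<bar>real (N t \<omega>) - real (N (t / 2) \<omega>) - r * (t - t / 2)\<bar>}"
  let ?B2 = "{\<omega> \<in> space M. 2 * r * t \<le> \<bar>real (N (2 * t) \<omega>) - real (N 0 \<omega>) - r * (2 * t - 0)\<bar>}"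
  let ?B3 = "{\<omega> \<in> space M. \<exists>k\<le>n. 2 * l \<le> \<bar>noise \<omega> k\<bar>}"
  have [measurable]: "N t \<in> measurable M (count_space UNIV)" "N (t / 2) \<in> measurable M (count_space UNIV)"
    "N (2 * t) \<in> measurable M (count_space UNIV)" "N 0 \<in> measurable M (count_space UNIV)"
    using t by (auto intro: N_measurable)
  have B: "?B1 \<in> events" "?B2 \<in> events" "?B3 \<in> events" by measurable
  have p1: "prob ?B1 \<le> 8 / (r * t)"
    using poisson_process_deviation[OF prob_space_axioms N r_pos, of "t / 2" t "r * t / 4"] t r_pos
    by (simp add: power2_eq_square field_simps)
  have p2: "prob ?B2 \<le> 1 / (2 * (r * t))"
    using poisson_process_deviation[OF prob_space_axioms N r_pos, of 0 "2 * t" "2 * r * t"] t r_pos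
    by (simp add: power2_eq_square field_simps)
  have im: "1 / m\<^sup>2 \<le> 4 / (c\<^sup>2 * t\<^sup>2) + 1 / x0\<^sup>2"
  proof (cases "c * t / 2 \<le> x0")
    case True
    then have "1 / m\<^sup>2 = 4 / (c\<^sup>2 * t\<^sup>2)" using c t by (simp add: m_def power_mult_distrib power_divide)
    then show ?thesis by simp
  next
    case False
    then have "1 / m\<^sup>2 = 1 / x0\<^sup>2" by (simp add: m_def)
    then show ?thesis by simp
  qed
  have "prob ?B3 \<le> 2 * (n * v / l\<^sup>2)" by (rule prob_max_noise_ge[OF l])
  also have "\<dots> \<le> 2 * (4 * r * t * v / l\<^sup>2)"
  proof -
    have "real n \<le> 4 * r * t" using r_pos t by (simp add: n_def)
    then show ?thesis using v_nonneg by (intro mult_left_mono divide_right_mono mult_right_mono) auto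
  qed
  also have "\<dots> = 512 * v / (r * a\<^sup>2) * (1 / t) * (1 / m\<^sup>2)"
    using r_pos t a m by (simp add: l_def power2_eq_square field_simps)
  also have "\<dots> \<le> 512 * v / (r * a\<^sup>2) * (1 / t) * (4 / (c\<^sup>2 * t\<^sup>2) + 1 / x0\<^sup>2)"
    using r_pos t a v_nonneg by (intro mult_left_mono im) auto
  also have "\<dots> = 512 * v / (r * a\<^sup>2) * (4 * (1 / (c\<^sup>2 * t ^ 3)) + 1 / x0\<^sup>2 * (1 / t))"
    using r_pos t a c by (simp add: power2_eq_square power3_eq_cube field_simps)
  also have "\<dots> \<le> 512 * v / (r * a\<^sup>2) * ((4 + 1 / x0\<^sup>2) * (1 / (c\<^sup>2 * t ^ 3) + 1 / t))"
  proof (rule mult_left_mono)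
    have *: "4 * x + z * y \<le> (4 + z) * (x + y)" if "0 \<le> x" "0 \<le> y" "0 \<le> z" for x y z :: real
      using that by (simp add: algebra_simps)
    show "4 * (1 / (c\<^sup>2 * t ^ 3)) + 1 / x0\<^sup>2 * (1 / t) \<le> (4 + 1 / x0\<^sup>2) * (1 / (c\<^sup>2 * t ^ 3) + 1 / t)"
      by (rule *) (use t in auto)
  qed (use r_pos v_nonneg in auto)
  finally have p3: "prob ?B3 \<le> 512 * v / (r * a\<^sup>2) * ((4 + 1 / x0\<^sup>2) * (1 / (c\<^sup>2 * t ^ 3) + 1 / t))" .
  have p12: "8 / (r * t) + 1 / (2 * (r * t)) \<le> 9 / r * (1 / (c\<^sup>2 * t ^ 3) + 1 / t)"
  proof -
    have "8 / (r * t) + 1 / (2 * (r * t)) \<le> 9 / r * (1 / t)" using r_pos t by (simp add: field_simps)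
    also have "\<dots> \<le> 9 / r * (1 / (c\<^sup>2 * t ^ 3) + 1 / t)" using r_pos t c by (intro mult_left_mono) auto
    finally show ?thesis .
  qed
  have "prob (?B1 \<union> ?B2 \<union> ?B3) \<le> prob (?B1 \<union> ?B2) + prob ?B3" using B by (intro measure_Un_le) auto
  also have "\<dots> \<le> prob ?B1 + prob ?B2 + prob ?B3" using B by (intro add_right_mono measure_Un_le) auto
  also have "\<dots> \<le> (9 / r + 512 * v / (r * a\<^sup>2) * (4 + 1 / x0\<^sup>2)) * (1 / (c\<^sup>2 * t ^ 3) + 1 / t)"
    using p1 p2 p3 p12 unfolding distrib_right mult.assoc by linarith
  finally have p: "prob (?B1 \<union> ?B2 \<union> ?B3) \<le> \<dots>" .
  have pos: "0 < walk c \<omega> h" if \<omega>: "\<omega> \<in> space M - (?B1 \<union> ?B2 \<union> ?B3)" and h: "t \<le> h" "h \<le> 2 * t" for \<omega> h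
  proof -
    have \<omega>M: "\<omega> \<in> space M" using \<omega> by auto
    have n1: "r * t / 4 < real (N t \<omega>) - real (N (t / 2) \<omega>)" 
    proof -
      have "\<not> r * t / 4 \<le> \<bar>real (N t \<omega>) - real (N (t / 2) \<omega>) - r * (t - t / 2)\<bar>" using \<omega> \<omega>M by blast
      moreover have "r * (t - t / 2) = r * t / 2" by simp
      ultimately show ?thesis by linarith
    qed
    have "real (N (2 * t) \<omega>) < 4 * r * t" using \<omega> N_0[OF \<omega>M] by (auto simp: field_simps)
    moreover have "N h \<omega> \<le> N (2 * t) \<omega>" using h t \<omega>M by (intro N_mono) auto
    ultimately have "real (N h \<omega>) \<le> 4 * r * t" by linarith
    then have "N h \<omega> \<le> n" unfolding n_def by (simp add: le_nat_floor)
    then have noise: "\<bar>noise \<omega> (N h \<omega>)\<bar> < 2 * l" using \<omega> by auto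
    have "2 * l \<le> r * t / 4 * \<phi> (c * (t / 2))"
      using a(3)[of "c * (t / 2)"] c t r_pos by (simp add: l_def m_def)
    also have "\<dots> \<le> (real (N t \<omega>) - real (N (t / 2) \<omega>)) * \<phi> (c * (t / 2))"
      using n1 c t by (intro mult_right_mono \<phi>_nonneg) auto
    also have "\<dots> \<le> drift c \<omega> t - drift c \<omega> (t / 2)"
      using \<omega>M t c by (intro drift_increment) auto
    also have "\<dots> \<le> drift c \<omega> h"
      using drift_mono[OF \<omega>M, of t h c] drift_nonneg[OF \<omega>M, of "t/2" c] h t c by simp
    finally show ?thesis using noise by (simp add: walk_def)
  qed
  show ?thesis by (rule bexI[of _ "?B1 \<union> ?B2 \<union> ?B3"]) (use p pos B in auto)
qed

text \<open>The dyadic bounds are summed over \<open>t = 2 ^ k * h1\<close>. For fixed \<open>c\<close> they show that the walk is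
  almost surely positive far out; for \<open>h1 = K * c powr (-2/3)\<close> the first term is \<open>1 / K ^ 3\<close>, so that
  the minimizer is of order \<open>c powr (-2/3)\<close> uniformly in small \<open>c\<close>.\<close>

lemma walk_positive_tail:
  "\<exists>C. \<forall>c>0. \<forall>h1>0. \<exists>B\<in>events. prob B \<le> C * (1 / (c\<^sup>2 * h1 ^ 3) + 1 / h1) \<and>
    (\<forall>\<omega>\<in>space M - B. \<forall>h\<ge>h1. 0 < walk c \<omega> h)"
proof -
  obtain a x0 where a: "0 < a" "0 < x0" "\<And>x. 0 \<le> x \<Longrightarrow> a * min x x0 \<le> \<phi> x"
    using \<phi>_lower_bound by blast
  define C where "C = 9 / r + 512 * v / (r * a\<^sup>2) * (4 + 1 / x0\<^sup>2)"
  have C: "0 \<le> C" using r_pos a v_nonneg by (simp add: C_def)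
  have "\<exists>B\<in>events. prob B \<le> 2 * C * (1 / (c\<^sup>2 * h1 ^ 3) + 1 / h1) \<and>
    (\<forall>\<omega>\<in>space M - B. \<forall>h\<ge>h1. 0 < walk c \<omega> h)" if c: "0 < c" and h1: "0 < h1" for c h1
  proof -
    have "\<forall>k::nat. \<exists>B. B \<in> events \<and> prob B \<le> C * (1 / (c\<^sup>2 * (2 ^ k * h1) ^ 3) + 1 / (2 ^ k * h1)) \<and>
        (\<forall>\<omega>\<in>space M - B. \<forall>h. 2 ^ k * h1 \<le> h \<longrightarrow> h \<le> 2 * (2 ^ k * h1) \<longrightarrow> 0 < walk c \<omega> h)"
    proof
      fix k :: nat
      show "\<exists>B. B \<in> events \<and> prob B \<le> C * (1 / (c\<^sup>2 * (2 ^ k * h1) ^ 3) + 1 / (2 ^ k * h1)) \<and>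
        (\<forall>\<omega>\<in>space M - B. \<forall>h. 2 ^ k * h1 \<le> h \<longrightarrow> h \<le> 2 * (2 ^ k * h1) \<longrightarrow> 0 < walk c \<omega> h)"
        using walk_positive_dyadic[OF a c, of "2 ^ k * h1"] h1 unfolding C_def by auto
    qed
    then obtain B where B: "\<And>k::nat. B k \<in> events"
      "\<And>k. prob (B k) \<le> C * (1 / (c\<^sup>2 * (2 ^ k * h1) ^ 3) + 1 / (2 ^ k * h1))"
      "\<And>k \<omega> h. \<omega> \<in> space M - B k \<Longrightarrow> 2 ^ k * h1 \<le> h \<Longrightarrow> h \<le> 2 * (2 ^ k * h1) \<Longrightarrow> 0 < walk c \<omega> h"
      unfolding choice_iff by auto
    let ?u = "C * (1 / (c\<^sup>2 * h1 ^ 3) + 1 / h1)"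
    have pk: "prob (B k) \<le> ?u * (1 / 2) ^ k" for k
    proof -
      have e1: "1 / (c\<^sup>2 * (2 ^ k * h1) ^ 3) \<le> 1 / (c\<^sup>2 * h1 ^ 3) * (1 / 2) ^ k"
      proof -
        have "(2::real) ^ k \<le> (2 ^ k) ^ 3" by (simp add: self_le_power)
        then show ?thesis using c h1 by (simp add: power_mult_distrib field_simps)
      qed
      have "C * (1 / (c\<^sup>2 * (2 ^ k * h1) ^ 3) + 1 / (2 ^ k * h1)) \<le> C * ((1 / (c\<^sup>2 * h1 ^ 3) + 1 / h1) * (1 / 2) ^ k)"
        using e1 C by (intro mult_left_mono) (auto simp: algebra_simps power_divide)
      then show ?thesis using B(2)[of k] by (simp add: mult.assoc)
    qed
    have gs: "(\<lambda>k. ?u * (1 / 2) ^ k) sums (?u * 2)"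
      using geometric_sums[of "1/2::real"] by (intro sums_mult) simp
    have summ: "summable (\<lambda>k. prob (B k))"
      by (rule summable_comparison_test'[OF sums_summable[OF gs], of 0]) (use pk in auto)
    have "prob (\<Union>k. B k) \<le> (\<Sum>k. prob (B k))"
      by (rule finite_measure_subadditive_countably) (use B summ in auto)
    also have "\<dots> \<le> (\<Sum>k. ?u * (1 / 2) ^ k)"
      by (rule suminf_le[OF pk summ sums_summable[OF gs]])
    also have "\<dots> = 2 * ?u" using sums_unique[OF gs] by (metis mult.commute)
    finally have p: "prob (\<Union>k. B k) \<le> 2 * ?u" .
    have "0 < walk c \<omega> h" if \<omega>: "\<omega> \<in> space M - (\<Union>k. B k)" and h: "h1 \<le> h" for \<omega> h
    proof -
      have "1 \<le> nat \<lfloor>h / h1\<rfloor>" using h h1 by (simp add: le_nat_iff)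
      then obtain k where k: "2 ^ k \<le> nat \<lfloor>h / h1\<rfloor>" "nat \<lfloor>h / h1\<rfloor> < 2 ^ (k + 1)"
        using ex_power_ivl1[of 2 "nat \<lfloor>h / h1\<rfloor>"] by auto
      have "real (2 ^ k) \<le> h / h1" using k(1) h h1 by (simp add: le_nat_iff le_floor_iff)
      moreover have "h / h1 < real (2 ^ (k + 1))" using k(2) h h1 by (simp add: nat_less_iff floor_less_iff)
      ultimately show ?thesis
        using B(3)[of \<omega> k h] \<omega> h1 by (simp add: field_simps)
    qed
    then show ?thesis using p B by (intro bexI[of _ "\<Union>k. B k"]) (auto simp: mult.assoc)
  qed
  then show ?thesis by blast
qed

end

section \<open>Compound sums and blocks of steps\<close>

lemma (in prob_space) prob_UN_le:
  fixes d :: nat and a :: real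
  assumes "\<And>l. l \<le> d \<Longrightarrow> A l \<in> events" "\<And>l. l \<le> d \<Longrightarrow> prob (A l) \<le> a"
  shows "(\<Union>l\<le>d. A l) \<in> events" "prob (\<Union>l\<le>d. A l) \<le> (real d + 1) * a"
proof -
  show "(\<Union>l\<le>d. A l) \<in> events" using assms(1) by (intro sets.finite_UN) auto
  have "prob (\<Union>l\<le>d. A l) \<le> (\<Sum>l\<le>d. prob (A l))"
    using assms(1) by (intro finite_measure_subadditive_finite) auto
  also have "\<dots> \<le> real (card {..d}) * a" using assms(2) by (intro sum_bounded_above) auto
  finally show "prob (\<Union>l\<le>d. A l) \<le> (real d + 1) * a" by (simp add: add.commute)
qed

context compound_walk
begin

lemma noise_add: "noise \<omega> (m + k) = noise \<omega> m + (\<Sum>j=m+1..m+k. e j \<omega>)"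
proof -
  have "{1..m + k} = {1..m} \<union> {m+1..m+k}" by auto
  then show ?thesis unfolding noise_def by (simp only:) (subst sum.union_disjoint, auto)
qed

text \<open>From \<open>i * k\<close> one reaches \<open>m\<close> across at most two of the blocks of length \<open>k\<close>, or goes back within
  one of them, whose start is then compared with both ends.\<close>

lemma noise_block_oscillation:
  assumes osc: "\<And>l j. l \<le> d \<Longrightarrow> j \<le> k \<Longrightarrow> \<bar>noise \<omega> (l * k + j) - noise \<omega> (l * k)\<bar> \<le> x"
    and i: "i < d" and m: "i * k \<le> m + k" "m \<le> (i + 2) * k"
  shows "\<bar>noise \<omega> m - noise \<omega> (i * k)\<bar> \<le> 2 * x"
proof -
  have x: "0 \<le> x" using osc[of 0 0] by simp
  consider (a) "i * k \<le> m" "m \<le> (i + 1) * k" | (b) "(i + 1) * k < m" | (c) "m < i * k" by linarith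
  then show ?thesis
  proof cases
    case a
    then obtain j where "m = i * k + j" "j \<le> k" by (auto simp: le_iff_add)
    then show ?thesis using osc[of i j] i x by simp
  next
    case b
    then obtain j where j: "m = (i + 1) * k + j" "j \<le> k" using m(2) by (auto simp: less_iff_Suc_add algebra_simps)
    have "\<bar>noise \<omega> m - noise \<omega> ((i + 1) * k)\<bar> \<le> x" using osc[of "i + 1" j] i j by simp
    moreover have "\<bar>noise \<omega> ((i + 1) * k) - noise \<omega> (i * k)\<bar> \<le> x"
      using osc[of i k] i by (simp add: algebra_simps)
    ultimately show ?thesis by linarith
  next
    case c
    then have "0 < i" by (cases i) auto
    then obtain i' where i': "i = Suc i'" by (cases i) auto
    then obtain j where j: "m = i' * k + j" using m(1) by (auto simp: le_iff_add)
    then have "j \<le> k" using c i' by simp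
    have "\<bar>noise \<omega> m - noise \<omega> (i' * k)\<bar> \<le> x" using osc[of i' j] i i' j \<open>j \<le> k\<close> by simp
    moreover have "\<bar>noise \<omega> (i * k) - noise \<omega> (i' * k)\<bar> \<le> x"
      using osc[of i' k] i i' by (simp add: algebra_simps)
    ultimately show ?thesis by linarith
  qed
qed

lemma prob_block_oscillation:
  fixes k l :: nat and q x \<beta> :: real
  assumes "0 < q" "0 < x" and small: "8 * q\<^sup>2 * k * v \<le> x\<^sup>2"
    and last: "prob {\<omega> \<in> space M. x / 2 \<le> \<bar>q * (\<Sum>j=l*k+1..l*k+k. e j \<omega>)\<bar>} \<le> \<beta>"
  shows "{\<omega> \<in> space M. \<exists>j\<le>k. x \<le> q * \<bar>noise \<omega> (l * k + j) - noise \<omega> (l * k)\<bar>} \<in> events"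
    and "prob {\<omega> \<in> space M. \<exists>j\<le>k. x \<le> q * \<bar>noise \<omega> (l * k + j) - noise \<omega> (l * k)\<bar>} \<le> 2 * \<beta>"
proof -
  show "{\<omega> \<in> space M. \<exists>j\<le>k. x \<le> q * \<bar>noise \<omega> (l * k + j) - noise \<omega> (l * k)\<bar>} \<in> events"
    by measurable
  let ?X = "\<lambda>i. e (l * k + 1 + i)"
  have shift: "(\<Sum>j=l*k+1..l*k+n. e j \<omega>) = (\<Sum>i<n. ?X i \<omega>)" for n \<omega>
    by (rule sum.reindex_bij_witness[of _ "\<lambda>i. l * k + 1 + i" "\<lambda>j. j - (l * k + 1)"]) auto
  have X: "indep_vars (\<lambda>_. borel) ?X {..<k}"
    using indep_vars_sum_disjoint[OF e_indep, of "{..<k}" "\<lambda>i. {l * k + 1 + i}"]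
    by (auto simp: disjoint_family_on_def)
  let ?y = "x / (2 * q)"
  have "prob {\<omega> \<in> space M. \<exists>j\<le>k. 2 * ?y \<le> \<bar>\<Sum>i<j. ?X i \<omega>\<bar>} \<le> 2 * prob {\<omega> \<in> space M. ?y \<le> \<bar>\<Sum>i<k. ?X i \<omega>\<bar>}"
  proof (rule prob_max_sum_le_last[OF X])
    show "k * v / ?y\<^sup>2 \<le> 1 / 2"
      using small assms(1,2) by (simp add: power2_eq_square field_simps)
  qed (use assms(1,2) e_square e_mean e_variance in auto)
  also have "{\<omega> \<in> space M. ?y \<le> \<bar>\<Sum>i<k. ?X i \<omega>\<bar>} = {\<omega> \<in> space M. x / 2 \<le> \<bar>q * (\<Sum>j=l*k+1..l*k+k. e j \<omega>)\<bar>}"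
    unfolding shift using assms(1) by (auto simp: abs_mult field_simps)
  also have "{\<omega> \<in> space M. \<exists>j\<le>k. 2 * ?y \<le> \<bar>\<Sum>i<j. ?X i \<omega>\<bar>}
      = {\<omega> \<in> space M. \<exists>j\<le>k. x \<le> q * \<bar>noise \<omega> (l * k + j) - noise \<omega> (l * k)\<bar>}"
  proof -
    have "noise \<omega> (l * k + j) - noise \<omega> (l * k) = (\<Sum>i<j. ?X i \<omega>)" for j \<omega>
      by (simp only: noise_add shift add_diff_cancel_left')
    then show ?thesis using assms(1) by (simp add: field_simps)
  qed
  finally show "prob {\<omega> \<in> space M. \<exists>j\<le>k. x \<le> q * \<bar>noise \<omega> (l * k + j) - noise \<omega> (l * k)\<bar>} \<le> 2 * \<beta>"
    using last by linarith
qed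

lemma drift_grid_bounds:
  assumes \<omega>: "\<omega> \<in> space M" and t: "0 \<le> t" and c: "0 \<le> c"
  shows "(\<Sum>l<i. (real (N (real (Suc l) * t) \<omega>) - real (N (real l * t) \<omega>)) * \<phi> (c * (real l * t))) \<le> drift c \<omega> (real i * t)"
    and "drift c \<omega> (real i * t) \<le> (\<Sum>l<i. (real (N (real (Suc l) * t) \<omega>) - real (N (real l * t) \<omega>)) * \<phi> (c * (real (Suc l) * t)))"
proof (induction i)
  case 0
  { case 1 show ?case using drift_0[OF \<omega>] by simp }
  { case 2 show ?case using drift_0[OF \<omega>] by simp }
next
  case (Suc i)
  have "real i * t \<le> real (Suc i) * t" using t by (intro mult_right_mono) auto
  note d = drift_increment[OF \<omega> _ this c]
  { case 1 show ?case using Suc.IH(1) d(1) t by simp }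
  { case 2 show ?case using Suc.IH(2) d(2) t by simp }
qed

text \<open>The deterministic part: arrival counts close to their means on a grid of mesh \<open>\<delta>\<close> and
  oscillations within blocks below \<open>\<eta>\<close> tie the rescaled walk to its values at block ends. Between
  two grid times the number of arrivals stays within neighbouring blocks, and the increasing drift
  is enclosed by a lower and an upper Riemann sum.\<close>

lemma walk_near_blocks:
  fixes T c q \<delta> \<eta> \<gamma> :: real and k d :: nat
  defines "b \<equiv> r * D / 2"
  assumes \<omega>: "\<omega> \<in> space M" and pos: "0 < T" "0 < c" "0 < q" "0 < \<delta>"
    and k: "real k \<le> r * \<delta> * T" "r * \<delta> * T < real k + 1"
    and \<gamma>: "0 < \<gamma>" "\<gamma> \<le> r * \<delta> / 2" and T: "real d + 2 \<le> r * \<delta> * T / 2"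
    and count: "\<And>l. l \<le> d \<Longrightarrow> \<bar>real (N (real l * (\<delta> * T)) \<omega>) - r * (real l * (\<delta> * T))\<bar> \<le> \<gamma> * T"
    and osc: "\<And>l j. l \<le> d \<Longrightarrow> j \<le> k \<Longrightarrow> q * \<bar>noise \<omega> (l * k + j) - noise \<omega> (l * k)\<bar> \<le> \<eta>"
    and slope: "\<And>l. l \<le> d \<Longrightarrow> \<bar>q * T * \<phi> (c * (real l * (\<delta> * T))) - D * (real l * \<delta>)\<bar> \<le> \<gamma>"
    and lower: "\<And>i. i < d \<Longrightarrow> b * \<delta>\<^sup>2 * (real i * (real i - 1)) - \<eta> \<le> (r * \<delta> - 2 * \<gamma>) * (\<Sum>l<i. D * (real l * \<delta>) - \<gamma>)"
    and upper: "\<And>i. i < d \<Longrightarrow> (r * \<delta> + 2 * \<gamma>) * (\<Sum>l<Suc i. D * (real (Suc l) * \<delta>) + \<gamma>) \<le> b * \<delta>\<^sup>2 * ((real i + 1) * (real i + 2)) + \<eta>"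
    and mesh: "b * \<delta>\<^sup>2 * (3 * real d + 2) \<le> \<eta>"
    and i: "i < d" and u: "real i * \<delta> \<le> u" "u \<le> (real i + 1) * \<delta>"
  shows "\<bar>q * walk c \<omega> (u * T) - (q * noise \<omega> (i * k) + b * (real i * \<delta>)\<^sup>2)\<bar> \<le> 4 * \<eta>"
proof -
  have b: "0 < b" using r_pos D_pos by (simp add: b_def)
  let ?t = "\<delta> * T"
  have t: "0 < ?t" using pos by simp
  have u1: "real i * ?t \<le> u * T" "u * T \<le> real (Suc i) * ?t" "0 \<le> u * T"
  proof -
    show "real i * ?t \<le> u * T" using u pos mult_right_mono[of "real i * \<delta>" u T] by (simp add: mult.assoc)
    then show "0 \<le> u * T" using t by (meson mult_nonneg_nonneg of_nat_0_le_iff order_trans less_imp_le)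
    show "u * T \<le> real (Suc i) * ?t"
      using u pos mult_right_mono[of u "(real i + 1) * \<delta>" T] by (simp add: algebra_simps)
  qed
  have Ni: "N (real i * ?t) \<omega> \<le> N (u * T) \<omega>" "N (u * T) \<omega> \<le> N (real (Suc i) * ?t) \<omega>"
    using u1 t by (auto intro!: N_mono[OF \<omega>])
  have noise: "q * \<bar>noise \<omega> (N (u * T) \<omega>) - noise \<omega> (i * k)\<bar> \<le> 2 * \<eta>"
  proof -
    have \<gamma>T: "\<gamma> * T \<le> r * \<delta> * T / 2" using mult_right_mono[OF \<gamma>(2), of T] pos by simp
    have "real (i * k) \<le> real (N (u * T) \<omega> + k)"
    proof -
      have "real (i * k) \<le> real i * (r * \<delta> * T)" using k by (simp add: mult_left_mono)
      also have "\<dots> \<le> real (N (real i * ?t) \<omega>) + \<gamma> * T" using count[of i] i by (simp add: algebra_simps)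
      also have "\<gamma> * T \<le> real k" using \<gamma>T T k by linarith
      finally show ?thesis using Ni(1) by simp
    qed
    then have m1: "i * k \<le> N (u * T) \<omega> + k" by linarith
    have "real (N (u * T) \<omega>) \<le> real ((i + 2) * k)"
    proof -
      have "real (N (u * T) \<omega>) \<le> r * (real (Suc i) * ?t) + \<gamma> * T"
        using count[of "Suc i"] i Ni(2) by simp
      also have "r * (real (Suc i) * ?t) + \<gamma> * T \<le> (real i + 2) * (r * \<delta> * T - 1)"
        using \<gamma>T T i by (simp add: algebra_simps)
      also have "\<dots> \<le> (real i + 2) * real k" using k by (intro mult_left_mono) auto
      finally show ?thesis by (simp add: distrib_right)
    qed
    then have m2: "N (u * T) \<omega> \<le> (i + 2) * k" by linarith
    have "\<bar>noise \<omega> (N (u * T) \<omega>) - noise \<omega> (i * k)\<bar> \<le> 2 * (\<eta> / q)"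
      by (rule noise_block_oscillation[OF _ i m1 m2]) (use osc pos in \<open>auto simp: field_simps\<close>)
    then show ?thesis using pos by (simp add: field_simps)
  qed
  have incr: "(r * \<delta> - 2 * \<gamma>) * T \<le> real (N (real (Suc l) * ?t) \<omega>) - real (N (real l * ?t) \<omega>)"
    "real (N (real (Suc l) * ?t) \<omega>) - real (N (real l * ?t) \<omega>) \<le> (r * \<delta> + 2 * \<gamma>) * T" if "l < d" for l
    using count[of l] count[of "Suc l"] that by (auto simp: algebra_simps abs_le_iff)
  have \<phi>0: "0 \<le> \<phi> (c * (real l * ?t))" for l :: nat using pos by (intro \<phi>_nonneg) auto
  have lo: "b * \<delta>\<^sup>2 * (real i * (real i - 1)) - \<eta> \<le> q * drift c \<omega> (u * T)"
  proof -
    have "(r * \<delta> - 2 * \<gamma>) * (\<Sum>l<i. D * (real l * \<delta>) - \<gamma>) \<le> (r * \<delta> - 2 * \<gamma>) * (\<Sum>l<i. q * T * \<phi> (c * (real l * ?t)))"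
    proof (intro mult_left_mono sum_mono)
      fix l assume "l \<in> {..<i}"
      then have "l \<le> d" using i by auto
      from slope[OF this] show "D * (real l * \<delta>) - \<gamma> \<le> q * T * \<phi> (c * (real l * ?t))" by linarith
    qed (use \<gamma> in auto)
    also have "\<dots> = q * (\<Sum>l<i. (r * \<delta> - 2 * \<gamma>) * T * \<phi> (c * (real l * ?t)))"
      by (simp add: sum_distrib_left mult_ac)
    also have "\<dots> \<le> q * (\<Sum>l<i. (real (N (real (Suc l) * ?t) \<omega>) - real (N (real l * ?t) \<omega>)) * \<phi> (c * (real l * ?t)))"
      using pos i by (intro mult_left_mono sum_mono mult_right_mono incr \<phi>0) auto
    also have "\<dots> \<le> q * drift c \<omega> (real i * ?t)"
      using pos t by (intro mult_left_mono drift_grid_bounds \<omega>) auto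
    also have "\<dots> \<le> q * drift c \<omega> (u * T)" using pos t u1 by (intro mult_left_mono drift_mono \<omega>) auto
    finally show ?thesis using lower[OF i] by linarith
  qed
  have up: "q * drift c \<omega> (u * T) \<le> b * \<delta>\<^sup>2 * ((real i + 1) * (real i + 2)) + \<eta>"
  proof -
    have "q * drift c \<omega> (u * T) \<le> q * drift c \<omega> (real (Suc i) * ?t)"
      using pos t u1 by (intro mult_left_mono drift_mono \<omega>) auto
    also have "\<dots> \<le> q * (\<Sum>l<Suc i. (real (N (real (Suc l) * ?t) \<omega>) - real (N (real l * ?t) \<omega>)) * \<phi> (c * (real (Suc l) * ?t)))"
      using pos t by (intro mult_left_mono drift_grid_bounds \<omega>) auto
    also have "\<dots> \<le> q * (\<Sum>l<Suc i. (r * \<delta> + 2 * \<gamma>) * T * \<phi> (c * (real (Suc l) * ?t)))"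
      using pos i by (intro mult_left_mono sum_mono mult_right_mono incr \<phi>0) auto
    also have "\<dots> = (r * \<delta> + 2 * \<gamma>) * (\<Sum>l<Suc i. q * T * \<phi> (c * (real (Suc l) * ?t)))"
      by (simp only: sum_distrib_left mult_ac)
    also have "\<dots> \<le> (r * \<delta> + 2 * \<gamma>) * (\<Sum>l<Suc i. D * (real (Suc l) * \<delta>) + \<gamma>)"
    proof (intro mult_left_mono sum_mono)
      fix l assume "l \<in> {..<Suc i}"
      then have "Suc l \<le> d" using i by auto
      from slope[OF this] show "q * T * \<phi> (c * (real (Suc l) * ?t)) \<le> D * (real (Suc l) * \<delta>) + \<gamma>" by linarith
    qed (use \<gamma> r_pos pos in auto)
    finally show ?thesis using upper[OF i] by linarith
  qed
  have sq: "b * (real i * \<delta>)\<^sup>2 = b * \<delta>\<^sup>2 * (real i * real i)" by (simp add: power2_eq_square mult_ac)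
  have "b * \<delta>\<^sup>2 * (3 * real i + 2) \<le> b * \<delta>\<^sup>2 * (3 * real d + 2)"
    using b i by (intro mult_left_mono) auto
  then have mi: "b * \<delta>\<^sup>2 * (3 * real i + 2) \<le> \<eta>" using mesh by simp
  have "0 \<le> b * \<delta>\<^sup>2 * (2 * real i + 2)" "0 \<le> b * \<delta>\<^sup>2 * real i" using b by auto
  then have "\<bar>q * drift c \<omega> (u * T) - b * (real i * \<delta>)\<^sup>2\<bar> \<le> 2 * \<eta>"
    using lo up mi unfolding sq by (simp add: algebra_simps abs_le_iff)
  moreover have "\<bar>q * noise \<omega> (N (u * T) \<omega>) - q * noise \<omega> (i * k)\<bar> \<le> 2 * \<eta>"
    using noise pos by (simp add: right_diff_distrib[symmetric] abs_mult)
  ultimately show ?thesis by (simp add: walk_def algebra_simps abs_le_iff)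
qed

text \<open>With \<open>c = T powr (-3/2)\<close> time is measured in units of \<open>T\<close>, and \<open>k n\<close> is the expected number
  of arrivals, rounded down, in \<open>\<delta>\<close> of these units. The factor \<open>sqrt (\<delta> * r) / sqrt (k n)\<close> agrees
  asymptotically with \<open>1 / sqrt (T n)\<close>, but makes the central limit theorem exactly applicable to
  blocks of length \<open>k n\<close>.\<close>

lemma eventually_walk_near_blocks:
  fixes T :: "nat \<Rightarrow> real" and \<delta> \<eta> \<beta> e0 :: real and d :: nat
  defines "b \<equiv> r * D / 2" and "k \<equiv> \<lambda>n. nat \<lfloor>r * \<delta> * T n\<rfloor>"
  defines "q \<equiv> \<lambda>n. sqrt (\<delta> * r) / sqrt (k n)"
  assumes T: "filterlim T at_top sequentially" and pos: "0 < \<delta>" "0 < \<eta>" "0 < e0"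
    and c: "\<And>n. 0 < T n \<Longrightarrow> c n = 1 / (T n * sqrt (T n))"
    and small: "8 * (\<delta> * r * v) \<le> \<eta>\<^sup>2" and mesh: "b * \<delta>\<^sup>2 * (3 * real d + 2) \<le> \<eta>"
    and last: "\<And>l. l \<le> d \<Longrightarrow> \<forall>\<^sub>F n in sequentially.
      prob {\<omega> \<in> space M. \<eta> / 2 \<le> \<bar>q n * (\<Sum>j=l*k n+1..l*k n+k n. e j \<omega>)\<bar>} \<le> \<beta>"
  shows "\<forall>\<^sub>F n in sequentially. \<exists>B\<in>events. prob B \<le> (real d + 1) * (2 * \<beta>) + e0 \<and>
    (\<forall>\<omega>\<in>space M - B. \<forall>i<d. \<forall>u. real i * \<delta> \<le> u \<longrightarrow> u \<le> (real i + 1) * \<delta> \<longrightarrow>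
      \<bar>q n * walk (c n) \<omega> (u * T n) - (q n * noise \<omega> (i * k n) + b * (real i * \<delta>)\<^sup>2)\<bar> \<le> 4 * \<eta>)"
proof -
  have Tpos: "\<forall>\<^sub>F n in sequentially. 0 < T n" using T by (simp add: filterlim_at_top_dense)
  \<comment> \<open>A tolerance for the arrival counts for which the Riemann sums of the drift are accurate.\<close>
  obtain \<gamma> where \<gamma>: "0 < \<gamma>" "\<gamma> \<le> r * \<delta> / 2"
    "\<And>i. i < d \<Longrightarrow> b * \<delta>\<^sup>2 * (real i * (real i - 1)) - \<eta> \<le> (r * \<delta> - 2 * \<gamma>) * (\<Sum>l<i. D * (real l * \<delta>) - \<gamma>)"
    "\<And>i. i < d \<Longrightarrow> (r * \<delta> + 2 * \<gamma>) * (\<Sum>l<Suc i. D * (real (Suc l) * \<delta>) + \<gamma>) \<le> b * \<delta>\<^sup>2 * ((real i + 1) * (real i + 2)) + \<eta>"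
  proof -
    have s1: "(\<Sum>l<i. D * (real l * \<delta>)) = D * \<delta> * (real i * (real i - 1)) / 2" for i
      by (induction i) (auto simp: field_simps)
    have s2: "(\<Sum>l<i. D * (real (Suc l) * \<delta>)) = D * \<delta> * (real i * (real i + 1)) / 2" for i
      by (induction i) (auto simp: field_simps)
    have "\<forall>\<^sub>F \<gamma> in at_right 0. b * \<delta>\<^sup>2 * (real i * (real i - 1)) - \<eta> < (r * \<delta> - 2 * \<gamma>) * (\<Sum>l<i. D * (real l * \<delta>) - \<gamma>)" for i
    proof (rule order_tendstoD(1))
      show "((\<lambda>\<gamma>. (r * \<delta> - 2 * \<gamma>) * (\<Sum>l<i. D * (real l * \<delta>) - \<gamma>)) \<longlongrightarrow> (r * \<delta> - 2 * 0) * (\<Sum>l<i. D * (real l * \<delta>) - 0)) (at_right 0)"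
        by (intro tendsto_intros)
      show "b * \<delta>\<^sup>2 * (real i * (real i - 1)) - \<eta> < (r * \<delta> - 2 * 0) * (\<Sum>l<i. D * (real l * \<delta>) - 0)"
        using pos unfolding diff_zero mult_zero_right s1 by (simp add: b_def power2_eq_square field_simps)
    qed
    moreover have "\<forall>\<^sub>F \<gamma> in at_right 0. (r * \<delta> + 2 * \<gamma>) * (\<Sum>l<Suc i. D * (real (Suc l) * \<delta>) + \<gamma>) < b * \<delta>\<^sup>2 * ((real i + 1) * (real i + 2)) + \<eta>" for i
    proof (rule order_tendstoD(2))
      show "((\<lambda>\<gamma>. (r * \<delta> + 2 * \<gamma>) * (\<Sum>l<Suc i. D * (real (Suc l) * \<delta>) + \<gamma>)) \<longlongrightarrow> (r * \<delta> + 2 * 0) * (\<Sum>l<Suc i. D * (real (Suc l) * \<delta>) + 0)) (at_right 0)"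
        by (intro tendsto_intros)
      show "(r * \<delta> + 2 * 0) * (\<Sum>l<Suc i. D * (real (Suc l) * \<delta>) + 0) < b * \<delta>\<^sup>2 * ((real i + 1) * (real i + 2)) + \<eta>"
        using pos unfolding add_0_right s2 by (simp add: b_def power2_eq_square algebra_simps)
    qed
    moreover have "\<forall>\<^sub>F \<gamma> :: real in at_right 0. 0 < \<gamma>" by (rule eventually_at_right_less)
    moreover have "\<forall>\<^sub>F \<gamma> in at_right 0. \<gamma> \<le> r * \<delta> / 2"
      unfolding eventually_at_right_field using r_pos pos by (intro exI[of _ "r * \<delta> / 2"]) auto
    ultimately have "\<forall>\<^sub>F \<gamma> in at_right 0. (0 < \<gamma> \<and> \<gamma> \<le> r * \<delta> / 2) \<and>
      (\<forall>i\<in>{..<d}. b * \<delta>\<^sup>2 * (real i * (real i - 1)) - \<eta> < (r * \<delta> - 2 * \<gamma>) * (\<Sum>l<i. D * (real l * \<delta>) - \<gamma>)) \<and>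
      (\<forall>i\<in>{..<d}. (r * \<delta> + 2 * \<gamma>) * (\<Sum>l<Suc i. D * (real (Suc l) * \<delta>) + \<gamma>) < b * \<delta>\<^sup>2 * ((real i + 1) * (real i + 2)) + \<eta>)"
      by (intro eventually_conj eventually_ball_finite) auto
    from eventually_happens'[OF _ this] obtain \<gamma> where "(0 < \<gamma> \<and> \<gamma> \<le> r * \<delta> / 2) \<and>
      (\<forall>i\<in>{..<d}. b * \<delta>\<^sup>2 * (real i * (real i - 1)) - \<eta> < (r * \<delta> - 2 * \<gamma>) * (\<Sum>l<i. D * (real l * \<delta>) - \<gamma>)) \<and>
      (\<forall>i\<in>{..<d}. (r * \<delta> + 2 * \<gamma>) * (\<Sum>l<Suc i. D * (real (Suc l) * \<delta>) + \<gamma>) < b * \<delta>\<^sup>2 * ((real i + 1) * (real i + 2)) + \<eta>)"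
      by (auto simp: trivial_limit_at_right_real)
    then show ?thesis by (intro that[of \<gamma>]) (auto intro: less_imp_le)
  qed
  have invT: "(\<lambda>n. 1 / T n) \<longlonglongrightarrow> 0"
    using tendsto_inverse_0_at_top[OF T] by (simp add: inverse_eq_divide)
  have kT: "(\<lambda>n. real (k n) / T n) \<longlonglongrightarrow> r * \<delta>"
  proof (rule tendsto_sandwich)
    show "\<forall>\<^sub>F n in sequentially. r * \<delta> - 1 / T n \<le> real (k n) / T n"
      using Tpos
    proof eventually_elim
      case (elim n)
      have "r * \<delta> * T n - 1 \<le> real (k n)" unfolding k_def using r_pos pos elim by linarith
      from divide_right_mono[OF this, of "T n"] show ?case using elim by (simp add: diff_divide_distrib)
    qed
    show "\<forall>\<^sub>F n in sequentially. real (k n) / T n \<le> r * \<delta>"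
      using Tpos
    proof eventually_elim
      case (elim n)
      have "0 \<le> r * \<delta> * T n" using r_pos pos elim by simp
      then have "real (k n) \<le> r * \<delta> * T n" unfolding k_def by linarith
      then show ?case using elim by (simp add: field_simps)
    qed
    show "(\<lambda>n. r * \<delta> - 1 / T n) \<longlonglongrightarrow> r * \<delta>"
      using tendsto_diff[OF tendsto_const invT] by simp
  qed simp
  have slope: "(\<lambda>n. q n * T n * \<phi> (c n * (real l * (\<delta> * T n)))) \<longlonglongrightarrow> D * (real l * \<delta>)" for l
  proof (cases "l = 0")
    case True
    then show ?thesis by (simp add: \<phi>_0)
  next
    case False
    let ?x = "\<lambda>n. real l * \<delta> / sqrt (T n)"
    have "filterlim ?x (at_right 0) sequentially"
      unfolding filterlim_at
    proof
      show "\<forall>\<^sub>F n in sequentially. ?x n \<in> {0<..} \<and> ?x n \<noteq> 0"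
        using Tpos by eventually_elim (use False pos in auto)
      have "filterlim (\<lambda>n. sqrt (T n)) at_top sequentially"
        by (rule filterlim_compose[OF sqrt_at_top T])
      from tendsto_mult_right_zero[OF tendsto_inverse_0_at_top[OF this], of "real l * \<delta>"]
      show "?x \<longlonglongrightarrow> 0" by (simp add: divide_inverse)
    qed
    from filterlim_compose[OF \<phi>_deriv this] have "(\<lambda>n. \<phi> (?x n) / ?x n) \<longlonglongrightarrow> D" .
    moreover have "(\<lambda>n. sqrt (\<delta> * r) / sqrt (real (k n) / T n)) \<longlonglongrightarrow> sqrt (\<delta> * r) / sqrt (r * \<delta>)"
      using r_pos pos by (intro tendsto_intros kT) auto
    then have "(\<lambda>n. sqrt (\<delta> * r) / sqrt (real (k n) / T n)) \<longlonglongrightarrow> 1"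
      using r_pos pos by (simp add: mult.commute)
    ultimately have "(\<lambda>n. (sqrt (\<delta> * r) / sqrt (real (k n) / T n)) * (real l * \<delta>) * (\<phi> (?x n) / ?x n)) \<longlonglongrightarrow> 1 * (real l * \<delta>) * D"
      by (intro tendsto_intros)
    then have "(\<lambda>n. (sqrt (\<delta> * r) / sqrt (real (k n) / T n)) * (real l * \<delta>) * (\<phi> (?x n) / ?x n)) \<longlonglongrightarrow> D * (real l * \<delta>)"
      by (simp add: mult_ac)
    then show ?thesis
    proof (rule Lim_transform_eventually)
      show "\<forall>\<^sub>F n in sequentially. sqrt (\<delta> * r) / sqrt (real (k n) / T n) * (real l * \<delta>) * (\<phi> (?x n) / ?x n)
          = q n * T n * \<phi> (c n * (real l * (\<delta> * T n)))"
        using Tpos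
      proof eventually_elim
        case (elim n)
        have "c n * (real l * (\<delta> * T n)) = ?x n" using elim c[OF elim] by simp
        moreover have "real l * \<delta> * (y / (real l * \<delta> / sqrt (T n))) = y * sqrt (T n)" for y
          using False pos by simp
        moreover have "sqrt (\<delta> * r) / sqrt (real (k n) / T n) = q n * sqrt (T n)"
          by (simp add: q_def real_sqrt_divide)
        moreover have "q n * sqrt (T n) * (y * sqrt (T n)) = q n * T n * y" for y
          using elim by simp
        ultimately show ?case by (simp only: mult.assoc)
      qed
    qed
  qed
  have ev_slope: "\<forall>\<^sub>F n in sequentially. \<forall>l\<in>{..d}. \<bar>q n * T n * \<phi> (c n * (real l * (\<delta> * T n))) - D * (real l * \<delta>)\<bar> \<le> \<gamma>"
  proof (intro eventually_ball_finite ballI finite_atMost)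
    fix l
    have "(\<lambda>n. q n * T n * \<phi> (c n * (real l * (\<delta> * T n))) - D * (real l * \<delta>)) \<longlonglongrightarrow> 0"
      using tendsto_diff[OF slope[of l] tendsto_const[of "D * (real l * \<delta>)"]] by simp
    from tendstoD[OF this \<gamma>(1)]
    show "\<forall>\<^sub>F n in sequentially. \<bar>q n * T n * \<phi> (c n * (real l * (\<delta> * T n))) - D * (real l * \<delta>)\<bar> \<le> \<gamma>"
      by eventually_elim (simp add: dist_real_def)
  qed
  have ev_last: "\<forall>\<^sub>F n in sequentially. \<forall>l\<in>{..d}. prob {\<omega> \<in> space M. \<eta> / 2 \<le> \<bar>q n * (\<Sum>j=l*k n+1..l*k n+k n. e j \<omega>)\<bar>} \<le> \<beta>"
    by (intro eventually_ball_finite ballI finite_atMost last) auto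
  have ev_T: "\<forall>\<^sub>F n in sequentially. 2 * (real d + 2) / (r * \<delta>) \<le> T n"
    using T by (auto simp: filterlim_at_top)
  have ev_count: "\<forall>\<^sub>F n in sequentially. (real d + 1) * (r * (real d * \<delta>) / \<gamma>\<^sup>2 * (1 / T n)) \<le> e0"
  proof -
    have "(\<lambda>n. (real d + 1) * (r * (real d * \<delta>) / \<gamma>\<^sup>2 * (1 / T n))) \<longlonglongrightarrow> (real d + 1) * (r * (real d * \<delta>) / \<gamma>\<^sup>2 * 0)"
      by (intro tendsto_intros invT)
    then have "(\<lambda>n. (real d + 1) * (r * (real d * \<delta>) / \<gamma>\<^sup>2 * (1 / T n))) \<longlonglongrightarrow> 0" by simp
    from order_tendstoD(2)[OF this pos(3)] show ?thesis by eventually_elim simp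
  qed
  show ?thesis
    using Tpos ev_slope ev_last ev_T ev_count
  proof eventually_elim
    case (elim n)
    note Tn = elim(1)
    have rdT: "real d + 2 \<le> r * \<delta> * T n / 2"
      using elim(4) r_pos pos by (simp add: field_simps)
    have kn: "real (k n) \<le> r * \<delta> * T n" "r * \<delta> * T n < real (k n) + 1"
      unfolding k_def using rdT by linarith+
    have k0: "0 < real (k n)" using kn rdT by linarith
    have qn: "0 < q n" unfolding q_def using k0 r_pos pos by simp
    have q2: "8 * (q n)\<^sup>2 * k n * v \<le> \<eta>\<^sup>2"
      using small k0 r_pos pos by (simp add: q_def power_divide mult_ac)
    let ?C = "\<lambda>l. {\<omega> \<in> space M. \<gamma> * T n \<le> \<bar>real (N (real l * (\<delta> * T n)) \<omega>) - real (N 0 \<omega>) - r * (real l * (\<delta> * T n) - 0)\<bar>}"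
    let ?O = "\<lambda>l. {\<omega> \<in> space M. \<exists>j\<le>k n. \<eta> \<le> q n * \<bar>noise \<omega> (l * k n + j) - noise \<omega> (l * k n)\<bar>}"
    have Cm: "?C l \<in> events" for l :: nat
    proof -
      have [measurable]: "N (real l * (\<delta> * T n)) \<in> measurable M (count_space UNIV)" "N 0 \<in> measurable M (count_space UNIV)"
        using Tn pos by (auto intro!: N_measurable)
      show ?thesis by measurable
    qed
    have Om: "?O l \<in> events" and Op: "prob (?O l) \<le> 2 * \<beta>" if "l \<le> d" for l
      using prob_block_oscillation[OF qn pos(2) q2, of l \<beta>] elim(3) that by auto
    have Cp: "prob (?C l) \<le> r * (real d * \<delta>) / \<gamma>\<^sup>2 * (1 / T n)" if l: "l \<le> d" for l
    proof (cases "l = 0")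
      case True
      have "?C l = {}" using True \<gamma>(1) Tn by (auto simp: mult_le_0_iff)
      moreover have "0 \<le> r * (real d * \<delta>) / \<gamma>\<^sup>2 * (1 / T n)" using r_pos pos Tn by simp
      ultimately show ?thesis by (simp only: measure_empty)
    next
      case False
      have "prob (?C l) \<le> r * (real l * (\<delta> * T n) - 0) / (\<gamma> * T n)\<^sup>2"
        by (rule poisson_process_deviation[OF prob_space_axioms N r_pos]) (use False \<gamma>(1) Tn pos in auto)
      also have "\<dots> = r * (real l * \<delta>) / \<gamma>\<^sup>2 * (1 / T n)"
        using Tn \<gamma>(1) by (simp add: power2_eq_square field_simps)
      also have "\<dots> \<le> r * (real d * \<delta>) / \<gamma>\<^sup>2 * (1 / T n)"
        using l r_pos pos Tn by (intro mult_right_mono divide_right_mono mult_left_mono) auto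
      finally show ?thesis .
    qed
    let ?B = "(\<Union>l\<le>d. ?O l) \<union> (\<Union>l\<le>d. ?C l)"
    note UO = prob_UN_le[of d ?O "2 * \<beta>", OF Om Op] and UC = prob_UN_le[of d ?C, OF Cm Cp]
    have B: "?B \<in> events" by (rule sets.Un[OF UO(1) UC(1)])
    have "prob ?B \<le> prob (\<Union>l\<le>d. ?O l) + prob (\<Union>l\<le>d. ?C l)"
      by (rule measure_Un_le[OF UO(1) UC(1)])
    then have pB: "prob ?B \<le> (real d + 1) * (2 * \<beta>) + e0" using UO(2) UC(2) elim(5) by linarith
    have "\<bar>q n * walk (c n) \<omega> (u * T n) - (q n * noise \<omega> (i * k n) + b * (real i * \<delta>)\<^sup>2)\<bar> \<le> 4 * \<eta>"
      if \<omega>: "\<omega> \<in> space M - ?B" and i: "i < d" and u: "real i * \<delta> \<le> u" "u \<le> (real i + 1) * \<delta>" for \<omega> i u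
      unfolding b_def
    proof (rule walk_near_blocks[OF _ Tn _ qn pos(1) kn \<gamma>(1,2) rdT])
      have "\<omega> \<notin> ?C l" if "l \<le> d" for l using \<omega> that by blast
      then show "\<bar>real (N (real l * (\<delta> * T n)) \<omega>) - r * (real l * (\<delta> * T n))\<bar> \<le> \<gamma> * T n" if "l \<le> d" for l
        using \<omega> that N_0[of \<omega>] by fastforce
      have "\<omega> \<notin> ?O l" if "l \<le> d" for l using \<omega> that by blast
      then show "q n * \<bar>noise \<omega> (l * k n + j) - noise \<omega> (l * k n)\<bar> \<le> \<eta>" if "l \<le> d" "j \<le> k n" for l j
        using \<omega> that by fastforce
      show "0 < c n" using c[OF Tn] Tn by simp
    qed (use \<omega> elim(2) \<gamma>(3,4) mesh i u in \<open>auto simp: b_def\<close>)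
    then show ?case by (intro bexI[OF _ B] conjI pB) blast
  qed
qed

end

section \<open>Measurability of the smallest minimizer\<close>

lemma argmin_eqI:
  assumes "is_smallest_minimizer g h"
  shows "argmin g = h"
  unfolding argmin_def using assms
  by (intro Least_equality) (auto simp: is_smallest_minimizer_def)

text \<open>Without a smallest minimizer, \<open>argmin\<close> is an unspecified number, but always the same one.\<close>

lemma argmin_none:
  assumes "\<nexists>h. is_smallest_minimizer g h"
  shows "argmin g = (THE x. False)"
proof -
  have "(\<lambda>x. is_minimizer g x \<and> (\<forall>y. is_minimizer g y \<longrightarrow> x \<le> y)) = (\<lambda>x. False)"
    using assms by (auto simp: is_smallest_minimizer_def fun_eq_iff)
  then show ?thesis unfolding argmin_def Least_def by simp
qed

lemma is_smallest_minimizer_Inf: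
  assumes "is_minimizer g h0" "bdd_below {h. is_minimizer g h}"
    and "is_minimizer g (Inf {h. is_minimizer g h})"
  shows "is_smallest_minimizer g (Inf {h. is_minimizer g h})"
  using assms by (auto simp: is_smallest_minimizer_def intro: cInf_lower)

text \<open>If the infimum of the minimizers is a minimizer, then a smallest minimizer exists if and only
  if there are minimizers and they are bounded below. Both conditions are expressed by the events that
  some minimizer lies below a given number.\<close>

lemma borel_measurable_argmin:
  assumes inf: "\<And>\<omega> h. \<omega> \<in> space M \<Longrightarrow> is_minimizer (g \<omega>) h \<Longrightarrow> bdd_below {h. is_minimizer (g \<omega>) h} \<Longrightarrow>
      is_minimizer (g \<omega>) (Inf {h. is_minimizer (g \<omega>) h})"
    and ex: "\<And>a::real. {\<omega> \<in> space M. \<exists>h<a. is_minimizer (g \<omega>) h} \<in> sets M"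
  shows "(\<lambda>\<omega>. argmin (g \<omega>)) \<in> borel_measurable M"
proof -
  have sm: "(\<exists>h<a. is_smallest_minimizer (g \<omega>) h) \<longleftrightarrow>
      (\<exists>h<a. is_minimizer (g \<omega>) h) \<and> (\<exists>n::nat. \<not> (\<exists>h < - real n. is_minimizer (g \<omega>) h))"
    if \<omega>: "\<omega> \<in> space M" for \<omega> and a :: real
  proof (intro iffI conjI)
    assume "\<exists>h<a. is_smallest_minimizer (g \<omega>) h"
    then obtain h where h: "h < a" "is_smallest_minimizer (g \<omega>) h" by blast
    then show "\<exists>h<a. is_minimizer (g \<omega>) h" by (auto simp: is_smallest_minimizer_def)
    obtain n :: nat where "- h \<le> real n" using real_arch_simple by blast
    then show "\<exists>n::nat. \<not> (\<exists>h < - real n. is_minimizer (g \<omega>) h)"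
      using h(2) by (intro exI[of _ n]) (fastforce simp: is_smallest_minimizer_def)
  next
    assume "(\<exists>h<a. is_minimizer (g \<omega>) h) \<and> (\<exists>n::nat. \<not> (\<exists>h < - real n. is_minimizer (g \<omega>) h))"
    then obtain h0 and n :: nat where h0: "h0 < a" "is_minimizer (g \<omega>) h0"
      and n: "\<not> (\<exists>h < - real n. is_minimizer (g \<omega>) h)" by blast
    have bdd: "bdd_below {h. is_minimizer (g \<omega>) h}"
      using n by (intro bdd_belowI[of _ "- real n"]) (auto simp: not_less)
    from is_smallest_minimizer_Inf[OF h0(2) bdd inf[OF \<omega> h0(2) bdd]]
    have s: "is_smallest_minimizer (g \<omega>) (Inf {h. is_minimizer (g \<omega>) h})" .
    have "Inf {h. is_minimizer (g \<omega>) h} \<le> h0" using h0(2) bdd by (intro cInf_lower) auto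
    then show "\<exists>h<a. is_smallest_minimizer (g \<omega>) h" using s h0(1) by (intro exI[of _ "Inf {h. is_minimizer (g \<omega>) h}"]) auto
  qed
  have S: "{\<omega> \<in> space M. \<exists>h<a. is_smallest_minimizer (g \<omega>) h} \<in> sets M" for a :: real
  proof -
    have "{\<omega> \<in> space M. \<exists>h<a. is_smallest_minimizer (g \<omega>) h} = {\<omega> \<in> space M. \<exists>h<a. is_minimizer (g \<omega>) h} \<inter>
        (\<Union>n::nat. space M - {\<omega> \<in> space M. \<exists>h < - real n. is_minimizer (g \<omega>) h})"
      using sm by blast
    also have "\<dots> \<in> sets M" using ex by (intro sets.Int sets.countable_UN sets.Diff) auto
    finally show ?thesis .
  qed
  have S': "{\<omega> \<in> space M. \<exists>h. is_smallest_minimizer (g \<omega>) h} \<in> sets M"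
  proof -
    have "{\<omega> \<in> space M. \<exists>h. is_smallest_minimizer (g \<omega>) h} = (\<Union>n::nat. {\<omega> \<in> space M. \<exists>h < real n. is_smallest_minimizer (g \<omega>) h})"
      using reals_Archimedean2 by blast
    also have "\<dots> \<in> sets M" using S by (intro sets.countable_UN) auto
    finally show ?thesis .
  qed
  show ?thesis
  proof (rule borel_measurableI_less)
    fix a :: real
    let ?c = "THE x::real. False"
    have "{\<omega> \<in> space M. argmin (g \<omega>) < a} = {\<omega> \<in> space M. \<exists>h<a. is_smallest_minimizer (g \<omega>) h} \<union>
        (if ?c < a then space M - {\<omega> \<in> space M. \<exists>h. is_smallest_minimizer (g \<omega>) h} else {})"
    proof (intro set_eqI)
      fix \<omega>
      show "\<omega> \<in> {\<omega> \<in> space M. argmin (g \<omega>) < a} \<longleftrightarrow> \<omega> \<in> {\<omega> \<in> space M. \<exists>h<a. is_smallest_minimizer (g \<omega>) h} \<union>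
        (if ?c < a then space M - {\<omega> \<in> space M. \<exists>h. is_smallest_minimizer (g \<omega>) h} else {})"
      proof (cases "\<exists>h. is_smallest_minimizer (g \<omega>) h")
        case True
        then obtain h where h: "is_smallest_minimizer (g \<omega>) h" by blast
        have "k = h" if "is_smallest_minimizer (g \<omega>) k" for k
          using h that argmin_eqI by metis
        then have "(\<exists>k<a. is_smallest_minimizer (g \<omega>) k) \<longleftrightarrow> h < a" using h by blast
        then show ?thesis using True by (simp add: argmin_eqI[OF h])
      next
        case False
        then have "\<not> (\<exists>k<a. is_smallest_minimizer (g \<omega>) k)" by blast
        then show ?thesis using False by (simp add: argmin_none[OF False])
      qed
    qed
    also have "\<dots> \<in> sets M" using S S' by auto
    finally show "{\<omega> \<in> space M. argmin (g \<omega>) < a} \<in> sets M" .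
  qed
qed

text \<open>For a path that is constant on some interval \<open>[h, h + d)\<close> after every point \<open>h\<close>, the rational
  points see all values, and an infimum of minimizers is a minimizer.\<close>

definition right_locally_constant :: "(real \<Rightarrow> real) \<Rightarrow> bool" where
  "right_locally_constant g \<longleftrightarrow> (\<forall>h. \<exists>d>0. \<forall>k. h \<le> k \<longrightarrow> k < h + d \<longrightarrow> g k = g h)"

lemma right_locally_constant_Inf_minimizer:
  assumes "right_locally_constant g" "is_minimizer g h" "bdd_below {h. is_minimizer g h}"
  shows "is_minimizer g (Inf {h. is_minimizer g h})"
proof -
  let ?A = "{h. is_minimizer g h}"
  obtain d where d: "0 < d" "\<And>k. Inf ?A \<le> k \<Longrightarrow> k < Inf ?A + d \<Longrightarrow> g k = g (Inf ?A)"
    using assms(1) unfolding right_locally_constant_def by blast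
  obtain k where k: "k \<in> ?A" "k < Inf ?A + d"
    using cInf_lessD[of ?A "Inf ?A + d"] assms(2) d(1) by auto
  have "Inf ?A \<le> k" using k(1) assms(3) by (intro cInf_lower)
  then show ?thesis using d(2)[of k] k by (simp add: is_minimizer_def)
qed

lemma right_locally_constant_rat:
  assumes "right_locally_constant g" "h < a"
  shows "\<exists>q\<in>\<rat>. h \<le> q \<and> q < a \<and> g q = g h"
proof -
  obtain d where d: "0 < d" "\<And>k. h \<le> k \<Longrightarrow> k < h + d \<Longrightarrow> g k = g h"
    using assms(1) unfolding right_locally_constant_def by blast
  then obtain q where "q \<in> \<rat>" "h < q" "q < min a (h + d)"
    using Rats_dense_in_real[of h "min a (h + d)"] assms(2) by auto
  then show ?thesis using d(2)[of q] by (intro bexI[of _ q]) auto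
qed

lemma sets_le_rationals:
  fixes g :: "'a \<Rightarrow> real \<Rightarrow> real"
  assumes [measurable]: "\<And>h. (\<lambda>\<omega>. g \<omega> h) \<in> borel_measurable M"
  shows "{\<omega> \<in> space M. \<forall>p\<in>\<rat>. g \<omega> q \<le> g \<omega> p + e} \<in> sets M"
proof -
  have "{\<omega> \<in> space M. \<forall>p\<in>\<rat>. g \<omega> q \<le> g \<omega> p + e} = space M \<inter> (\<Inter>p\<in>\<rat>. {\<omega> \<in> space M. g \<omega> q \<le> g \<omega> p + e})"
    by auto
  also have "\<dots> \<in> sets M"
  proof (intro sets.Int sets.countable_INT' countable_rat)
    show "(\<lambda>p. {\<omega> \<in> space M. g \<omega> q \<le> g \<omega> p + e}) ` \<rat> \<subseteq> sets M" by (auto intro: measurable)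
    show "\<rat> \<noteq> {}" using Rats_0 by blast
  qed auto
  finally show ?thesis .
qed

lemma borel_measurable_argmin_right_locally_constant:
  fixes g :: "'a \<Rightarrow> real \<Rightarrow> real"
  assumes rc: "\<And>\<omega>. \<omega> \<in> space M \<Longrightarrow> right_locally_constant (g \<omega>)"
    and meas: "\<And>h. (\<lambda>\<omega>. g \<omega> h) \<in> borel_measurable M"
  shows "(\<lambda>\<omega>. argmin (g \<omega>)) \<in> borel_measurable M"
proof (rule borel_measurable_argmin)
  fix a :: real
  have rat: "is_minimizer (g \<omega>) h \<longleftrightarrow> (\<forall>q\<in>\<rat>. g \<omega> h \<le> g \<omega> q)" if "\<omega> \<in> space M" for \<omega> h
    unfolding is_minimizer_def
    using right_locally_constant_rat[OF rc[OF that] less_add_one] by metis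
  have "{\<omega> \<in> space M. \<exists>h<a. is_minimizer (g \<omega>) h} = (\<Union>q\<in>\<rat> \<inter> {..<a}. {\<omega> \<in> space M. \<forall>p\<in>\<rat>. g \<omega> q \<le> g \<omega> p + 0})"
  proof (intro equalityI subsetI)
    fix \<omega> assume "\<omega> \<in> {\<omega> \<in> space M. \<exists>h<a. is_minimizer (g \<omega>) h}"
    then obtain h where h: "\<omega> \<in> space M" "h < a" "is_minimizer (g \<omega>) h" by blast
    obtain q where "q \<in> \<rat>" "q < a" "g \<omega> q = g \<omega> h"
      using right_locally_constant_rat[OF rc[OF h(1)] h(2)] by blast
    then show "\<omega> \<in> (\<Union>q\<in>\<rat> \<inter> {..<a}. {\<omega> \<in> space M. \<forall>p\<in>\<rat>. g \<omega> q \<le> g \<omega> p + 0})"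
      using h by (intro UN_I[of q]) (auto simp: is_minimizer_def)
  next
    fix \<omega> assume "\<omega> \<in> (\<Union>q\<in>\<rat> \<inter> {..<a}. {\<omega> \<in> space M. \<forall>p\<in>\<rat>. g \<omega> q \<le> g \<omega> p + 0})"
    then obtain q where q: "q \<in> \<rat>" "q < a" "\<And>p. p \<in> \<rat> \<Longrightarrow> g \<omega> q \<le> g \<omega> p" and \<omega>: "\<omega> \<in> space M" by auto
    then have "is_minimizer (g \<omega>) q" using q rat[OF \<omega>] by blast
    then show "\<omega> \<in> {\<omega> \<in> space M. \<exists>h<a. is_minimizer (g \<omega>) h}" using q \<omega> by blast
  qed
  also have "\<dots> \<in> sets M"
    by (intro sets.countable_UN'' sets_le_rationals meas countable_Int1 countable_rat)
  finally show "{\<omega> \<in> space M. \<exists>h<a. is_minimizer (g \<omega>) h} \<in> sets M" .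
qed (rule right_locally_constant_Inf_minimizer[OF rc])

lemma continuous_Inf_minimizer:
  fixes g :: "real \<Rightarrow> real"
  assumes "continuous_on UNIV g" "is_minimizer g h" "bdd_below {h. is_minimizer g h}"
  shows "is_minimizer g (Inf {h. is_minimizer g h})"
proof -
  have "{h. is_minimizer g h} = (\<Inter>y. {h. g h \<le> g y})" by (auto simp: is_minimizer_def)
  also have "closed \<dots>"
    using assms(1) by (intro closed_INT ballI closed_Collect_le) (auto intro: continuous_intros)
  finally have "Inf {h. is_minimizer g h} \<in> {h. is_minimizer g h}"
    using assms by (intro closed_contains_Inf) auto
  then show ?thesis by simp
qed

text \<open>By compactness of \<open>[u, w]\<close>, near minimizers at rational points suffice.\<close>

lemma exists_minimizer_interval_iff:
  fixes g :: "real \<Rightarrow> real"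
  assumes g: "continuous_on UNIV g" and uw: "u < w"
  shows "(\<exists>h\<in>{u..w}. is_minimizer g h) \<longleftrightarrow>
    (\<forall>n::nat. \<exists>q\<in>\<rat> \<inter> {u..w}. \<forall>p\<in>\<rat>. g q \<le> g p + 1 / (Suc n))"
proof
  assume "\<exists>h\<in>{u..w}. is_minimizer g h"
  then obtain h where h: "h \<in> {u..w}" "is_minimizer g h" by blast
  show "\<forall>n::nat. \<exists>q\<in>\<rat> \<inter> {u..w}. \<forall>p\<in>\<rat>. g q \<le> g p + 1 / (Suc n)"
  proof
    fix n :: nat
    have "isCont g h" using g by (simp add: continuous_on_eq_continuous_at)
    then have "\<forall>\<^sub>F x in at h. dist (g x) (g h) < 1 / (Suc n)"
      unfolding isCont_def by (rule tendstoD) simp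
    then obtain d where d: "0 < d" "\<And>x. x \<noteq> h \<Longrightarrow> dist x h < d \<Longrightarrow> dist (g x) (g h) < 1 / (Suc n)"
      unfolding eventually_at by auto
    have "max u (h - d) < min w (h + d)" using h uw d(1) by auto
    then obtain q where q: "q \<in> \<rat>" "max u (h - d) < q" "q < min w (h + d)" using Rats_dense_in_real by blast
    have "\<bar>g q - g h\<bar> < 1 / (Suc n)"
      using d(2)[of q] q by (cases "q = h") (auto simp: dist_real_def)
    moreover have "g h \<le> g p" for p using h(2) by (simp add: is_minimizer_def)
    ultimately have "\<forall>p\<in>\<rat>. g q \<le> g p + 1 / (Suc n)" by (smt (verit))
    then show "\<exists>q\<in>\<rat> \<inter> {u..w}. \<forall>p\<in>\<rat>. g q \<le> g p + 1 / (Suc n)" using q by (intro bexI[of _ q]) auto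
  qed
next
  assume R: "\<forall>n::nat. \<exists>q\<in>\<rat> \<inter> {u..w}. \<forall>p\<in>\<rat>. g q \<le> g p + 1 / (Suc n)"
  obtain h where h: "h \<in> {u..w}" "\<And>x. x \<in> {u..w} \<Longrightarrow> g h \<le> g x"
  proof -
    have "continuous_on {u..w} g" using g by (rule continuous_on_subset) simp
    then have "\<exists>x\<in>{u..w}. \<forall>y\<in>{u..w}. g x \<le> g y" using uw by (intro continuous_attains_inf) auto
    then show ?thesis using that by blast
  qed
  have rat: "g h \<le> g p" if p: "p \<in> \<rat>" for p
  proof (rule field_le_epsilon)
    fix e :: real assume "0 < e"
    then obtain n :: nat where n: "1 / (Suc n) < e" using nat_approx_posE by blast
    obtain q where q: "q \<in> {u..w}" "g q \<le> g p + 1 / (Suc n)" using R p by blast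
    then show "g h \<le> g p + e" using h(2)[OF q(1)] n by linarith
  qed
  have "g h \<le> g x" for x
  proof -
    have "closed {x. g h \<le> g x}" using g by (intro closed_Collect_le) (auto intro: continuous_intros)
    moreover have "\<rat> \<subseteq> {x. g h \<le> g x}" using rat by auto
    ultimately have "closure \<rat> \<subseteq> {x. g h \<le> g x}" by (intro closure_minimal)
    then show ?thesis by (auto simp: Rats_closure_real)
  qed
  then show "\<exists>h\<in>{u..w}. is_minimizer g h" using h(1) by (intro bexI[of _ h]) (auto simp: is_minimizer_def)
qed

lemma borel_measurable_argmin_continuous:
  fixes g :: "'a \<Rightarrow> real \<Rightarrow> real"
  assumes cont: "\<And>\<omega>. \<omega> \<in> space M \<Longrightarrow> continuous_on UNIV (g \<omega>)"
    and meas: "\<And>h. (\<lambda>\<omega>. g \<omega> h) \<in> borel_measurable M"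
  shows "(\<lambda>\<omega>. argmin (g \<omega>)) \<in> borel_measurable M"
proof (rule borel_measurable_argmin)
  fix a :: real
  let ?C = "\<lambda>u w. {\<omega> \<in> space M. \<exists>h\<in>{u..w}. is_minimizer (g \<omega>) h}"
  have C: "?C u w \<in> sets M" if uw: "u < w" for u w
  proof -
    have "?C u w = {\<omega> \<in> space M. \<forall>n::nat. \<exists>q\<in>\<rat> \<inter> {u..w}. \<forall>p\<in>\<rat>. g \<omega> q \<le> g \<omega> p + 1 / (Suc n)}"
      using exists_minimizer_interval_iff[OF cont uw] by blast
    also have "\<dots> = space M \<inter> (\<Inter>n::nat. \<Union>q\<in>\<rat> \<inter> {u..w}. {\<omega> \<in> space M. \<forall>p\<in>\<rat>. g \<omega> q \<le> g \<omega> p + 1 / (Suc n)})"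
      by auto
    also have "\<dots> \<in> sets M"
    proof (intro sets.Int sets.top sets.countable_INT image_subsetI)
      show "(\<Union>q\<in>\<rat> \<inter> {u..w}. {\<omega> \<in> space M. \<forall>p\<in>\<rat>. g \<omega> q \<le> g \<omega> p + 1 / (Suc n)}) \<in> sets M" for n :: nat
        by (intro sets.countable_UN'' sets_le_rationals meas countable_Int1 countable_rat)
    qed auto
    finally show ?thesis .
  qed
  have "{\<omega> \<in> space M. \<exists>h<a. is_minimizer (g \<omega>) h} = (\<Union>n::nat. ?C (a - 2 - real n) (a - 1 / Suc n))"
  proof (intro equalityI subsetI)
    fix \<omega> assume "\<omega> \<in> {\<omega> \<in> space M. \<exists>h<a. is_minimizer (g \<omega>) h}"
    then obtain h where h: "\<omega> \<in> space M" "h < a" "is_minimizer (g \<omega>) h" by blast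
    obtain m :: nat where m: "1 / Suc m < a - h" using h(2) nat_approx_posE[of "a - h"] by auto
    obtain l :: nat where l: "a - h \<le> real l" using real_arch_simple by blast
    have "1 / Suc (m + l) \<le> 1 / Suc m" by (simp add: frac_le)
    then have "h \<in> {a - 2 - real (m + l)..a - 1 / Suc (m + l)}" using m l by auto
    then show "\<omega> \<in> (\<Union>n::nat. ?C (a - 2 - real n) (a - 1 / Suc n))" using h by blast
  next
    fix \<omega> assume "\<omega> \<in> (\<Union>n::nat. ?C (a - 2 - real n) (a - 1 / Suc n))"
    then obtain n :: nat and h where h: "\<omega> \<in> space M" "h \<le> a - 1 / Suc n" "is_minimizer (g \<omega>) h" by auto
    have "h < a" using h(2) by (smt (verit) of_nat_0_less_iff zero_less_Suc zero_less_divide_1_iff)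
    then show "\<omega> \<in> {\<omega> \<in> space M. \<exists>h<a. is_minimizer (g \<omega>) h}" using h by blast
  qed
  also have "\<dots> \<in> sets M"
  proof (intro sets.countable_UN, safe)
    fix n :: nat
    have "1 / real (Suc n) \<le> 1" by simp
    then show "?C (a - 2 - real n) (a - 1 / Suc n) \<in> sets M" by (intro C) linarith
  qed
  finally show "{\<omega> \<in> space M. \<exists>h<a. is_minimizer (g \<omega>) h} \<in> sets M" .
qed (rule continuous_Inf_minimizer[OF cont])

section \<open>The limit process\<close>

lemma eventually_grid_point:
  fixes g :: "real \<Rightarrow> real" and a b t :: real
  assumes t: "a \<le> t" "t \<le> b" and g: "isCont g t" and S: "open S" "g t \<in> S"
  shows "\<forall>\<^sub>F m in sequentially. \<exists>k\<le>Suc m. g (a + real k * ((b - a) / real (Suc m))) \<in> S"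
proof -
  define \<delta> where "\<delta> m = (b - a) / real (Suc m)" for m
  define k where "k m = nat \<lfloor>(t - a) / \<delta> m\<rfloor>" for m
  have \<delta>0: "0 \<le> \<delta> m" for m using t by (simp add: \<delta>_def)
  have k: "k m \<le> Suc m \<and> \<bar>a + real (k m) * \<delta> m - t\<bar> \<le> \<delta> m" for m
  proof (cases "a = b")
    case True
    then show ?thesis using t by (simp add: k_def \<delta>_def)
  next
    case False
    then have \<delta>: "0 < \<delta> m" using t by (simp add: \<delta>_def)
    have "0 \<le> (t - a) / \<delta> m" using t \<delta> by simp
    then have f: "real (k m) \<le> (t - a) / \<delta> m" "(t - a) / \<delta> m < real (k m) + 1" unfolding k_def by linarith+
    then have f': "real (k m) * \<delta> m \<le> t - a" "t - a < real (k m) * \<delta> m + \<delta> m"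
      using \<delta> by (simp_all add: field_simps)
    have "(t - a) / \<delta> m \<le> (b - a) / \<delta> m" using t \<delta> by (intro divide_right_mono) auto
    also have "(b - a) / \<delta> m = real (Suc m)" using False t by (simp add: \<delta>_def)
    finally have "real (k m) \<le> real (Suc m)" using f(1) by linarith
    then show ?thesis using f' by auto
  qed
  have "\<delta> \<longlonglongrightarrow> 0"
    unfolding \<delta>_def using tendsto_mult[OF tendsto_const[of "b - a"] LIMSEQ_inverse_real_of_nat]
    by (simp add: divide_inverse)
  then have "(\<lambda>m. a + real (k m) * \<delta> m - t) \<longlonglongrightarrow> 0"
    by (rule Lim_null_comparison[rotated]) (use k in auto)
  then have "(\<lambda>m. a + real (k m) * \<delta> m) \<longlonglongrightarrow> t" by (rule Lim_null[THEN iffD2])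
  from isCont_tendsto_compose[OF g this] S
  have "\<forall>\<^sub>F m in sequentially. g (a + real (k m) * \<delta> m) \<in> S" by (rule topological_tendstoD)
  then show ?thesis
  proof eventually_elim
    case (elim m)
    then show ?case using k[of m] unfolding \<delta>_def by blast
  qed
qed

locale brownian = prob_space Q for Q :: "'b measure" +
  fixes W :: "real \<Rightarrow> 'b \<Rightarrow> real"
  assumes W: "two_sided_brownian_motion Q W"
begin

lemma W_measurable[measurable]: "W t \<in> borel_measurable Q"
  using W by (auto simp: two_sided_brownian_motion_def)

lemma W_0: "\<omega> \<in> space Q \<Longrightarrow> W 0 \<omega> = 0"
  using W by (auto simp: two_sided_brownian_motion_def)

lemma W_continuous: "\<omega> \<in> space Q \<Longrightarrow> continuous_on UNIV (\<lambda>t. W t \<omega>)"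
  using W by (auto simp: two_sided_brownian_motion_def)

lemma W_isCont: "\<omega> \<in> space Q \<Longrightarrow> isCont (\<lambda>t. W t \<omega>) t"
  using W_continuous by (simp add: continuous_on_eq_continuous_at)

lemma W_indep: "strict_mono t \<Longrightarrow> indep_vars (\<lambda>_. borel) (\<lambda>i \<omega>. W (t (Suc i)) \<omega> - W (t i) \<omega>) {..<n}"
  using W by (auto simp: two_sided_brownian_motion_def independent_increments_def)

lemma W_distributed: "s < t \<Longrightarrow> distributed Q lborel (\<lambda>\<omega>. W t \<omega> - W s \<omega>) (normal_density 0 (sqrt (t - s)))"
  using W by (auto simp: two_sided_brownian_motion_def)

lemma W_increment_moments:
  assumes "s < t"
  shows "integrable Q (\<lambda>\<omega>. (W t \<omega> - W s \<omega>)\<^sup>2)" "expectation (\<lambda>\<omega>. W t \<omega> - W s \<omega>) = 0"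
    "expectation (\<lambda>\<omega>. (W t \<omega> - W s \<omega>)\<^sup>2) = t - s"
    "integrable Q (\<lambda>\<omega>. (W t \<omega> - W s \<omega>) ^ 4)" "expectation (\<lambda>\<omega>. (W t \<omega> - W s \<omega>) ^ 4) = 3 * (t - s)\<^sup>2"
proof -
  have pos: "0 < sqrt (t - s)" using assms by simp
  note D = W_distributed[OF assms]
  have i: "integrable Q (\<lambda>\<omega>. (W t \<omega> - W s \<omega>) ^ k)" for k
    using distributed_integrable[OF D, of "\<lambda>x. x ^ k"] integrable_normal_moment[OF pos, of 0 k] by simp
  show "integrable Q (\<lambda>\<omega>. (W t \<omega> - W s \<omega>)\<^sup>2)" "integrable Q (\<lambda>\<omega>. (W t \<omega> - W s \<omega>) ^ 4)" by (rule i)+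
  show m: "expectation (\<lambda>\<omega>. W t \<omega> - W s \<omega>) = 0"
    by (rule normal_distributed_expectation[OF pos D])
  show "expectation (\<lambda>\<omega>. (W t \<omega> - W s \<omega>)\<^sup>2) = t - s"
    using normal_distributed_variance[OF pos D] m assms by simp
  have "expectation (\<lambda>\<omega>. (W t \<omega> - W s \<omega>) ^ 4) = (\<integral>x. normal_density 0 (sqrt (t - s)) x * x ^ 4 \<partial>lborel)"
    using distributed_integral[OF D, of "\<lambda>x. x ^ 4"] by simp
  also have "\<dots> = 3 * (t - s)\<^sup>2"
    using integral_normal_moment_even[OF pos, of 0 2] assms
    by (simp add: fact_numeral power4_eq_xxxx power2_eq_square power_divide field_simps)
  finally show "expectation (\<lambda>\<omega>. (W t \<omega> - W s \<omega>) ^ 4) = 3 * (t - s)\<^sup>2" .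
qed

lemma prob_increment_ge:
  assumes "s < t" "0 < x"
  shows "prob {\<omega> \<in> space Q. x \<le> \<bar>a * (W t \<omega> - W s \<omega>)\<bar>} \<le> 3 * a ^ 4 * (t - s)\<^sup>2 / x ^ 4"
proof -
  have "{\<omega> \<in> space Q. x \<le> \<bar>a * (W t \<omega> - W s \<omega>)\<bar>} \<subseteq> {\<omega> \<in> space Q. x ^ 4 \<le> (a * (W t \<omega> - W s \<omega>)) ^ 4}"
    using assms(2) by (auto intro!: order_trans[OF power_mono[of x _ 4]] simp: power_even_abs)
  then have "prob {\<omega> \<in> space Q. x \<le> \<bar>a * (W t \<omega> - W s \<omega>)\<bar>} \<le> prob {\<omega> \<in> space Q. x ^ 4 \<le> (a * (W t \<omega> - W s \<omega>)) ^ 4}"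
    by (intro finite_measure_mono) auto
  also have "\<dots> \<le> expectation (\<lambda>\<omega>. (a * (W t \<omega> - W s \<omega>)) ^ 4) / x ^ 4"
    using assms(2) W_increment_moments(4)[OF assms(1)]
    by (intro integral_Markov_inequality_measure[where A="{}"]) (auto simp: power_mult_distrib)
  also have "expectation (\<lambda>\<omega>. (a * (W t \<omega> - W s \<omega>)) ^ 4) = 3 * a ^ 4 * (t - s)\<^sup>2"
    using W_increment_moments(5)[OF assms(1)] by (simp add: power_mult_distrib)
  finally show ?thesis .
qed

text \<open>Maximal inequality in continuous time: Ottaviani's inequality on finer and finer grids.\<close>

lemma prob_max_W:
  assumes K: "0 < K" and l: "0 < l"
  shows "{\<omega> \<in> space Q. \<exists>t\<in>{-K..K}. 2 * l < \<bar>W t \<omega> - W (-K) \<omega>\<bar>} \<in> events" (is "?A \<in> _")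
    and "prob {\<omega> \<in> space Q. \<exists>t\<in>{-K..K}. 2 * l < \<bar>W t \<omega> - W (-K) \<omega>\<bar>} \<le> 4 * K / l\<^sup>2"
proof -
  define t where "t m k = - K + real k * ((K - - K) / real (Suc m))" for m k :: nat
  have tm: "strict_mono (t m)" for m
  proof (rule strict_monoI)
    fix x y :: nat
    assume "x < y"
    moreover have "0 < (K - - K) / real (Suc m)" using K by simp
    ultimately show "t m x < t m y"
      unfolding t_def by (simp only: add_less_cancel_left mult_less_cancel_right_pos of_nat_less_iff)
  qed
  have t0: "t m 0 = - K" for m by (simp add: t_def)
  have tS: "t m (Suc k) - t m k = 2 * K / real (Suc m)" for m k by (simp add: t_def algebra_simps add_divide_distrib)
  let ?E = "\<lambda>m. {\<omega> \<in> space Q. \<exists>k\<le>Suc m. 2 * l < \<bar>W (t m k) \<omega> - W (-K) \<omega>\<bar>}"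
  have E: "?E m \<in> events" for m by measurable
  have ev: "\<forall>\<^sub>F m in sequentially. \<omega> \<in> ?E m" if A: "\<omega> \<in> ?A" for \<omega>
  proof -
    obtain s where s: "s \<in> {-K..K}" "2 * l < \<bar>W s \<omega> - W (-K) \<omega>\<bar>" and \<omega>: "\<omega> \<in> space Q" using A by auto
    have "\<forall>\<^sub>F m in sequentially. \<exists>k\<le>Suc m. (\<lambda>t. \<bar>W t \<omega> - W (-K) \<omega>\<bar>) (- K + real k * ((K - - K) / real (Suc m))) \<in> {2 * l<..}"
      by (rule eventually_grid_point[of _ s]) (use s W_isCont[OF \<omega>] in \<open>auto intro!: continuous_intros\<close>)
    then show ?thesis using \<omega> by (auto simp: t_def elim!: eventually_mono)
  qed
  have tK: "t m k \<in> {-K..K}" if "k \<le> Suc m" for m k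
  proof -
    have "real k * (2 * K / real (Suc m)) \<le> real (Suc m) * (2 * K / real (Suc m))"
      using that K by (intro mult_right_mono) auto
    then show ?thesis using K by (simp add: t_def)
  qed
  have "?A = (\<Union>m. ?E m)"
  proof (intro equalityI subsetI)
    fix \<omega> assume "\<omega> \<in> ?A"
    from eventually_happens'[OF _ ev[OF this]] show "\<omega> \<in> (\<Union>m. ?E m)" by auto
  next
    fix \<omega> assume "\<omega> \<in> (\<Union>m. ?E m)"
    then obtain m k where "\<omega> \<in> space Q" "k \<le> Suc m" "2 * l < \<bar>W (t m k) \<omega> - W (-K) \<omega>\<bar>" by auto
    then show "\<omega> \<in> ?A" using tK by auto
  qed
  then show Am: "?A \<in> events" using E by auto
  have Ep: "prob (?E m) \<le> 4 * K / l\<^sup>2" for m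
  proof -
    let ?X = "\<lambda>i \<omega>. W (t m (Suc i)) \<omega> - W (t m i) \<omega>"
    have lt: "t m i < t m (Suc i)" for i using tm by (simp add: strict_mono_def)
    have "prob {\<omega> \<in> space Q. \<exists>k\<le>Suc m. 2 * l \<le> \<bar>\<Sum>i<k. ?X i \<omega>\<bar>} \<le> 2 * (real (Suc m) * (2 * K / real (Suc m)) / l\<^sup>2)"
      using W_increment_moments[OF lt] l unfolding tS
      by (intro prob_max_sum_ge W_indep[OF tm]) auto
    also have "2 * (real (Suc m) * (2 * K / real (Suc m)) / l\<^sup>2) = 4 * K / l\<^sup>2" by simp
    finally have "prob {\<omega> \<in> space Q. \<exists>k\<le>Suc m. 2 * l \<le> \<bar>\<Sum>i<k. ?X i \<omega>\<bar>} \<le> 4 * K / l\<^sup>2" .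
    moreover have "prob (?E m) \<le> prob {\<omega> \<in> space Q. \<exists>k\<le>Suc m. 2 * l \<le> \<bar>\<Sum>i<k. ?X i \<omega>\<bar>}"
    proof (rule finite_measure_mono)
      have "(\<Sum>i<k. ?X i \<omega>) = W (t m k) \<omega> - W (-K) \<omega>" for k \<omega>
        by (subst sum_lessThan_telescope) (simp add: t0)
      then show "?E m \<subseteq> {\<omega> \<in> space Q. \<exists>k\<le>Suc m. 2 * l \<le> \<bar>\<Sum>i<k. ?X i \<omega>\<bar>}" by fastforce
    qed measurable
    ultimately show ?thesis by linarith
  qed
  have "prob ?A \<le> 4 * K / l\<^sup>2 + e" if e: "0 < e" for e
  proof -
    have "\<forall>\<^sub>F m in sequentially. prob (space Q - ?E m) < prob (space Q - ?A) + e"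
    proof (rule eventually_prob_less)
      show "AE \<omega> in Q. (\<forall>\<^sub>F m in sequentially. \<omega> \<notin> space Q - ?E m) \<or> \<omega> \<in> space Q - ?A"
        using ev by (intro AE_I2) (auto elim!: eventually_mono)
    qed (use E Am e in auto)
    from eventually_happens'[OF _ this] obtain m where "prob (space Q - ?E m) < prob (space Q - ?A) + e" by auto
    then show ?thesis using prob_compl[OF E[of m]] prob_compl[OF Am] Ep[of m] by linarith
  qed
  then show "prob ?A \<le> 4 * K / l\<^sup>2" by (rule field_le_epsilon)
qed

text \<open>Borel-Cantelli on the windows \<open>[- 2 ^ (j+1), 2 ^ (j+1)]\<close>: the maximal inequality with a bound of
  order \<open>4 ^ j\<close> fails with probability of order \<open>8 ^ (- j)\<close>.\<close>

lemma AE_W_le_square: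
  assumes "0 < e"
  shows "AE \<omega> in Q. \<exists>H>0. \<forall>t. H \<le> \<bar>t\<bar> \<longrightarrow> \<bar>W t \<omega>\<bar> \<le> e * t\<^sup>2"
proof -
  define A where "A j = {\<omega> \<in> space Q. \<exists>t\<in>{- (2 ^ Suc j)..2 ^ Suc j}. 2 * (e * 4 ^ j / 4) < \<bar>W t \<omega> - W (- (2 ^ Suc j)) \<omega>\<bar>}" for j :: nat
  have A: "A j \<in> events" "prob (A j) \<le> 4 * 2 ^ Suc j / (e * 4 ^ j / 4)\<^sup>2" for j
    unfolding A_def using assms by (intro prob_max_W; simp)+
  have eq: "4 * 2 ^ Suc j / (e * 4 ^ j / 4)\<^sup>2 = 128 / e\<^sup>2 * (1 / 8) ^ j" for j :: nat
  proof -
    have "(4 ^ j * 4 ^ j :: real) = 2 ^ j * 8 ^ j"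
      by (simp add: power_mult_distrib[symmetric])
    then show ?thesis using assms by (simp add: power2_eq_square power_divide field_simps)
  qed
  have "summable (\<lambda>j. prob (A j))"
  proof (rule summable_comparison_test'[of "\<lambda>j. 128 / e\<^sup>2 * (1 / 8) ^ j" 0])
    show "summable (\<lambda>j. 128 / e\<^sup>2 * (1 / 8 :: real) ^ j)" by (intro summable_mult summable_geometric) auto
    show "norm (prob (A j)) \<le> 128 / e\<^sup>2 * (1 / 8) ^ j" for j using A(2)[of j] unfolding eq by simp
  qed
  then have "AE \<omega> in Q. \<forall>\<^sub>F j in sequentially. \<omega> \<in> space Q - A j"
    using A(1) by (intro borel_cantelli_AE1) (auto simp: emeasure_eq_measure)
  then show ?thesis
  proof eventually_elim
    case (elim \<omega>)
    then obtain J where J: "\<And>j. J \<le> j \<Longrightarrow> \<omega> \<in> space Q - A j" by (auto simp: eventually_sequentially)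
    have \<omega>: "\<omega> \<in> space Q" using J[of J] by auto
    have "\<bar>W t \<omega>\<bar> \<le> e * t\<^sup>2" if t: "2 ^ J \<le> \<bar>t\<bar>" for t
    proof -
      have "(1::real) \<le> 2 ^ J" by simp
      then have t1: "1 \<le> \<bar>t\<bar>" using t by linarith
      then have "1 \<le> nat \<lfloor>\<bar>t\<bar>\<rfloor>" by (simp add: le_nat_iff)
      then obtain j where j: "2 ^ j \<le> nat \<lfloor>\<bar>t\<bar>\<rfloor>" "nat \<lfloor>\<bar>t\<bar>\<rfloor> < 2 ^ (j + 1)"
        using ex_power_ivl1[of 2 "nat \<lfloor>\<bar>t\<bar>\<rfloor>"] by auto
      have j1: "2 ^ j \<le> \<bar>t\<bar>" using j(1) t1 by (simp add: le_nat_iff le_floor_iff)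
      have j2: "\<bar>t\<bar> < 2 ^ Suc j" using j(2) t1 by (simp add: nat_less_iff floor_less_iff)
      have "(2::real) ^ J < 2 ^ Suc j" using t j2 by linarith
      then have "J \<le> j" by (simp add: power_strict_increasing_iff del: power_Suc)
      then have nA: "\<bar>W s \<omega> - W (- (2 ^ Suc j)) \<omega>\<bar> \<le> 2 * (e * 4 ^ j / 4)" if "s \<in> {- (2 ^ Suc j)..2 ^ Suc j}" for s
        using J[of j] that \<omega> unfolding A_def by (auto simp: not_less)
      have "\<bar>W t \<omega> - W (- (2 ^ Suc j)) \<omega>\<bar> \<le> 2 * (e * 4 ^ j / 4)" "\<bar>W 0 \<omega> - W (- (2 ^ Suc j)) \<omega>\<bar> \<le> 2 * (e * 4 ^ j / 4)"
      proof -
        have "t \<in> {- (2 ^ Suc j)..2 ^ Suc j}" using j2 unfolding atLeastAtMost_iff by linarith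
        from nA[OF this] show "\<bar>W t \<omega> - W (- (2 ^ Suc j)) \<omega>\<bar> \<le> 2 * (e * 4 ^ j / 4)" .
        show "\<bar>W 0 \<omega> - W (- (2 ^ Suc j)) \<omega>\<bar> \<le> 2 * (e * 4 ^ j / 4)" by (rule nA) simp
      qed
      then have "\<bar>W t \<omega> - W 0 \<omega>\<bar> \<le> e * 4 ^ j" by linarith
      also have "e * 4 ^ j = e * (2 ^ j)\<^sup>2" by (simp add: power_mult[symmetric] power2_eq_square power_mult_distrib[symmetric])
      also have "\<dots> \<le> e * \<bar>t\<bar>\<^sup>2" using j1 assms by (intro mult_left_mono power_mono) auto
      finally show ?thesis using W_0[OF \<omega>] by simp
    qed
    then show ?case by (intro exI[of _ "2 ^ J"]) auto
  qed
qed

end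

text \<open>An independent summand with bounded density leaves no room for atoms.\<close>

lemma (in prob_space) prob_indep_sum_small:
  fixes G V :: "'a \<Rightarrow> real"
  assumes ind: "indep_var borel G borel V" and G: "distributed M lborel G (\<lambda>x. ennreal (f x))"
    and f: "\<And>x. f x \<le> C" "0 \<le> C" and a: "0 < a" and e: "0 < e"
  shows "prob {\<omega> \<in> space M. \<bar>V \<omega> - a * G \<omega>\<bar> < e} \<le> C * (2 * e / a)"
proof -
  have [measurable]: "random_variable borel G" "random_variable borel V"
    using indep_var_rv1[OF ind] indep_var_rv2[OF ind] by auto
  interpret G: prob_space "distr M borel G" by (rule prob_space_distr) simp
  interpret V: prob_space "distr M borel V" by (rule prob_space_distr) simp
  interpret P: pair_sigma_finite "distr M borel G" "distr M borel V" ..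
  define B where "B = {p :: real \<times> real. \<bar>snd p - a * fst p\<bar> < e}"
  have B[measurable]: "B \<in> sets (borel \<Otimes>\<^sub>M borel)"
  proof -
    have "B = {p \<in> space (borel \<Otimes>\<^sub>M borel). \<bar>snd p - a * fst p\<bar> < e}"
      by (simp add: B_def space_pair_measure)
    also have "\<dots> \<in> sets (borel \<Otimes>\<^sub>M borel)" by measurable
    finally show ?thesis .
  qed
  have sec: "emeasure (distr M borel G) ((\<lambda>x. (x, y)) -` B) \<le> ennreal (C * (2 * e / a))" for y
  proof -
    have s: "(\<lambda>x. (x, y)) -` B = {(y - e) / a <..< (y + e) / a}"
      using a by (auto simp: B_def field_simps abs_less_iff)
    have "emeasure (distr M borel G) {(y - e) / a <..< (y + e) / a} = emeasure (distr M lborel G) {(y - e) / a <..< (y + e) / a}"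
      by (simp cong: distr_cong)
    also have "\<dots> = emeasure (density lborel f) {(y - e) / a <..< (y + e) / a}"
      using distributed_distr_eq_density[OF G] by simp
    also have "\<dots> = (\<integral>\<^sup>+x. ennreal (f x) * indicator {(y - e) / a <..< (y + e) / a} x \<partial>lborel)"
      using distributed_borel_measurable[OF G] by (intro emeasure_density) auto
    also have "\<dots> \<le> (\<integral>\<^sup>+x. ennreal C * indicator {(y - e) / a <..< (y + e) / a} x \<partial>lborel)"
      using f by (intro nn_integral_mono mult_right_mono ennreal_leI) auto
    also have "\<dots> = ennreal C * emeasure lborel {(y - e) / a <..< (y + e) / a}"
      by (simp add: nn_integral_cmult_indicator)
    also have "emeasure lborel {(y - e) / a <..< (y + e) / a} = ennreal (2 * e / a)"
      using a e by (simp add: divide_right_mono diff_divide_distrib add_divide_distrib)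
    also have "ennreal C * ennreal (2 * e / a) = ennreal (C * (2 * e / a))"
      by (subst ennreal_mult[symmetric]) (use f a e in auto)
    finally show ?thesis unfolding s .
  qed
  have "emeasure M {\<omega> \<in> space M. \<bar>V \<omega> - a * G \<omega>\<bar> < e} = emeasure (distr M (borel \<Otimes>\<^sub>M borel) (\<lambda>x. (G x, V x))) B"
  proof -
    have "(\<lambda>x. (G x, V x)) -` B \<inter> space M = {\<omega> \<in> space M. \<bar>V \<omega> - a * G \<omega>\<bar> < e}" by (auto simp: B_def)
    then show ?thesis using emeasure_distr[OF _ B, of "\<lambda>x. (G x, V x)" M] by simp
  qed
  also have "distr M (borel \<Otimes>\<^sub>M borel) (\<lambda>x. (G x, V x)) = distr M borel G \<Otimes>\<^sub>M distr M borel V"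
    using ind by (simp add: indep_var_distribution_eq)
  also have "emeasure \<dots> B = (\<integral>\<^sup>+y. emeasure (distr M borel G) ((\<lambda>x. (x, y)) -` B) \<partial>distr M borel V)"
    by (intro P.emeasure_pair_measure_alt2) (simp add: B cong: sets_pair_measure_cong)
  also have "\<dots> \<le> (\<integral>\<^sup>+y. ennreal (C * (2 * e / a)) \<partial>distr M borel V)"
    by (intro nn_integral_mono sec)
  also have "\<dots> = ennreal (C * (2 * e / a))" by (simp add: V.emeasure_space_1[simplified])
  finally show ?thesis using f a e by (simp add: emeasure_eq_measure)
qed

locale brownian_parabola = brownian Q W for Q :: "'b measure" and W +
  fixes a b :: real
  assumes a: "0 \<le> a" and b: "0 < b"
begin

definition Z :: "'b \<Rightarrow> real \<Rightarrow> real" where "Z \<omega> h = a * W h \<omega> + b * h\<^sup>2"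

lemma Z_measurable[measurable]: "(\<lambda>\<omega>. Z \<omega> h) \<in> borel_measurable Q"
  unfolding Z_def by measurable

lemma Z_0: "\<omega> \<in> space Q \<Longrightarrow> Z \<omega> 0 = 0"
  by (simp add: Z_def W_0)

lemma Z_continuous: "\<omega> \<in> space Q \<Longrightarrow> continuous_on UNIV (Z \<omega>)"
  unfolding Z_def[abs_def] by (intro continuous_intros W_continuous)

lemma AE_Z_coercive: "AE \<omega> in Q. \<exists>H>0. \<forall>t. H \<le> \<bar>t\<bar> \<longrightarrow> b / 2 * t\<^sup>2 \<le> Z \<omega> t"
proof -
  have "0 < b / (2 * (a + 1))" using a b by simp
  from AE_W_le_square[OF this] show ?thesis
  proof eventually_elim
    case (elim \<omega>)
    then obtain H where H: "0 < H" "\<And>t. H \<le> \<bar>t\<bar> \<Longrightarrow> \<bar>W t \<omega>\<bar> \<le> b / (2 * (a + 1)) * t\<^sup>2" by blast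
    have "b / 2 * t\<^sup>2 \<le> Z \<omega> t" if "H \<le> \<bar>t\<bar>" for t
    proof -
      have "\<bar>a * W t \<omega>\<bar> = a * \<bar>W t \<omega>\<bar>" using a by (simp add: abs_mult)
      also have "\<dots> \<le> a * (b / (2 * (a + 1)) * t\<^sup>2)" by (intro mult_left_mono H(2) that a)
      also have "\<dots> = a / (a + 1) * (b / 2 * t\<^sup>2)" using a by (simp add: field_simps)
      also have "\<dots> \<le> 1 * (b / 2 * t\<^sup>2)" using a b by (intro mult_right_mono) auto
      finally show ?thesis by (simp add: Z_def abs_le_iff)
    qed
    then show ?case using H(1) by blast
  qed
qed

text \<open>Minima over grids to the left of \<open>q\<close> and to the right of \<open>r\<close> differ by a function of the
  increments outside \<open>[q, r]\<close> minus a multiple of the independent Gaussian \<open>W r - W q\<close>.\<close>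

lemma prob_grid_minima_close:
  fixes n :: nat and q r \<delta> e :: real
  assumes qr: "q < r" and "0 < \<delta>" and e: "0 < e" and a0: "0 < a"
  shows "prob {\<omega> \<in> space Q. \<bar>Min ((\<lambda>k. Z \<omega> (q - real k * \<delta>)) ` {..n}) - Min ((\<lambda>k. Z \<omega> (r + real k * \<delta>)) ` {..n})\<bar> < e}
    \<le> 1 / sqrt (2 * pi * (r - q)) * (2 * e / a)"
proof -
  define t where "t k = (if k \<le> n then q - real (n - k) * \<delta> else r + real (k - Suc n) * \<delta>)" for k :: nat
  have tm: "strict_mono t"
  proof (rule strict_mono_Suc_iff[THEN iffD2], rule allI)
    fix k
    consider "k < n" | "k = n" | "n < k" by linarith
    then show "t k < t (Suc k)"
    proof cases
      case 1
      then have "n - k = Suc (n - Suc k)" by simp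
      then show ?thesis using 1 \<open>0 < \<delta>\<close> by (simp add: t_def algebra_simps)
    next
      case 2
      then show ?thesis using qr by (simp add: t_def)
    next
      case 3
      then have "Suc k - Suc n = Suc (k - Suc n)" by simp
      then show ?thesis using 3 \<open>0 < \<delta>\<close> by (simp add: t_def algebra_simps)
    qed
  qed
  define X where "X i \<omega> = W (t (Suc i)) \<omega> - W (t i) \<omega>" for i \<omega>
  have Xm[measurable]: "X i \<in> borel_measurable Q" for i unfolding X_def by measurable
  let ?I = "{..<Suc n + n}" and ?J = "{..<Suc n + n} - {n}"
  have X: "indep_vars (\<lambda>_. borel) X ?I" unfolding X_def by (rule W_indep[OF tm])
  define Lf where "Lf x = Min ((\<lambda>k. b * (q - real k * \<delta>)\<^sup>2 - a * (\<Sum>i\<in>{n - k..<n}. x i)) ` {..n})" for x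
  define Rf where "Rf x = Min ((\<lambda>k. b * (r + real k * \<delta>)\<^sup>2 + a * (\<Sum>i\<in>{Suc n..<Suc n + k}. x i)) ` {..n})" for x
  let ?PJ = "PiM ?J (\<lambda>_. borel :: real measure)"
  have Lm: "Lf \<in> borel_measurable ?PJ"
    unfolding Lf_def by (intro borel_measurable_Min borel_measurable_diff borel_measurable_const borel_measurable_times borel_measurable_sum measurable_component_singleton) auto
  have Rm: "Rf \<in> borel_measurable ?PJ"
    unfolding Rf_def by (intro borel_measurable_Min borel_measurable_add borel_measurable_const borel_measurable_times borel_measurable_sum measurable_component_singleton) auto
  define V where "V \<omega> = Lf (restrict (\<lambda>i. X i \<omega>) ?J) - Rf (restrict (\<lambda>i. X i \<omega>) ?J)" for \<omega>
  have iv: "indep_var borel (X n) borel V"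
  proof -
    have "indep_var (PiM {n} (\<lambda>_. borel)) (\<lambda>\<omega>. restrict (\<lambda>i. X i \<omega>) {n}) ?PJ (\<lambda>\<omega>. restrict (\<lambda>i. X i \<omega>) ?J)"
      by (rule indep_var_restrict[OF X]) auto
    then have "indep_var borel ((\<lambda>x. x n) \<circ> (\<lambda>\<omega>. restrict (\<lambda>i. X i \<omega>) {n})) borel
        ((\<lambda>x. Lf x - Rf x) \<circ> (\<lambda>\<omega>. restrict (\<lambda>i. X i \<omega>) ?J))"
      by (rule indep_var_compose) (use Lm Rm in \<open>auto intro: measurable_component_singleton borel_measurable_diff\<close>)
    moreover have "(\<lambda>x. x n) \<circ> (\<lambda>\<omega>. restrict (\<lambda>i. X i \<omega>) {n}) = X n" by auto
    moreover have "(\<lambda>x. Lf x - Rf x) \<circ> (\<lambda>\<omega>. restrict (\<lambda>i. X i \<omega>) ?J) = V" by (auto simp: V_def)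
    ultimately show ?thesis by simp
  qed
  have Xn: "X n = (\<lambda>\<omega>. W r \<omega> - W q \<omega>)" by (auto simp: X_def t_def)
  have tel: "(\<Sum>i\<in>{j..<k}. X i \<omega>) = W (t k) \<omega> - W (t j) \<omega>" if "j \<le> k" for j k \<omega>
    using that unfolding X_def by (rule sum_Suc_diff'[of j k "\<lambda>i. W (t i) \<omega>"])
  have tn: "t n = q" "t (Suc n) = r" by (auto simp: t_def)
  have Min_shift: "Min ((\<lambda>k. c + h k) ` {..n}) = c + Min (h ` {..n})" for c and h :: "nat \<Rightarrow> real"
    using Min_add_commute[of "{..n}" h c] by (simp add: add.commute)
  have L: "Min ((\<lambda>k. Z \<omega> (q - real k * \<delta>)) ` {..n}) = a * W q \<omega> + Lf (restrict (\<lambda>i. X i \<omega>) ?J)" for \<omega>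
  proof -
    have "Z \<omega> (q - real k * \<delta>) = a * W q \<omega> + (b * (q - real k * \<delta>)\<^sup>2 - a * (\<Sum>i\<in>{n - k..<n}. restrict (\<lambda>i. X i \<omega>) ?J i))"
      if k: "k \<le> n" for k
    proof -
      have "(\<Sum>i\<in>{n - k..<n}. restrict (\<lambda>i. X i \<omega>) ?J i) = (\<Sum>i\<in>{n - k..<n}. X i \<omega>)"
        by (rule sum.cong) auto
      also have "\<dots> = W q \<omega> - W (q - real k * \<delta>) \<omega>"
        using k tel[of "n - k" n \<omega>] by (simp add: tn) (simp add: t_def)
      finally show ?thesis by (simp only: Z_def) (simp add: algebra_simps)
    qed
    then have "(\<lambda>k. Z \<omega> (q - real k * \<delta>)) ` {..n}
        = (\<lambda>k. a * W q \<omega> + (b * (q - real k * \<delta>)\<^sup>2 - a * (\<Sum>i\<in>{n - k..<n}. restrict (\<lambda>i. X i \<omega>) ?J i))) ` {..n}"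
      by (intro image_cong) auto
    then show ?thesis unfolding Lf_def by (simp only: Min_shift)
  qed
  have R: "Min ((\<lambda>k. Z \<omega> (r + real k * \<delta>)) ` {..n}) = a * W r \<omega> + Rf (restrict (\<lambda>i. X i \<omega>) ?J)" for \<omega>
  proof -
    have "Z \<omega> (r + real k * \<delta>) = a * W r \<omega> + (b * (r + real k * \<delta>)\<^sup>2 + a * (\<Sum>i\<in>{Suc n..<Suc n + k}. restrict (\<lambda>i. X i \<omega>) ?J i))"
      if k: "k \<le> n" for k
    proof -
      have "(\<Sum>i\<in>{Suc n..<Suc n + k}. restrict (\<lambda>i. X i \<omega>) ?J i) = (\<Sum>i\<in>{Suc n..<Suc n + k}. X i \<omega>)"
        by (rule sum.cong) (use k in auto)
      also have "\<dots> = W (r + real k * \<delta>) \<omega> - W r \<omega>"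
        using tel[of "Suc n" "Suc n + k" \<omega>] by (simp add: tn) (simp add: t_def)
      finally show ?thesis by (simp only: Z_def) (simp add: algebra_simps)
    qed
    then have "(\<lambda>k. Z \<omega> (r + real k * \<delta>)) ` {..n}
        = (\<lambda>k. a * W r \<omega> + (b * (r + real k * \<delta>)\<^sup>2 + a * (\<Sum>i\<in>{Suc n..<Suc n + k}. restrict (\<lambda>i. X i \<omega>) ?J i))) ` {..n}"
      by (intro image_cong) auto
    then show ?thesis unfolding Rf_def by (simp only: Min_shift)
  qed
  have "Min ((\<lambda>k. Z \<omega> (q - real k * \<delta>)) ` {..n}) - Min ((\<lambda>k. Z \<omega> (r + real k * \<delta>)) ` {..n}) = V \<omega> - a * X n \<omega>" for \<omega>
    unfolding L R V_def Xn by (simp add: algebra_simps)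
  moreover have "prob {\<omega> \<in> space Q. \<bar>V \<omega> - a * X n \<omega>\<bar> < e} \<le> 1 / sqrt (2 * pi * (r - q)) * (2 * e / a)"
  proof (rule prob_indep_sum_small[OF iv _ _ _ a0 e])
    show "distributed Q lborel (X n) (\<lambda>x. ennreal (normal_density 0 (sqrt (r - q)) x))"
      unfolding Xn using W_distributed[OF qr] by simp
    show "normal_density 0 (sqrt (r - q)) x \<le> 1 / sqrt (2 * pi * (r - q))" for x
      using qr by (auto simp: normal_density_def intro!: mult_left_le divide_right_mono)
    show "0 \<le> 1 / sqrt (2 * pi * (r - q))" using qr by simp
  qed
  ultimately show ?thesis by simp
qed

text \<open>Two minimizers in separated intervals bring the grid minima over these intervals together as the
  mesh tends to \<open>0\<close>, and each distance \<open>1 / Suc i\<close> is undercut with probability of order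
  \<open>1 / Suc i\<close> only.\<close>

lemma AE_no_tie:
  fixes q r K :: real
  assumes a0: "0 < a" and qr: "q < r" and K: "0 < K"
  shows "AE \<omega> in Q. \<not> (\<exists>h1\<in>{q - K..q}. \<exists>h2\<in>{r..r + K}. is_minimizer (Z \<omega>) h1 \<and> is_minimizer (Z \<omega>) h2)"
proof -
  define \<delta> where "\<delta> m = K / real (Suc m)" for m :: nat
  have \<delta>: "0 < \<delta> m" for m using K by (simp add: \<delta>_def)
  let ?l = "\<lambda>m \<omega>. Min ((\<lambda>k. Z \<omega> (q - real k * \<delta> m)) ` {..Suc m})"
  let ?r = "\<lambda>m \<omega>. Min ((\<lambda>k. Z \<omega> (r + real k * \<delta> m)) ` {..Suc m})"
  let ?E = "\<lambda>m i. {\<omega> \<in> space Q. \<bar>?l m \<omega> - ?r m \<omega>\<bar> < 1 / Suc i}"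
  have E: "?E m i \<in> events" for m i by measurable
  define U where "U i = {\<omega> \<in> space Q. \<forall>\<^sub>F m in sequentially. \<omega> \<in> ?E m i}" for i :: nat
  have U: "U i \<in> events" for i unfolding U_def eventually_sequentially by measurable
  let ?C = "1 / sqrt (2 * pi * (r - q)) * (2 / a)"
  have C: "0 \<le> ?C" using qr a0 by simp
  have pU: "prob (U i) \<le> ?C * (1 / Suc i)" for i
  proof (rule field_le_epsilon)
    fix e :: real assume e: "0 < e"
    have "\<forall>\<^sub>F m in sequentially. prob (space Q - ?E m i) < prob (space Q - U i) + e"
    proof (rule eventually_prob_less)
      show "AE \<omega> in Q. (\<forall>\<^sub>F m in sequentially. \<omega> \<notin> space Q - ?E m i) \<or> \<omega> \<in> space Q - U i"
        unfolding U_def by (intro AE_I2) (auto elim!: eventually_mono)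
    qed (use E U e in auto)
    from eventually_happens'[OF _ this] obtain m where "prob (space Q - ?E m i) < prob (space Q - U i) + e" by auto
    moreover have "prob (?E m i) \<le> 1 / sqrt (2 * pi * (r - q)) * (2 * (1 / Suc i) / a)"
      by (rule prob_grid_minima_close[OF qr \<delta> _ a0]) simp
    moreover have "1 / sqrt (2 * pi * (r - q)) * (2 * (1 / Suc i) / a) = ?C * (1 / Suc i)" by simp
    ultimately show "prob (U i) \<le> ?C * (1 / Suc i) + e"
      using prob_compl[OF E[of m i]] prob_compl[OF U[of i]] by linarith
  qed
  have "prob (\<Inter>i. U i) \<le> ?C * (1 / Suc i)" for i
    using finite_measure_mono[of "\<Inter>i. U i" "U i"] U pU[of i] by (auto intro: order_trans)
  moreover have "(\<lambda>i. ?C * (1 / Suc i)) \<longlonglongrightarrow> ?C * 0"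
    by (intro tendsto_intros LIMSEQ_Suc[OF lim_1_over_n])
  ultimately have "prob (\<Inter>i. U i) \<le> ?C * 0"
    by (intro LIMSEQ_le_const) auto
  then have "(\<Inter>i. U i) \<in> null_sets Q"
    using U by (intro null_setsI) (auto simp: emeasure_eq_measure measure_le_0_iff)
  moreover have "{\<omega> \<in> space Q. \<not> \<not> (\<exists>h1\<in>{q - K..q}. \<exists>h2\<in>{r..r + K}. is_minimizer (Z \<omega>) h1 \<and> is_minimizer (Z \<omega>) h2)} \<subseteq> (\<Inter>i. U i)"
  proof (intro subsetI INT_I)
    fix \<omega> and i :: nat
    assume "\<omega> \<in> {\<omega> \<in> space Q. \<not> \<not> (\<exists>h1\<in>{q - K..q}. \<exists>h2\<in>{r..r + K}. is_minimizer (Z \<omega>) h1 \<and> is_minimizer (Z \<omega>) h2)}"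
    then obtain h1 h2 where \<omega>: "\<omega> \<in> space Q"
      and h: "h1 \<in> {q - K..q}" "h2 \<in> {r..r + K}" "is_minimizer (Z \<omega>) h1" "is_minimizer (Z \<omega>) h2" by blast
    have cont: "isCont (Z \<omega>) x" for x
      using Z_continuous[OF \<omega>] by (simp add: continuous_on_eq_continuous_at)
    have eq: "Z \<omega> h1 = Z \<omega> h2" and le: "\<And>x. Z \<omega> h1 \<le> Z \<omega> x" using h by (auto simp: is_minimizer_def intro: antisym)
    let ?S = "{..<Z \<omega> h1 + 1 / Suc i}"
    have "\<forall>\<^sub>F m in sequentially. \<exists>k\<le>Suc m. (\<lambda>x. Z \<omega> (q - x)) (0 + real k * ((K - 0) / real (Suc m))) \<in> ?S"
      by (rule eventually_grid_point[of _ "q - h1"])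
        (use h in \<open>auto intro!: isCont_o2[where g="Z \<omega>", OF _ cont] continuous_intros\<close>)
    moreover have "\<forall>\<^sub>F m in sequentially. \<exists>k\<le>Suc m. (\<lambda>x. Z \<omega> (r + x)) (0 + real k * ((K - 0) / real (Suc m))) \<in> ?S"
      by (rule eventually_grid_point[of _ "h2 - r"])
        (use h eq in \<open>auto intro!: isCont_o2[where g="Z \<omega>", OF _ cont] continuous_intros\<close>)
    ultimately have "\<forall>\<^sub>F m in sequentially. \<omega> \<in> ?E m i"
    proof eventually_elim
      case (elim m)
      then obtain k k' where k: "k \<le> Suc m" "Z \<omega> (q - real k * \<delta> m) < Z \<omega> h1 + 1 / Suc i"
        and k': "k' \<le> Suc m" "Z \<omega> (r + real k' * \<delta> m) < Z \<omega> h1 + 1 / Suc i" by (auto simp: \<delta>_def)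
      have "?l m \<omega> \<le> Z \<omega> (q - real k * \<delta> m)" "?r m \<omega> \<le> Z \<omega> (r + real k' * \<delta> m)"
        using k(1) k'(1) by (auto intro!: Min_le)
      moreover have "Z \<omega> h1 \<le> ?l m \<omega>" "Z \<omega> h1 \<le> ?r m \<omega>" using le by auto
      ultimately have "\<bar>?l m \<omega> - ?r m \<omega>\<bar> < 1 / Suc i" using k(2) k'(2) by linarith
      then show ?case using \<omega> by blast
    qed
    then show "\<omega> \<in> U i" using \<omega> by (simp add: U_def)
  qed
  ultimately show ?thesis by (rule AE_I')
qed

text \<open>Two distinct minimizers would be separated by rational numbers \<open>q < r\<close>. Without noise, for
  \<open>a = 0\<close>, the process is a parabola.\<close>

lemma AE_ex1_minimizer: "AE \<omega> in Q. \<exists>!h. is_minimizer (Z \<omega>) h"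
proof (cases "a = 0")
  case True
  have "Z \<omega> = (\<lambda>h. b * h\<^sup>2)" for \<omega> unfolding Z_def[abs_def] by (simp add: True)
  moreover have "is_minimizer (\<lambda>h. b * h\<^sup>2) h \<longleftrightarrow> h = 0" for h
    using b by (auto simp: is_minimizer_def dest: spec[of _ 0])
  ultimately have "is_minimizer (Z \<omega>) h \<longleftrightarrow> h = 0" for \<omega> h by simp
  then show ?thesis by simp
next
  case False
  then have a0: "0 < a" using a by simp
  have "AE \<omega> in Q. \<forall>q\<in>\<rat>. \<forall>r\<in>\<rat>. \<forall>m::nat. q < r \<longrightarrow>
      \<not> (\<exists>h1\<in>{q - real (Suc m)..q}. \<exists>h2\<in>{r..r + real (Suc m)}. is_minimizer (Z \<omega>) h1 \<and> is_minimizer (Z \<omega>) h2)"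
    by (intro AE_ball_countable' countable_rat AE_all_countable[THEN iffD2] allI)
      (use AE_no_tie[OF a0] in \<open>auto intro: AE_impI\<close>)
  with AE_Z_coercive AE_space show ?thesis
  proof eventually_elim
    case (elim \<omega>)
    obtain H where H: "0 < H" "\<And>t. H \<le> \<bar>t\<bar> \<Longrightarrow> b / 2 * t\<^sup>2 \<le> Z \<omega> t" using elim(1) by blast
    have "continuous_on {-H..H} (Z \<omega>)" using Z_continuous[OF elim(2)] by (rule continuous_on_subset) simp
    then obtain h where h: "h \<in> {-H..H}" "\<And>x. x \<in> {-H..H} \<Longrightarrow> Z \<omega> h \<le> Z \<omega> x"
      using continuous_attains_inf[of "{-H..H}" "Z \<omega>"] H(1) by force
    have "Z \<omega> h \<le> 0" using h(2)[of 0] H(1) Z_0[OF elim(2)] by simp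
    have "Z \<omega> h \<le> Z \<omega> x" for x
    proof (cases "x \<in> {-H..H}")
      case False
      then have "b / 2 * x\<^sup>2 \<le> Z \<omega> x" by (intro H(2)) auto
      moreover have "0 \<le> b / 2 * x\<^sup>2" using b by simp
      ultimately show ?thesis using \<open>Z \<omega> h \<le> 0\<close> by linarith
    qed (rule h(2))
    then have min: "is_minimizer (Z \<omega>) h" by (simp add: is_minimizer_def)
    have less: False if m: "is_minimizer (Z \<omega>) x" "is_minimizer (Z \<omega>) y" "x < y" for x y
    proof -
      obtain q where q: "q \<in> \<rat>" "x < q" "q < y" using Rats_dense_in_real[OF m(3)] by blast
      obtain r where r: "r \<in> \<rat>" "q < r" "r < y" using Rats_dense_in_real[OF q(3)] by blast
      obtain k :: nat where k: "max (q - x) (y - r) \<le> real k" using real_arch_simple by blast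
      have "x \<in> {q - real (Suc k)..q}" "y \<in> {r..r + real (Suc k)}" using q r k by auto
      then show False using elim(3) q(1) r(1,2) m by blast
    qed
    show ?case
    proof (rule ex1I)
      show "is_minimizer (Z \<omega>) h" by (rule min)
      show "x = h" if "is_minimizer (Z \<omega>) x" for x
        using less[OF that min] less[OF min that] by (cases rule: linorder_cases[of x h]) auto
    qed
  qed
qed

end

section \<open>The two-sided compound process\<close>

context compound_walk
begin

text \<open>As the paths are monotone, rational times decide whether the infimum is below \<open>a\<close>. A path that
  never reaches \<open>j\<close> yields the number \<open>Inf {}\<close>.\<close>

lemma arrival_time_measurable[measurable]: "(\<lambda>\<omega>. arrival_time N j \<omega>) \<in> borel_measurable M"
proof (rule borel_measurableI_less)
  fix a :: real
  let ?reach = "\<lambda>\<omega>. \<exists>n::nat. j \<le> N (real n) \<omega>"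
  have [measurable]: "N (real n) \<in> measurable M (count_space UNIV)" for n by (rule N_measurable) simp
  have reach: "{\<omega> \<in> space M. ?reach \<omega>} \<in> events" by measurable
  have early: "{\<omega> \<in> space M. \<exists>q\<in>\<rat> \<inter> {0..<a}. j \<le> N q \<omega>} \<in> events"
  proof (rule sets.sets_Collect_countable_Ex')
    show "{\<omega> \<in> space M. j \<le> N q \<omega>} \<in> events" if "q \<in> \<rat> \<inter> {0..<a}" for q
    proof -
      have [measurable]: "N q \<in> measurable M (count_space UNIV)" using that by (intro N_measurable) auto
      show ?thesis by measurable
    qed
  qed (simp add: countable_rat countable_Int1)
  have less: "arrival_time N j \<omega> < a \<longleftrightarrow> ?reach \<omega> \<and> (\<exists>q\<in>\<rat> \<inter> {0..<a}. j \<le> N q \<omega>) \<or> \<not> ?reach \<omega> \<and> Inf {} < a"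
    if \<omega>: "\<omega> \<in> space M" for \<omega>
  proof (cases "?reach \<omega>")
    case True
    then obtain n :: nat where n: "j \<le> N (real n) \<omega>" by blast
    have "Inf {t. 0 \<le> t \<and> j \<le> N t \<omega>} < a \<longleftrightarrow> (\<exists>t\<in>{t. 0 \<le> t \<and> j \<le> N t \<omega>}. t < a)"
      using n by (intro cInf_less_iff bdd_belowI[of _ 0]) (auto intro!: exI[of _ "real n"])
    also have "\<dots> \<longleftrightarrow> (\<exists>q\<in>\<rat> \<inter> {0..<a}. j \<le> N q \<omega>)"
    proof
      assume "\<exists>t\<in>{t. 0 \<le> t \<and> j \<le> N t \<omega>}. t < a"
      then obtain t where t: "0 \<le> t" "j \<le> N t \<omega>" "t < a" by blast
      obtain q where q: "q \<in> \<rat>" "t < q" "q < a" using Rats_dense_in_real[OF t(3)] by blast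
      have "j \<le> N q \<omega>" using N_mono[OF \<omega> t(1), of q] q t by linarith
      then show "\<exists>q\<in>\<rat> \<inter> {0..<a}. j \<le> N q \<omega>" using q t by (intro bexI[of _ q]) auto
    qed auto
    finally show ?thesis using True by (simp add: arrival_time_def)
  next
    case False
    have "{t. 0 \<le> t \<and> j \<le> N t \<omega>} = {}"
    proof (safe, simp)
      fix t :: real assume t: "0 \<le> t" "j \<le> N t \<omega>"
      obtain n :: nat where "t \<le> real n" using real_arch_simple by blast
      then have "j \<le> N (real n) \<omega>" using N_mono[OF \<omega> t(1)] t(2) by fastforce
      then show False using False by blast
    qed
    then show ?thesis unfolding arrival_time_def using False by (simp only: simp_thms)
  qed
  have split: "{\<omega> \<in> space M. P \<omega>} = ({\<omega> \<in> space M. A \<omega>} \<inter> {\<omega> \<in> space M. E \<omega>}) \<union> (if b then space M - {\<omega> \<in> space M. A \<omega>} else {})"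
    if "\<And>\<omega>. \<omega> \<in> space M \<Longrightarrow> P \<omega> \<longleftrightarrow> A \<omega> \<and> E \<omega> \<or> \<not> A \<omega> \<and> b" for P A E b
    using that by (cases b) auto
  have "{\<omega> \<in> space M. arrival_time N j \<omega> < a} = ({\<omega> \<in> space M. ?reach \<omega>} \<inter> {\<omega> \<in> space M. \<exists>q\<in>\<rat> \<inter> {0..<a}. j \<le> N q \<omega>})
      \<union> (if (Inf {} :: real) < a then space M - {\<omega> \<in> space M. ?reach \<omega>} else {})"
    by (rule split) (rule less)
  also have "\<dots> \<in> events" using reach early by auto
  finally show "{\<omega> \<in> space M. arrival_time N j \<omega> < a} \<in> events" .
qed

lemma walk_measurable:
  assumes "\<phi> \<in> borel_measurable borel" and "0 \<le> h"
  shows "(\<lambda>\<omega>. walk c \<omega> h) \<in> borel_measurable M"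
proof -
  have [measurable]: "N h \<in> measurable M (count_space UNIV)" using assms(2) by (rule N_measurable)
  have "(\<lambda>\<omega>. noise \<omega> n + (\<Sum>j=1..n. \<phi> (c * arrival_time N j \<omega>))) \<in> borel_measurable M" for n
    by (intro borel_measurable_add noise_measurable borel_measurable_sum measurable_compose[OF _ assms(1)]
      borel_measurable_times borel_measurable_const arrival_time_measurable)
  from measurable_compose_countable[OF this, of "N h"] show ?thesis
    unfolding walk_def drift_def by simp
qed

lemma walk_cong: "N h \<omega> = N k \<omega> \<Longrightarrow> walk c \<omega> h = walk c \<omega> k"
  by (simp add: walk_def drift_def)

lemma walk_0: "\<omega> \<in> space M \<Longrightarrow> walk c \<omega> 0 = 0"
  by (simp add: walk_def drift_def noise_def N_0)

lemma finite_walk_values: "\<omega> \<in> space M \<Longrightarrow> finite (walk c \<omega> ` {0..H})"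
proof (rule finite_subset)
  show "walk c \<omega> ` {0..H} \<subseteq> (\<lambda>n. noise \<omega> n + (\<Sum>j=1..n. \<phi> (c * arrival_time N j \<omega>))) ` {..N H \<omega>}"
    if "\<omega> \<in> space M"
    using N_mono[OF that] by (auto simp: walk_def drift_def)
qed simp

lemma AE_walk_eventually_positive:
  assumes c: "0 < c"
  shows "AE \<omega> in M. \<exists>H>0. \<forall>h\<ge>H. 0 < walk c \<omega> h"
proof -
  obtain C where C: "\<And>c h1. 0 < c \<Longrightarrow> 0 < h1 \<Longrightarrow> \<exists>B\<in>events. prob B \<le> C * (1 / (c\<^sup>2 * h1 ^ 3) + 1 / h1) \<and>
    (\<forall>\<omega>\<in>space M - B. \<forall>h\<ge>h1. 0 < walk c \<omega> h)" using walk_positive_tail by blast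
  have "\<forall>n. \<exists>B. B \<in> events \<and> prob B \<le> C * (1 / (c\<^sup>2 * real (Suc n) ^ 3) + 1 / real (Suc n)) \<and>
    (\<forall>\<omega>\<in>space M - B. \<forall>h\<ge>real (Suc n). 0 < walk c \<omega> h)"
  proof
    fix n
    have "0 < real (Suc n)" by simp
    from C[OF c this] show "\<exists>B. B \<in> events \<and> prob B \<le> C * (1 / (c\<^sup>2 * real (Suc n) ^ 3) + 1 / real (Suc n)) \<and>
      (\<forall>\<omega>\<in>space M - B. \<forall>h\<ge>real (Suc n). 0 < walk c \<omega> h)" by blast
  qed
  from choice[OF this] obtain B where B: "\<And>n. B n \<in> events" "\<And>n. prob (B n) \<le> C * (1 / (c\<^sup>2 * real (Suc n) ^ 3) + 1 / real (Suc n))"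
    "\<And>n \<omega> h. \<omega> \<in> space M - B n \<Longrightarrow> real (Suc n) \<le> h \<Longrightarrow> 0 < walk c \<omega> h" by blast
  have lim: "(\<lambda>n. C * (1 / (c\<^sup>2 * real (Suc n) ^ 3) + 1 / real (Suc n))) \<longlonglongrightarrow> 0"
    using c by real_asymp
  have "prob (\<Inter>n. B n) \<le> C * (1 / (c\<^sup>2 * real (Suc n) ^ 3) + 1 / real (Suc n))" for n
    using finite_measure_mono[of "\<Inter>n. B n" "B n"] B(1) B(2)[of n] by (auto intro: order_trans)
  then have "prob (\<Inter>n. B n) \<le> 0" by (intro LIMSEQ_le_const[OF lim]) auto
  then have "(\<Inter>n. B n) \<in> null_sets M"
    using B(1) by (intro null_setsI) (auto simp: emeasure_eq_measure measure_le_0_iff)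
  moreover have "{\<omega> \<in> space M. \<not> (\<exists>H>0. \<forall>h\<ge>H. 0 < walk c \<omega> h)} \<subseteq> (\<Inter>n. B n)"
  proof (intro subsetI INT_I, rule ccontr)
    fix \<omega> n assume "\<omega> \<in> {\<omega> \<in> space M. \<not> (\<exists>H>0. \<forall>h\<ge>H. 0 < walk c \<omega> h)}" and "\<omega> \<notin> B n"
    then show False using B(3)[of \<omega> n] by (auto dest: spec[of _ "real (Suc n)"])
  qed
  ultimately show ?thesis by (rule AE_I')
qed

end

text \<open>The left half, seen from \<open>0\<close>, runs backwards in time; its walk has the steps \<open>- em j\<close>.\<close>

locale two_sided_walk =
  right: compound_walk M r v D Np ep \<phi>p + left: compound_walk M r v D Nm "\<lambda>j \<omega>. - em j \<omega>" \<phi>m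
  for M :: "'m measure" and r v D :: real and Np Nm :: "real \<Rightarrow> 'm \<Rightarrow> nat"
    and ep em :: "nat \<Rightarrow> 'm \<Rightarrow> real" and \<phi>p \<phi>m :: "real \<Rightarrow> real" +
  fixes \<mu>p \<mu>m :: "real measure"
  assumes Np_path: "\<And>\<omega>. \<omega> \<in> space M \<Longrightarrow> right_cont_left_limits (\<lambda>t. Np t \<omega>)"
    and Nm_path: "\<And>\<omega>. \<omega> \<in> space M \<Longrightarrow> left_cont_right_limits (\<lambda>t. Nm t \<omega>)"
    and \<phi>p_measurable: "\<phi>p \<in> borel_measurable borel" and \<phi>m_measurable: "\<phi>m \<in> borel_measurable borel"
    and ep_distr: "\<And>j. 1 \<le> j \<Longrightarrow> distr M borel (ep j) = \<mu>p"
    and em_distr: "\<And>j. 1 \<le> j \<Longrightarrow> distr M borel (em j) = \<mu>m"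
    and ep_em: "right.indep_set (generated_events M borel {1..} ep) (generated_events M borel {1..} em)"
begin

definition Lam :: "real \<Rightarrow> 'm \<Rightarrow> real \<Rightarrow> real" where
  "Lam c \<omega> h = (if 0 \<le> h then right.walk c \<omega> h else left.walk c \<omega> (- h))"

lemma Lam_measurable[measurable]: "(\<lambda>\<omega>. Lam c \<omega> h) \<in> borel_measurable M"
  unfolding Lam_def using right.walk_measurable[OF \<phi>p_measurable, of h c] left.walk_measurable[OF \<phi>m_measurable, of "- h" c]
  by (cases "0 \<le> h") auto

lemma Lam_0: "\<omega> \<in> space M \<Longrightarrow> Lam c \<omega> 0 = 0"
  by (simp add: Lam_def right.walk_0)

lemma Lam_right_locally_constant:
  assumes \<omega>: "\<omega> \<in> space M"
  shows "right_locally_constant (Lam c \<omega>)"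
  unfolding right_locally_constant_def
proof
  fix h :: real
  show "\<exists>d>0. \<forall>k. h \<le> k \<longrightarrow> k < h + d \<longrightarrow> Lam c \<omega> k = Lam c \<omega> h"
  proof (cases "0 \<le> h")
    case True
    then have "((\<lambda>t. Np t \<omega>) \<longlongrightarrow> Np h \<omega>) (at_right h)"
      using Np_path[OF \<omega>] by (auto simp: right_cont_left_limits_def)
    then have "\<forall>\<^sub>F t in at_right h. Np t \<omega> = Np h \<omega>" by (simp add: tendsto_discrete)
    then obtain b where b: "h < b" "\<And>t. h < t \<Longrightarrow> t < b \<Longrightarrow> Np t \<omega> = Np h \<omega>"
      unfolding eventually_at_right_field by blast
    have eq: "Lam c \<omega> k = Lam c \<omega> h" if "h \<le> k" "k < h + (b - h)" for k
      using b(2)[of k] that True right.walk_cong[of k \<omega> h c] by (cases "k = h") (auto simp: Lam_def)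
    have "0 < b - h" using b(1) by simp
    then show ?thesis using eq by blast
  next
    case False
    then have "((\<lambda>t. Nm t \<omega>) \<longlongrightarrow> Nm (- h) \<omega>) (at_left (- h))"
      using Nm_path[OF \<omega>] by (auto simp: left_cont_right_limits_def)
    then have "\<forall>\<^sub>F t in at_left (- h). Nm t \<omega> = Nm (- h) \<omega>" by (simp add: tendsto_discrete)
    then obtain b where b: "b < - h" "\<And>t. b < t \<Longrightarrow> t < - h \<Longrightarrow> Nm t \<omega> = Nm (- h) \<omega>"
      unfolding eventually_at_left_field by blast
    let ?d = "min (- h - b) (- h)"
    have eq: "Lam c \<omega> k = Lam c \<omega> h" if "h \<le> k" "k < h + ?d" for k
      using b(2)[of "- k"] that False left.walk_cong[of "- k" \<omega> "- h" c] by (cases "k = h") (auto simp: Lam_def)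
    have "0 < ?d" using b(1) False by simp
    then show ?thesis using eq by blast
  qed
qed

lemma argmin_Lam_measurable[measurable]: "(\<lambda>\<omega>. argmin (Lam c \<omega>)) \<in> borel_measurable M"
  by (rule borel_measurable_argmin_right_locally_constant) (use Lam_right_locally_constant in auto)

text \<open>Far out \<open>Lam\<close> is above its value \<open>0\<close> at \<open>0\<close>, and in between it takes finitely many values.\<close>

lemma AE_ex_smallest_minimizer:
  assumes c: "0 < c"
  shows "AE \<omega> in M. \<exists>h. is_smallest_minimizer (Lam c \<omega>) h"
  using right.AE_walk_eventually_positive[OF c] left.AE_walk_eventually_positive[OF c] AE_space
proof eventually_elim
  case (elim \<omega>)
  obtain H1 where H1: "0 < H1" "\<And>h. H1 \<le> h \<Longrightarrow> 0 < right.walk c \<omega> h" using elim(1) by blast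
  obtain H2 where H2: "0 < H2" "\<And>h. H2 \<le> h \<Longrightarrow> 0 < left.walk c \<omega> h" using elim(2) by blast
  have pos: "0 < Lam c \<omega> h" if "h \<notin> {- H2..H1}" for h
    using that H1 H2 by (auto simp: Lam_def not_le)
  have fin: "finite (Lam c \<omega> ` {- H2..H1})"
  proof (rule finite_subset)
    have "Lam c \<omega> h \<in> right.walk c \<omega> ` {0..H1} \<union> left.walk c \<omega> ` {0..H2}" if "h \<in> {- H2..H1}" for h
    proof (cases "0 \<le> h")
      case True
      then show ?thesis using that by (intro UnI1) (auto simp: Lam_def)
    next
      case False
      then have "Lam c \<omega> h = left.walk c \<omega> (- h)" "- h \<in> {0..H2}" using that by (auto simp: Lam_def)
      then show ?thesis by (intro UnI2) (rule image_eqI)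
    qed
    then show "Lam c \<omega> ` {- H2..H1} \<subseteq> right.walk c \<omega> ` {0..H1} \<union> left.walk c \<omega> ` {0..H2}" by blast
    show "finite (right.walk c \<omega> ` {0..H1} \<union> left.walk c \<omega> ` {0..H2})"
      using right.finite_walk_values[OF elim(3)] left.finite_walk_values[OF elim(3)] by blast
  qed
  have ne: "0 \<in> {- H2..H1}" using H1 H2 by auto
  have "Min (Lam c \<omega> ` {- H2..H1}) \<in> Lam c \<omega> ` {- H2..H1}" using fin ne by (intro Min_in) auto
  then obtain h0 where h0: "h0 \<in> {- H2..H1}" "Lam c \<omega> h0 = Min (Lam c \<omega> ` {- H2..H1})" by auto
  have le: "Lam c \<omega> h0 \<le> Lam c \<omega> h" if "h \<in> {- H2..H1}" for h
    unfolding h0(2) using fin that by (intro Min_le) auto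
  have "Lam c \<omega> h0 \<le> 0" using le[OF ne] Lam_0[OF elim(3)] by simp
  then have "Lam c \<omega> h0 \<le> Lam c \<omega> h" for h
    using le[of h] pos[of h] by (cases "h \<in> {- H2..H1}") auto
  then have min: "is_minimizer (Lam c \<omega>) h0" by (simp add: is_minimizer_def)
  have bdd: "bdd_below {h. is_minimizer (Lam c \<omega>) h}"
  proof (rule bdd_belowI[of _ "- H2"], rule ccontr)
    fix h assume "h \<in> {h. is_minimizer (Lam c \<omega>) h}" "\<not> - H2 \<le> h"
    then have "Lam c \<omega> h \<le> Lam c \<omega> 0" "0 < Lam c \<omega> h" using pos[of h] by (auto simp: is_minimizer_def)
    then show False using Lam_0[OF elim(3)] by simp
  qed
  show ?case
    using is_smallest_minimizer_Inf[OF min bdd right_locally_constant_Inf_minimizer[OF Lam_right_locally_constant[OF elim(3)] min bdd]]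
    by blast
qed

end

section \<open>Reduction to independent increments\<close>

lemma generated_events_sigma_algebra: "sigma_algebra (space M) (generated_events M N I X)"
  unfolding generated_events_def by (rule sigma_algebra_sigma_sets) auto

lemma generated_events_sum_vimage:
  fixes X :: "'i \<Rightarrow> 'm \<Rightarrow> real"
  assumes J: "J \<subseteq> I" and A: "A \<in> sets borel"
  shows "(\<lambda>\<omega>. q * (\<Sum>j\<in>J. X j \<omega>)) -` A \<inter> space M \<in> generated_events M borel I X"
proof -
  let ?G = "\<Union>i\<in>I. {X i -` A \<inter> space M |A. A \<in> sets borel}"
  have sub: "?G \<subseteq> Pow (space M)" by auto
  let ?N = "sigma (space M) ?G"
  have Xm: "X j \<in> borel_measurable ?N" if "j \<in> J" for j
  proof (rule measurableI)
    fix B :: "real set" assume B: "B \<in> sets borel"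
    have "X j -` B \<inter> space M \<in> ?G" using B that J by blast
    then show "X j -` B \<inter> space ?N \<in> sets ?N" using sub by (auto simp: space_measure_of_conv)
  qed simp
  have "(\<lambda>\<omega>. q * (\<Sum>j\<in>J. X j \<omega>)) \<in> borel_measurable ?N"
    by (intro borel_measurable_times borel_measurable_const borel_measurable_sum Xm)
  from measurable_sets[OF this A] show ?thesis
    using sub by (simp add: generated_events_def space_measure_of_conv sets_measure_of)
qed

lemma disjoint_blocks:
  assumes "inj_on f L"
  shows "disjoint_family_on (\<lambda>l. {f l * k + 1..f l * k + k :: nat}) L"
  unfolding disjoint_family_on_def
proof (intro ballI impI)
  have less: "{i * k + 1..i * k + k} \<inter> {j * k + 1..j * k + k} = {}" if "i < j" for i j :: nat
  proof -
    have "Suc i * k \<le> j * k" using that by (intro mult_right_mono) auto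
    then show ?thesis by auto
  qed
  fix l l' assume "l \<in> L" "l' \<in> L" "l \<noteq> l'"
  then have "f l \<noteq> f l'" using assms by (auto simp: inj_on_def)
  then show "{f l * k + 1..f l * k + k} \<inter> {f l' * k + 1..f l' * k + k} = {}"
    using less[of "f l" "f l'"] less[of "f l'" "f l"] by (cases rule: linorder_cases[of "f l" "f l'"]) auto
qed

lemma (in compound_walk) noise_blocks: "noise \<omega> (i * k) = (\<Sum>j<i. \<Sum>t=j*k+1..j*k+k. e t \<omega>)"
proof (induction i)
  case (Suc i)
  have "noise \<omega> (Suc i * k) = noise \<omega> (i * k + k)" by (simp add: add.commute)
  then show ?case using Suc noise_add[of \<omega> "i * k" k] by simp
qed (simp add: noise_def)

text \<open>A vector \<open>x\<close> of \<open>2 d\<close> forward increments is summed up to a path on the grid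
  \<open>- d, \<dots>, d\<close> that vanishes at \<open>0\<close>.\<close>

definition grid_path :: "nat \<Rightarrow> (nat \<Rightarrow> real) \<Rightarrow> int \<Rightarrow> real" where
  "grid_path d x z = (if 0 \<le> z then \<Sum>l=d..<d + nat z. x l else - (\<Sum>l=d - nat (- z)..<d. x l))"

lemma grid_path_restrict:
  assumes "\<bar>z\<bar> < int d"
  shows "grid_path d (restrict x {..<2 * d}) z = grid_path d x z"
  using assms unfolding grid_path_def by (auto intro!: sum.cong)

lemma grid_path_tendsto:
  assumes "\<bar>z\<bar> < int d" "\<And>l. l \<in> {..<2 * d} \<Longrightarrow> (\<lambda>n. xs n l) \<longlonglongrightarrow> x l"
  shows "(\<lambda>n. grid_path d (xs n) z) \<longlonglongrightarrow> grid_path d x z"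
  using assms unfolding grid_path_def by (auto intro!: tendsto_sum tendsto_minus)

lemma grid_path_measurable:
  assumes "\<bar>z\<bar> < int d"
  shows "(\<lambda>x. grid_path d x z) \<in> borel_measurable (PiM {..<2 * d} (\<lambda>_. borel))"
  using assms unfolding grid_path_def
  by (cases "0 \<le> z") (auto intro!: borel_measurable_sum borel_measurable_uminus measurable_component_singleton)

text \<open>Up to the tolerance \<open>\<eta>\<close>, some grid point in \<open>C\<close> minimizes the path plus parabola over the
  grid. For fixed \<open>C\<close> this is a closed condition on finitely many increments.\<close>

definition near_min_in :: "real \<Rightarrow> nat \<Rightarrow> real \<Rightarrow> real \<Rightarrow> real set \<Rightarrow> (nat \<Rightarrow> real) \<Rightarrow> bool" where
  "near_min_in b d \<delta> \<eta> C x \<longleftrightarrow> (\<exists>z\<in>{z. \<bar>z\<bar> < int d \<and> of_int z * \<delta> \<in> C}. \<forall>z'\<in>{z. \<bar>z\<bar> < int d}.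
    grid_path d x z + b * (of_int z * \<delta>)\<^sup>2 \<le> grid_path d x z' + b * (of_int z' * \<delta>)\<^sup>2 + \<eta>)"

lemma finite_grid: "finite {z :: int. \<bar>z\<bar> < int d}"
  by (rule finite_subset[of _ "{- int d..int d}"]) auto

lemma finite_grid': "finite {z :: int. \<bar>z\<bar> < int d \<and> P z}"
  by (rule finite_subset[OF _ finite_grid[of d]]) auto

lemma near_min_in_restrict: "near_min_in b d \<delta> \<eta> C (restrict x {..<2 * d}) \<longleftrightarrow> near_min_in b d \<delta> \<eta> C x"
  unfolding near_min_in_def using grid_path_restrict[of _ d x] by simp

lemma near_min_in_measurable:
  "{x \<in> space (PiM {..<2 * d} (\<lambda>_. borel)). near_min_in b d \<delta> \<eta> C x} \<in> sets (PiM {..<2 * d} (\<lambda>_. borel))"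
  unfolding near_min_in_def
  by (intro sets.sets_Collect_finite_Ex sets.sets_Collect_finite_All' finite_grid finite_grid' borel_measurable_le
    borel_measurable_add borel_measurable_const grid_path_measurable) auto

lemma near_min_in_closed:
  assumes "\<And>l. l \<in> {..<2 * d} \<Longrightarrow> (\<lambda>n. xs n l) \<longlonglongrightarrow> x l" "\<not> near_min_in b d \<delta> \<eta> C x"
  shows "\<forall>\<^sub>F n in sequentially. \<not> near_min_in b d \<delta> \<eta> C (xs n)"
proof -
  have "\<forall>\<^sub>F n in sequentially. \<forall>z\<in>{z. \<bar>z\<bar> < int d \<and> of_int z * \<delta> \<in> C}. \<exists>z'\<in>{z. \<bar>z\<bar> < int d}.
    grid_path d (xs n) z' + b * (of_int z' * \<delta>)\<^sup>2 + \<eta> < grid_path d (xs n) z + b * (of_int z * \<delta>)\<^sup>2"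
  proof (rule eventually_ball_finite[OF finite_grid'], rule ballI)
    fix z assume z: "z \<in> {z. \<bar>z\<bar> < int d \<and> of_int z * \<delta> \<in> C}"
    then obtain z' where z': "\<bar>z'\<bar> < int d"
      "grid_path d x z' + b * (of_int z' * \<delta>)\<^sup>2 + \<eta> < grid_path d x z + b * (of_int z * \<delta>)\<^sup>2"
      using assms(2) unfolding near_min_in_def by (force simp: not_le)
    have "(\<lambda>n. (grid_path d (xs n) z + b * (of_int z * \<delta>)\<^sup>2) - (grid_path d (xs n) z' + b * (of_int z' * \<delta>)\<^sup>2 + \<eta>))
        \<longlonglongrightarrow> (grid_path d x z + b * (of_int z * \<delta>)\<^sup>2) - (grid_path d x z' + b * (of_int z' * \<delta>)\<^sup>2 + \<eta>)"
      using z z' assms(1) by (intro tendsto_intros grid_path_tendsto) auto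
    then have "\<forall>\<^sub>F n in sequentially. 0 < (grid_path d (xs n) z + b * (of_int z * \<delta>)\<^sup>2) - (grid_path d (xs n) z' + b * (of_int z' * \<delta>)\<^sup>2 + \<eta>)"
      by (rule order_tendstoD) (use z' in simp)
    then show "\<forall>\<^sub>F n in sequentially. \<exists>z'\<in>{z. \<bar>z\<bar> < int d}.
      grid_path d (xs n) z' + b * (of_int z' * \<delta>)\<^sup>2 + \<eta> < grid_path d (xs n) z + b * (of_int z * \<delta>)\<^sup>2"
    proof eventually_elim
      case (elim n)
      then show ?case using z'(1) by (intro bexI[of _ z']) auto
    qed
  qed
  then show ?thesis
  proof eventually_elim
    case (elim n)
    show ?case
    proof
      assume "near_min_in b d \<delta> \<eta> C (xs n)"
      then obtain z where z: "z \<in> {z. \<bar>z\<bar> < int d \<and> of_int z * \<delta> \<in> C}"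
        "\<And>z'. z' \<in> {z. \<bar>z\<bar> < int d} \<Longrightarrow>
          grid_path d (xs n) z + b * (of_int z * \<delta>)\<^sup>2 \<le> grid_path d (xs n) z' + b * (of_int z' * \<delta>)\<^sup>2 + \<eta>"
        unfolding near_min_in_def by blast
      from elim z(1) obtain z' where "z' \<in> {z. \<bar>z\<bar> < int d}"
        "grid_path d (xs n) z' + b * (of_int z' * \<delta>)\<^sup>2 + \<eta> < grid_path d (xs n) z + b * (of_int z * \<delta>)\<^sup>2" by blast
      then show False using z(2)[of z'] by simp
    qed
  qed
qed

text \<open>The index of the grid point next to \<open>u\<close> on the side of \<open>0\<close>; rounding towards \<open>0\<close> matches
  the one-sided block estimates on both half lines.\<close>

definition trunc_grid :: "real \<Rightarrow> real \<Rightarrow> int" where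
  "trunc_grid \<delta> u = (if 0 \<le> u then \<lfloor>u / \<delta>\<rfloor> else \<lceil>u / \<delta>\<rceil>)"

lemma trunc_grid_of_int: "0 < \<delta> \<Longrightarrow> trunc_grid \<delta> (of_int z * \<delta>) = z"
  by (simp add: trunc_grid_def)

lemma trunc_grid_le: "0 < \<delta> \<Longrightarrow> u \<le> of_int k * \<delta> \<Longrightarrow> of_int (trunc_grid \<delta> u) * \<delta> \<le> of_int k * \<delta>"
  by (simp add: trunc_grid_def ceiling_le_iff pos_divide_le_eq) 
    (meson floor_mono of_int_floor_le order_trans pos_divide_le_eq floor_le_iff le_floor_iff of_int_le_iff)

lemma trunc_grid_ge: "0 < \<delta> \<Longrightarrow> of_int k * \<delta> \<le> u \<Longrightarrow> of_int k * \<delta> \<le> of_int (trunc_grid \<delta> u) * \<delta>"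
  by (simp add: trunc_grid_def le_floor_iff pos_le_divide_eq)
    (meson le_of_int_ceiling order_trans pos_le_divide_eq of_int_le_iff)

locale two_sided_limit = two_sided_walk M r v D Np Nm ep em \<phi>p \<phi>m \<mu>p \<mu>m + lim: brownian_parabola Q W "sqrt (v * r)" "r * D / 2"
  for M :: "'m measure" and r v D Np Nm ep em \<phi>p \<phi>m \<mu>p \<mu>m and Q :: "'b measure" and W
begin

text \<open>The forward increment of the noise from grid point \<open>l - d\<close> to \<open>l - d + 1\<close>. To the left of \<open>0\<close> the
  walk with steps \<open>- em j\<close> is run backwards, so the forward increment is a sum of \<open>em j\<close>.\<close>

definition block :: "nat \<Rightarrow> nat \<Rightarrow> real \<Rightarrow> nat \<Rightarrow> 'm \<Rightarrow> real" where
  "block k d q l \<omega> = (if d \<le> l then q * (\<Sum>t=(l-d)*k+1..(l-d)*k+k. ep t \<omega>)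
    else q * (\<Sum>t=(d-Suc l)*k+1..(d-Suc l)*k+k. em t \<omega>))"

definition increment :: "real \<Rightarrow> nat \<Rightarrow> nat \<Rightarrow> 'b \<Rightarrow> real" where
  "increment \<delta> d l \<omega> = sqrt (v * r) * (W ((real (Suc l) - real d) * \<delta>) \<omega> - W ((real l - real d) * \<delta>) \<omega>)"

lemma em_indep: "right.indep_vars (\<lambda>_. borel) em {1..}"
  using right.indep_vars_compose2[OF left.e_indep, of "\<lambda>_ x. - x" "\<lambda>_. borel"] by simp

lemma block_indep: "right.indep_vars (\<lambda>_. borel) (block k d q) {..<2 * d}"
proof -
  have R: "right.indep_vars (\<lambda>_. borel) (block k d q) {d..<2 * d}"
  proof -
    have "right.indep_vars (\<lambda>_. borel) (\<lambda>l \<omega>. \<Sum>t=(l-d)*k+1..(l-d)*k+k. ep t \<omega>) {d..<2 * d}"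
      by (rule right.indep_vars_sum_disjoint[OF right.e_indep _ disjoint_blocks]) (auto intro!: inj_onI)
    then have "right.indep_vars (\<lambda>_. borel) (\<lambda>l \<omega>. q * (\<Sum>t=(l-d)*k+1..(l-d)*k+k. ep t \<omega>)) {d..<2 * d}"
      by (rule right.indep_vars_compose2) auto
    moreover have "block k d q l = (\<lambda>\<omega>. q * (\<Sum>t=(l-d)*k+1..(l-d)*k+k. ep t \<omega>))" if "l \<in> {d..<2 * d}" for l
      using that by (auto simp: block_def)
    ultimately show ?thesis by (subst right.indep_vars_cong) auto
  qed
  have L: "right.indep_vars (\<lambda>_. borel) (block k d q) {..<d}"
  proof -
    have "right.indep_vars (\<lambda>_. borel) (\<lambda>l \<omega>. \<Sum>t=(d-Suc l)*k+1..(d-Suc l)*k+k. em t \<omega>) {..<d}"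
      by (rule right.indep_vars_sum_disjoint[OF em_indep _ disjoint_blocks]) (auto intro!: inj_onI)
    then have "right.indep_vars (\<lambda>_. borel) (\<lambda>l \<omega>. q * (\<Sum>t=(d-Suc l)*k+1..(d-Suc l)*k+k. em t \<omega>)) {..<d}"
      by (rule right.indep_vars_compose2) auto
    moreover have "block k d q l = (\<lambda>\<omega>. q * (\<Sum>t=(d-Suc l)*k+1..(d-Suc l)*k+k. em t \<omega>))" if "l \<in> {..<d}" for l
      using that by (auto simp: block_def)
    ultimately show ?thesis by (subst right.indep_vars_cong) auto
  qed
  have "right.indep_vars (\<lambda>_. borel) (block k d q) ({d..<2 * d} \<union> {..<d})"
  proof (rule right.indep_vars_Un[OF R L _ ep_em generated_events_sigma_algebra generated_events_sigma_algebra])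
    show "block k d q l -` A \<inter> space M \<in> generated_events M borel {1..} ep" if "l \<in> {d..<2 * d}" "A \<in> sets borel" for l A
    proof -
      have "block k d q l = (\<lambda>\<omega>. q * (\<Sum>t=(l-d)*k+1..(l-d)*k+k. ep t \<omega>))" using that by (auto simp: block_def)
      then show ?thesis using that by (simp only:) (rule generated_events_sum_vimage, auto)
    qed
    show "block k d q l -` A \<inter> space M \<in> generated_events M borel {1..} em" if "l \<in> {..<d}" "A \<in> sets borel" for l A
    proof -
      have "block k d q l = (\<lambda>\<omega>. q * (\<Sum>t=(d-Suc l)*k+1..(d-Suc l)*k+k. em t \<omega>))" using that by (auto simp: block_def)
      then show ?thesis using that by (simp only:) (rule generated_events_sum_vimage, auto)
    qed
  qed auto
  also have "{d..<2 * d} \<union> {..<d} = {..<2 * d}" by auto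
  finally show ?thesis .
qed

lemma increment_indep:
  assumes "0 < \<delta>"
  shows "lim.indep_vars (\<lambda>_. borel) (increment \<delta> d) {..<2 * d}"
proof -
  have "strict_mono (\<lambda>l. (real l - real d) * \<delta>)"
    using assms by (auto simp: strict_mono_def)
  from lim.indep_vars_compose2[OF lim.W_indep[OF this], where Y="\<lambda>_ x. sqrt (v * r) * x" and N="\<lambda>_. borel"]
  show ?thesis unfolding increment_def[abs_def] by simp
qed

lemma block_weak_conv:
  assumes "0 < \<delta>" and k: "filterlim k at_top sequentially"
  shows "weak_conv_m (\<lambda>n. distr M borel (block (k n) d (sqrt (\<delta> * r) / sqrt (k n)) l)) (distr Q borel (increment \<delta> d l))"
proof -
  let ?s = "(real l - real d) * \<delta>" and ?t = "(real (Suc l) - real d) * \<delta>"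
  have st: "?s < ?t" using assms by simp
  have ts: "?t - ?s = \<delta>" by (simp add: algebra_simps)
  have Y: "distributed Q lborel (\<lambda>\<omega>. W ?t \<omega> - W ?s \<omega>) (normal_density 0 (sqrt \<delta>))"
    using lim.W_distributed[OF st] unfolding ts .
  have pos: "0 < sqrt \<delta>" "0 < sqrt (\<delta> * r)" using assms right.r_pos by auto
  have eq: "sqrt (v * r) * sqrt \<delta> = sqrt (\<delta> * r) * sqrt v" by (simp add: real_sqrt_mult)
  show ?thesis
  proof (cases "d \<le> l")
    case True
    then have b: "block (k n) d q l = (\<lambda>\<omega>. q * (\<Sum>t=(l-d)*k n+1..(l-d)*k n+k n. ep t \<omega>))" for n q
      by (auto simp: block_def)
    show ?thesis unfolding b increment_def[abs_def]
      by (rule right.weak_conv_block_sum[OF right.e_indep ep_distr right.e_square right.e_mean right.e_variance k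
        lim.prob_space_axioms Y pos eq])
  next
    case False
    then have b: "block (k n) d q l = (\<lambda>\<omega>. q * (\<Sum>t=(d-Suc l)*k n+1..(d-Suc l)*k n+k n. em t \<omega>))" for n q
      by (auto simp: block_def)
    show ?thesis unfolding b increment_def[abs_def]
      by (rule right.weak_conv_block_sum[OF em_indep em_distr _ _ _ k lim.prob_space_axioms Y pos eq])
        (use left.e_square left.e_mean left.e_variance in auto)
  qed
qed

lemma eventually_prob_block:
  assumes "0 < \<delta>" "filterlim k at_top sequentially" "0 < d" "0 < e"
    and R: "{x \<in> space (PiM {..<2 * d} (\<lambda>_. borel)). R x} \<in> sets (PiM {..<2 * d} (\<lambda>_. borel))"
    and closed: "\<And>x xs. (\<And>l. l \<in> {..<2 * d} \<Longrightarrow> (\<lambda>n. xs n l) \<longlonglongrightarrow> x l) \<Longrightarrow> \<not> R x \<Longrightarrow> \<forall>\<^sub>F n in sequentially. \<not> R (xs n)"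
  shows "\<forall>\<^sub>F n in sequentially. right.prob {\<omega> \<in> space M. R (\<lambda>l\<in>{..<2 * d}. block (k n) d (sqrt (\<delta> * r) / sqrt (k n)) l \<omega>)}
    < lim.prob {\<omega> \<in> space Q. R (\<lambda>l\<in>{..<2 * d}. increment \<delta> d l \<omega>)} + e"
  by (rule eventually_prob_less_indep_weak_conv[OF right.prob_space_axioms lim.prob_space_axioms _ _ block_indep
      increment_indep block_weak_conv R closed])
    (use assms in \<open>auto simp: lessThan_empty_iff\<close>)

lemma grid_path_block:
  assumes z: "\<bar>z\<bar> < int d"
  shows "grid_path d (\<lambda>l. block k d q l \<omega>) z = q * (if 0 \<le> z then right.noise \<omega> (nat z * k) else left.noise \<omega> (nat (- z) * k))"
proof (cases "0 \<le> z")
  case True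
  have "(\<Sum>l=d..<d + nat z. block k d q l \<omega>) = (\<Sum>j<nat z. q * (\<Sum>t=j*k+1..j*k+k. ep t \<omega>))"
    by (rule sum.reindex_bij_witness[of _ "\<lambda>j. j + d" "\<lambda>l. l - d"]) (auto simp: block_def)
  then show ?thesis using True by (simp add: grid_path_def right.noise_blocks sum_distrib_left)
next
  case False
  have "(\<Sum>l=d - nat (- z)..<d. block k d q l \<omega>) = (\<Sum>j<nat (- z). q * (\<Sum>t=j*k+1..j*k+k. em t \<omega>))"
    by (rule sum.reindex_bij_witness[of _ "\<lambda>j. d - Suc j" "\<lambda>l. d - Suc l"]) (use z False in \<open>auto simp: block_def\<close>)
  then show ?thesis using False by (simp add: grid_path_def left.noise_blocks sum_distrib_left sum_negf)
qed

lemma grid_path_increment: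
  assumes z: "\<bar>z\<bar> < int d" and \<omega>: "\<omega> \<in> space Q"
  shows "grid_path d (\<lambda>l. increment \<delta> d l \<omega>) z = sqrt (v * r) * W (of_int z * \<delta>) \<omega>"
proof -
  let ?w = "\<lambda>l. sqrt (v * r) * W ((real l - real d) * \<delta>) \<omega>"
  have tel: "(\<Sum>l=i..<j. increment \<delta> d l \<omega>) = ?w j - ?w i" if "i \<le> j" for i j
    using sum_Suc_diff'[OF that, of ?w] by (simp add: increment_def right_diff_distrib)
  have w0: "?w d = 0" using lim.W_0[OF \<omega>] by simp
  show ?thesis
  proof (cases "0 \<le> z")
    case True
    then show ?thesis using tel[of d "d + nat z"] w0 by (simp add: grid_path_def)
  next
    case False
    then show ?thesis using tel[of "d - nat (- z)" d] w0 z by (simp add: grid_path_def of_nat_diff)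
  qed
qed

end

section \<open>Convergence of the minimizer\<close>

context two_sided_limit
begin

lemma Lam_near_grid_path:
  fixes T q \<delta> \<eta> :: real and k d :: nat
  defines "b \<equiv> r * D / 2"
  assumes pos: "0 < T" "0 < \<delta>"
    and R: "\<forall>i<d. \<forall>u. real i * \<delta> \<le> u \<longrightarrow> u \<le> (real i + 1) * \<delta> \<longrightarrow>
      \<bar>q * right.walk c \<omega> (u * T) - (q * right.noise \<omega> (i * k) + b * (real i * \<delta>)\<^sup>2)\<bar> \<le> \<eta>"
    and L: "\<forall>i<d. \<forall>u. real i * \<delta> \<le> u \<longrightarrow> u \<le> (real i + 1) * \<delta> \<longrightarrow>
      \<bar>q * left.walk c \<omega> (u * T) - (q * left.noise \<omega> (i * k) + b * (real i * \<delta>)\<^sup>2)\<bar> \<le> \<eta>"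
    and u: "\<bar>u\<bar> < real d * \<delta>"
  shows "\<bar>trunc_grid \<delta> u\<bar> < int d"
    and "\<bar>q * Lam c \<omega> (u * T) - (grid_path d (\<lambda>l. block k d q l \<omega>) (trunc_grid \<delta> u) + b * (of_int (trunc_grid \<delta> u) * \<delta>)\<^sup>2)\<bar> \<le> \<eta>"
proof -
  define i where "i = nat \<lfloor>\<bar>u\<bar> / \<delta>\<rfloor>"
  have i0: "0 \<le> \<bar>u\<bar> / \<delta>" using pos by simp
  then have i: "real i \<le> \<bar>u\<bar> / \<delta>" "\<bar>u\<bar> / \<delta> < real i + 1" unfolding i_def by linarith+
  have iu: "real i * \<delta> \<le> \<bar>u\<bar>" "\<bar>u\<bar> \<le> (real i + 1) * \<delta>" using i pos by (simp_all add: field_simps)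
  have "\<bar>u\<bar> / \<delta> < real d" using u pos by (simp add: field_simps)
  then have id: "i < d" using i by linarith
  have tr: "trunc_grid \<delta> u = (if 0 \<le> u then int i else - int i)"
    using i0 unfolding trunc_grid_def i_def by (auto simp: ceiling_def abs_if)
  show tr': "\<bar>trunc_grid \<delta> u\<bar> < int d" using tr id by simp
  note g = grid_path_block[OF tr', of k q \<omega>]
  show "\<bar>q * Lam c \<omega> (u * T) - (grid_path d (\<lambda>l. block k d q l \<omega>) (trunc_grid \<delta> u) + b * (of_int (trunc_grid \<delta> u) * \<delta>)\<^sup>2)\<bar> \<le> \<eta>"
  proof (cases "0 \<le> u")
    case True
    then have "\<bar>u\<bar> = u" by simp
    then show ?thesis using True R id iu pos unfolding g unfolding tr by (auto simp: Lam_def)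
  next
    case False
    then have "\<not> 0 \<le> u * T" using pos by (simp add: zero_le_mult_iff)
    moreover have "left.noise \<omega> 0 = 0" "right.noise \<omega> 0 = 0" by (simp_all add: left.noise_def right.noise_def)
    moreover have "\<bar>q * left.walk c \<omega> (\<bar>u\<bar> * T) - (q * left.noise \<omega> (i * k) + b * (real i * \<delta>)\<^sup>2)\<bar> \<le> \<eta>"
      using L id iu by blast
    ultimately show ?thesis using False unfolding g unfolding tr by (cases "i = 0") (simp_all add: Lam_def)
  qed
qed

lemma minimizer_near_min_in:
  fixes T q \<delta> \<eta> :: real and k d :: nat
  defines "b \<equiv> r * D / 2"
  assumes pos: "0 < T" "0 < \<delta>" "0 < q"
    and R: "\<forall>i<d. \<forall>u. real i * \<delta> \<le> u \<longrightarrow> u \<le> (real i + 1) * \<delta> \<longrightarrow>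
      \<bar>q * right.walk c \<omega> (u * T) - (q * right.noise \<omega> (i * k) + b * (real i * \<delta>)\<^sup>2)\<bar> \<le> \<eta>"
    and L: "\<forall>i<d. \<forall>u. real i * \<delta> \<le> u \<longrightarrow> u \<le> (real i + 1) * \<delta> \<longrightarrow>
      \<bar>q * left.walk c \<omega> (u * T) - (q * left.noise \<omega> (i * k) + b * (real i * \<delta>)\<^sup>2)\<bar> \<le> \<eta>"
    and C: "\<And>u. u \<in> C \<Longrightarrow> of_int (trunc_grid \<delta> u) * \<delta> \<in> C"
    and h: "is_minimizer (Lam c \<omega>) h" "\<bar>h\<bar> < real d * \<delta> * T" "h / T \<in> C"
  shows "near_min_in b d \<delta> (2 * \<eta>) C (\<lambda>l. block k d q l \<omega>)"
proof -
  let ?V = "\<lambda>z. grid_path d (\<lambda>l. block k d q l \<omega>) z + b * (of_int z * \<delta>)\<^sup>2"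
  note near = Lam_near_grid_path[OF pos(1,2) R[unfolded b_def] L[unfolded b_def], folded b_def]
  have u: "\<bar>h / T\<bar> < real d * \<delta>" using h(2) pos by (simp add: field_simps)
  let ?z = "trunc_grid \<delta> (h / T)"
  have z: "\<bar>?z\<bar> < int d" "\<bar>q * Lam c \<omega> h - ?V ?z\<bar> \<le> \<eta>" using near[OF u] pos by simp_all
  have "?V ?z \<le> ?V z' + 2 * \<eta>" if z': "\<bar>z'\<bar> < int d" for z'
  proof -
    have "\<bar>of_int z' * \<delta>\<bar> < real d * \<delta>"
    proof -
      have "\<bar>of_int z' * \<delta>\<bar> = of_int \<bar>z'\<bar> * \<delta>" using pos by (simp add: abs_mult)
      also have "\<dots> < of_int (int d) * \<delta>" using z' pos by (intro mult_strict_right_mono) (simp_all only: of_int_less_iff)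
      finally show ?thesis by simp
    qed
    from near(2)[OF this] have "\<bar>q * Lam c \<omega> (of_int z' * \<delta> * T) - ?V z'\<bar> \<le> \<eta>"
      using pos by (simp add: trunc_grid_of_int)
    moreover have "q * Lam c \<omega> h \<le> q * Lam c \<omega> (of_int z' * \<delta> * T)"
      using h(1) pos by (intro mult_left_mono) (auto simp: is_minimizer_def)
    ultimately show ?thesis using z(2) by (simp add: abs_le_iff)
  qed
  then show ?thesis unfolding near_min_in_def using z(1) C[OF h(3)] by (intro bexI[of _ ?z]) auto
qed

text \<open>At the minimizer \<open>Lam\<close> is at most \<open>Lam c \<omega> 0 = 0\<close>, so both halves being positive beyond \<open>h1\<close>
  confines it.\<close>

lemma prob_argmin_Lam_tail:
  "\<exists>A. \<forall>c>0. \<forall>h1>0. right.prob {\<omega> \<in> space M. h1 \<le> \<bar>argmin (Lam c \<omega>)\<bar>} \<le> A * (1 / (c\<^sup>2 * h1 ^ 3) + 1 / h1)"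
proof -
  obtain C1 where C1: "\<And>c h1. 0 < c \<Longrightarrow> 0 < h1 \<Longrightarrow> \<exists>B\<in>right.events. right.prob B \<le> C1 * (1 / (c\<^sup>2 * h1 ^ 3) + 1 / h1) \<and>
    (\<forall>\<omega>\<in>space M - B. \<forall>h\<ge>h1. 0 < right.walk c \<omega> h)" using right.walk_positive_tail by blast
  obtain C2 where C2: "\<And>c h1. 0 < c \<Longrightarrow> 0 < h1 \<Longrightarrow> \<exists>B\<in>right.events. right.prob B \<le> C2 * (1 / (c\<^sup>2 * h1 ^ 3) + 1 / h1) \<and>
    (\<forall>\<omega>\<in>space M - B. \<forall>h\<ge>h1. 0 < left.walk c \<omega> h)" using left.walk_positive_tail by blast
  have "right.prob {\<omega> \<in> space M. h1 \<le> \<bar>argmin (Lam c \<omega>)\<bar>} \<le> (C1 + C2) * (1 / (c\<^sup>2 * h1 ^ 3) + 1 / h1)"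
    if c: "0 < c" and h1: "0 < h1" for c h1
  proof -
    obtain B1 where B1: "B1 \<in> right.events" "right.prob B1 \<le> C1 * (1 / (c\<^sup>2 * h1 ^ 3) + 1 / h1)"
      "\<And>\<omega> h. \<omega> \<in> space M \<Longrightarrow> \<omega> \<notin> B1 \<Longrightarrow> h1 \<le> h \<Longrightarrow> 0 < right.walk c \<omega> h" using C1[OF c h1] by blast
    obtain B2 where B2: "B2 \<in> right.events" "right.prob B2 \<le> C2 * (1 / (c\<^sup>2 * h1 ^ 3) + 1 / h1)"
      "\<And>\<omega> h. \<omega> \<in> space M \<Longrightarrow> \<omega> \<notin> B2 \<Longrightarrow> h1 \<le> h \<Longrightarrow> 0 < left.walk c \<omega> h" using C2[OF c h1] by blast
    have "right.prob {\<omega> \<in> space M. h1 \<le> \<bar>argmin (Lam c \<omega>)\<bar>} \<le> right.prob (B1 \<union> B2)"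
    proof (rule right.finite_measure_mono_AE)
      show "AE \<omega> in M. \<omega> \<in> {\<omega> \<in> space M. h1 \<le> \<bar>argmin (Lam c \<omega>)\<bar>} \<longrightarrow> \<omega> \<in> B1 \<union> B2"
        using AE_ex_smallest_minimizer[OF c]
      proof eventually_elim
        case (elim \<omega>)
        then obtain h where h: "is_smallest_minimizer (Lam c \<omega>) h" by blast
        have le: "Lam c \<omega> h \<le> Lam c \<omega> 0" using h by (auto simp: is_smallest_minimizer_def is_minimizer_def)
        have "\<omega> \<in> B1 \<union> B2" if \<omega>: "\<omega> \<in> space M" and "h1 \<le> \<bar>h\<bar>"
        proof (rule ccontr)
          assume "\<omega> \<notin> B1 \<union> B2"
          then have "0 < Lam c \<omega> h"
            using B1(3)[OF \<omega>, of h] B2(3)[OF \<omega>, of "- h"] \<open>h1 \<le> \<bar>h\<bar>\<close> h1 by (cases "0 \<le> h") (auto simp: Lam_def)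
          then show False using le Lam_0[OF \<omega>] by simp
        qed
        then show ?case using argmin_eqI[OF h] by blast
      qed
    qed (use B1 B2 in auto)
    also have "\<dots> \<le> right.prob B1 + right.prob B2" using B1 B2 by (intro measure_Un_le) auto
    also have "\<dots> \<le> (C1 + C2) * (1 / (c\<^sup>2 * h1 ^ 3) + 1 / h1)" using B1(2) B2(2) by (simp only: distrib_right)
    finally show ?thesis .
  qed
  then show ?thesis by blast
qed

lemma eventually_prob_block_ge:
  assumes "0 < \<delta>" "filterlim k at_top sequentially" "0 < x" "0 < e" and l: "l < 2 * d"
  shows "\<forall>\<^sub>F n in sequentially. right.prob {\<omega> \<in> space M. x \<le> \<bar>block (k n) d (sqrt (\<delta> * r) / sqrt (k n)) l \<omega>\<bar>}
    \<le> 3 * sqrt (v * r) ^ 4 * \<delta>\<^sup>2 / x ^ 4 + e"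
proof -
  have d: "0 < d" using l by simp
  have "\<forall>\<^sub>F n in sequentially. right.prob {\<omega> \<in> space M. x \<le> \<bar>(\<lambda>l\<in>{..<2 * d}. block (k n) d (sqrt (\<delta> * r) / sqrt (k n)) l \<omega>) l\<bar>}
    < lim.prob {\<omega> \<in> space Q. x \<le> \<bar>(\<lambda>l\<in>{..<2 * d}. increment \<delta> d l \<omega>) l\<bar>} + e"
  proof (rule eventually_prob_block[OF assms(1,2) d assms(4), where R="\<lambda>y. x \<le> \<bar>y l\<bar>"])
    have [measurable]: "(\<lambda>y. y l) \<in> borel_measurable (PiM {..<2 * d} (\<lambda>_. borel :: real measure))"
      using l by (intro measurable_component_singleton) auto
    show "{y \<in> space (PiM {..<2 * d} (\<lambda>_. borel)). x \<le> \<bar>y l\<bar>} \<in> sets (PiM {..<2 * d} (\<lambda>_. borel))" by measurable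
  next
    fix y :: "nat \<Rightarrow> real" and ys assume y: "\<And>l. l \<in> {..<2 * d} \<Longrightarrow> (\<lambda>n. ys n l) \<longlonglongrightarrow> y l" "\<not> x \<le> \<bar>y l\<bar>"
    have "(\<lambda>n. \<bar>ys n l\<bar>) \<longlonglongrightarrow> \<bar>y l\<bar>" using y(1)[of l] l by (intro tendsto_rabs) auto
    then have "\<forall>\<^sub>F n in sequentially. \<bar>ys n l\<bar> < x" by (rule order_tendstoD) (use y(2) in simp)
    then show "\<forall>\<^sub>F n in sequentially. \<not> x \<le> \<bar>ys n l\<bar>" by eventually_elim simp
  qed
  moreover have "lim.prob {\<omega> \<in> space Q. x \<le> \<bar>increment \<delta> d l \<omega>\<bar>} \<le> 3 * sqrt (v * r) ^ 4 * \<delta>\<^sup>2 / x ^ 4"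
  proof -
    have "(real l - real d) * \<delta> < (real (Suc l) - real d) * \<delta>" using assms by simp
    from lim.prob_increment_ge[OF this assms(3), of "sqrt (v * r)"] show ?thesis
      unfolding increment_def by (simp add: algebra_simps)
  qed
  ultimately show ?thesis using l by (auto elim!: eventually_mono)
qed

definition grid_event :: "nat \<Rightarrow> real \<Rightarrow> real \<Rightarrow> real set \<Rightarrow> 'b set" where
  "grid_event d \<delta> \<eta> C = {\<omega> \<in> space Q. near_min_in (r * D / 2) d \<delta> \<eta> C (\<lambda>l. increment \<delta> d l \<omega>)}"

text \<open>The error terms are, in this order, the probability of a large oscillation within one of the
  blocks, the probability that the minimizer leaves the window \<open>[- d * \<delta> * T n, d * \<delta> * T n]\<close>, and
  all that vanishes as \<open>n\<close> grows.\<close>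

lemma eventually_prob_argmin_in_le_grid_event:
  fixes T :: "nat \<Rightarrow> real" and \<delta> \<eta> e :: real and d :: nat
  assumes T: "filterlim T at_top sequentially" and pos: "0 < \<delta>" "0 < \<eta>" "0 < e" "0 < d"
    and c: "\<And>n. 0 < T n \<Longrightarrow> c n = 1 / (T n * sqrt (T n))"
    and small: "8 * (\<delta> * r * v) \<le> \<eta>\<^sup>2" and mesh: "r * D / 2 * \<delta>\<^sup>2 * (3 * real d + 2) \<le> \<eta>"
    and C: "\<And>u. u \<in> C \<Longrightarrow> of_int (trunc_grid \<delta> u) * \<delta> \<in> C" and Cm: "C \<in> sets borel"
    and A: "\<And>c h1. 0 < c \<Longrightarrow> 0 < h1 \<Longrightarrow>
      right.prob {\<omega> \<in> space M. h1 \<le> \<bar>argmin (Lam c \<omega>)\<bar>} \<le> A * (1 / (c\<^sup>2 * h1 ^ 3) + 1 / h1)"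
  shows "\<forall>\<^sub>F n in sequentially. right.prob {\<omega> \<in> space M. argmin (Lam (c n) \<omega>) / T n \<in> C}
    \<le> lim.prob (grid_event d \<delta> (8 * \<eta>) C) + 4 * (real d + 1) * (48 * sqrt (v * r) ^ 4 * \<delta>\<^sup>2 / \<eta> ^ 4)
      + A * (1 / (real d * \<delta>) ^ 3) + e"
proof -
  define k where "k n = nat \<lfloor>r * \<delta> * T n\<rfloor>" for n
  define q where "q n = sqrt (\<delta> * r) / sqrt (k n)" for n
  let ?b = "r * D / 2"
  have k: "filterlim k at_top sequentially"
  proof -
    have "filterlim (\<lambda>n. r * \<delta> * T n) at_top sequentially"
      using right.r_pos pos by (intro filterlim_tendsto_pos_mult_at_top[OF tendsto_const _ T]) simp
    then show ?thesis unfolding k_def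
      by (intro filterlim_compose[OF filterlim_nat_sequentially] filterlim_compose[OF filterlim_floor_sequentially])
  qed
  let ?t = "48 * sqrt (v * r) ^ 4 * \<delta>\<^sup>2 / \<eta> ^ 4"
  let ?\<beta> = "?t + e / (16 * (real d + 1))"
  have \<beta>e: "0 < e / (16 * (real d + 1))" using pos by simp
  have x4: "3 * sqrt (v * r) ^ 4 * \<delta>\<^sup>2 / (\<eta> / 2) ^ 4 = ?t" by (simp add: power_divide)
  \<comment> \<open>Blocks \<open>0, \<dots>, d\<close> on either side occur in the estimate, hence vectors for \<open>d + 1\<close>.\<close>
  note ge = eventually_prob_block_ge[OF pos(1) k _ \<beta>e, of "\<eta> / 2" _ "d + 1", unfolded x4]
  have lastR: "\<forall>\<^sub>F n in sequentially. right.prob {\<omega> \<in> space M. \<eta> / 2 \<le> \<bar>q n * (\<Sum>j=l*k n+1..l*k n+k n. ep j \<omega>)\<bar>} \<le> ?\<beta>"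
    if "l \<le> d" for l
  proof -
    have "block (k n) (d + 1) (q n) (d + 1 + l) \<omega> = q n * (\<Sum>j=l*k n+1..l*k n+k n. ep j \<omega>)" for n \<omega>
      by (simp add: block_def)
    with ge[of "d + 1 + l", folded q_def] that pos(2) show ?thesis by (simp only:) simp
  qed
  have lastL: "\<forall>\<^sub>F n in sequentially. right.prob {\<omega> \<in> space M. \<eta> / 2 \<le> \<bar>q n * (\<Sum>j=l*k n+1..l*k n+k n. - em j \<omega>)\<bar>} \<le> ?\<beta>"
    if "l \<le> d" for l
  proof -
    have "\<bar>block (k n) (d + 1) (q n) (d - l) \<omega>\<bar> = \<bar>q n * (\<Sum>j=l*k n+1..l*k n+k n. - em j \<omega>)\<bar>" for n \<omega>
      using that by (simp add: block_def sum_negf)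
    with ge[of "d - l", folded q_def] that pos(2) show ?thesis by (simp only:) simp
  qed
  have e16: "0 < e / 16" using pos by simp
  have nearR: "\<forall>\<^sub>F n in sequentially. \<exists>B\<in>right.events. right.prob B \<le> (real d + 1) * (2 * ?\<beta>) + e / 16 \<and>
    (\<forall>\<omega>\<in>space M - B. \<forall>i<d. \<forall>u. real i * \<delta> \<le> u \<longrightarrow> u \<le> (real i + 1) * \<delta> \<longrightarrow>
      \<bar>q n * right.walk (c n) \<omega> (u * T n) - (q n * right.noise \<omega> (i * k n) + ?b * (real i * \<delta>)\<^sup>2)\<bar> \<le> 4 * \<eta>)"
    unfolding q_def k_def
  proof (rule right.eventually_walk_near_blocks[OF T pos(1,2) e16 _ small mesh])
    show "c n = 1 / (T n * sqrt (T n))" if "0 < T n" for n using that by (rule c)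
  qed (rule lastR[unfolded q_def k_def])
  have nearL: "\<forall>\<^sub>F n in sequentially. \<exists>B\<in>right.events. right.prob B \<le> (real d + 1) * (2 * ?\<beta>) + e / 16 \<and>
    (\<forall>\<omega>\<in>space M - B. \<forall>i<d. \<forall>u. real i * \<delta> \<le> u \<longrightarrow> u \<le> (real i + 1) * \<delta> \<longrightarrow>
      \<bar>q n * left.walk (c n) \<omega> (u * T n) - (q n * left.noise \<omega> (i * k n) + ?b * (real i * \<delta>)\<^sup>2)\<bar> \<le> 4 * \<eta>)"
    unfolding q_def k_def
  proof (rule left.eventually_walk_near_blocks[OF T pos(1,2) e16 _ small mesh])
    show "c n = 1 / (T n * sqrt (T n))" if "0 < T n" for n using that by (rule c)
  qed (rule lastL[unfolded q_def k_def])
  have blockR: "\<forall>\<^sub>F n in sequentially. right.prob {\<omega> \<in> space M. near_min_in ?b d \<delta> (8 * \<eta>) C (\<lambda>l. block (k n) d (q n) l \<omega>)}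
      < lim.prob (grid_event d \<delta> (8 * \<eta>) C) + e / 16"
  proof -
    have "\<forall>\<^sub>F n in sequentially. right.prob {\<omega> \<in> space M. near_min_in ?b d \<delta> (8 * \<eta>) C (\<lambda>l\<in>{..<2 * d}. block (k n) d (sqrt (\<delta> * r) / sqrt (k n)) l \<omega>)}
      < lim.prob {\<omega> \<in> space Q. near_min_in ?b d \<delta> (8 * \<eta>) C (\<lambda>l\<in>{..<2 * d}. increment \<delta> d l \<omega>)} + e / 16"
      by (rule eventually_prob_block[OF pos(1) k pos(4) e16 near_min_in_measurable]) (rule near_min_in_closed)
    then show ?thesis unfolding near_min_in_restrict grid_event_def q_def .
  qed
  have Tpos: "\<forall>\<^sub>F n in sequentially. 0 < T n" using T by (simp add: filterlim_at_top_dense)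
  have kpos: "\<forall>\<^sub>F n in sequentially. 0 < k n"
  proof -
    have "\<forall>\<^sub>F n in sequentially. 1 \<le> k n" using k by (simp add: filterlim_at_top)
    then show ?thesis by eventually_elim simp
  qed
  have tail: "\<forall>\<^sub>F n in sequentially. A * (1 / (real d * \<delta> * T n)) < e / 16"
  proof -
    have "(\<lambda>n. A * (1 / (real d * \<delta>) * inverse (T n))) \<longlonglongrightarrow> A * (1 / (real d * \<delta>) * 0)"
      by (intro tendsto_intros tendsto_inverse_0_at_top[OF T])
    then have "(\<lambda>n. A * (1 / (real d * \<delta> * T n))) \<longlonglongrightarrow> 0" by (simp add: field_simps)
    then show ?thesis using e16 by (rule order_tendstoD)
  qed
  show ?thesis
    using nearR nearL blockR Tpos kpos tail
  proof eventually_elim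
    case (elim n)
    obtain B1 where B1: "B1 \<in> right.events" "right.prob B1 \<le> (real d + 1) * (2 * ?\<beta>) + e / 16"
      "\<And>\<omega>. \<omega> \<in> space M - B1 \<Longrightarrow> \<forall>i<d. \<forall>u. real i * \<delta> \<le> u \<longrightarrow> u \<le> (real i + 1) * \<delta> \<longrightarrow>
        \<bar>q n * right.walk (c n) \<omega> (u * T n) - (q n * right.noise \<omega> (i * k n) + ?b * (real i * \<delta>)\<^sup>2)\<bar> \<le> 4 * \<eta>"
      using elim(1) by blast
    obtain B2 where B2: "B2 \<in> right.events" "right.prob B2 \<le> (real d + 1) * (2 * ?\<beta>) + e / 16"
      "\<And>\<omega>. \<omega> \<in> space M - B2 \<Longrightarrow> \<forall>i<d. \<forall>u. real i * \<delta> \<le> u \<longrightarrow> u \<le> (real i + 1) * \<delta> \<longrightarrow>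
        \<bar>q n * left.walk (c n) \<omega> (u * T n) - (q n * left.noise \<omega> (i * k n) + ?b * (real i * \<delta>)\<^sup>2)\<bar> \<le> 4 * \<eta>"
      using elim(2) by blast
    have Tn: "0 < T n" by (rule elim(4))
    have cn: "0 < c n" using c[OF Tn] Tn by simp
    have qn: "0 < q n" using elim(5) pos right.r_pos by (simp add: q_def)
    let ?h1 = "real d * \<delta> * T n"
    have h1: "0 < ?h1" using pos Tn by simp
    let ?B3 = "{\<omega> \<in> space M. ?h1 \<le> \<bar>argmin (Lam (c n) \<omega>)\<bar>}"
    let ?B4 = "{\<omega> \<in> space M. near_min_in ?b d \<delta> (8 * \<eta>) C (\<lambda>l. block (k n) d (q n) l \<omega>)}"
    have B3: "?B3 \<in> right.events" by measurable
    have B4: "?B4 \<in> right.events"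
    proof -
      have m: "(\<lambda>\<omega>. \<lambda>l\<in>{..<2 * d}. block (k n) d (q n) l \<omega>) \<in> measurable M (PiM {..<2 * d} (\<lambda>_. borel))"
        using block_indep[of "k n" d "q n"] by (intro measurable_restrict) (auto simp: right.indep_vars_def)
      have "?B4 = (\<lambda>\<omega>. \<lambda>l\<in>{..<2 * d}. block (k n) d (q n) l \<omega>) -` {x \<in> space (PiM {..<2 * d} (\<lambda>_. borel)). near_min_in ?b d \<delta> (8 * \<eta>) C x} \<inter> space M"
        using near_min_in_restrict[of ?b d \<delta> "8 * \<eta>" C] by (auto simp: space_PiM)
      also have "\<dots> \<in> right.events" by (rule measurable_sets[OF m near_min_in_measurable])
      finally show ?thesis .
    qed
    have "right.prob {\<omega> \<in> space M. argmin (Lam (c n) \<omega>) / T n \<in> C} \<le> right.prob (B1 \<union> B2 \<union> (?B3 \<union> ?B4))"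
    proof (rule right.finite_measure_mono_AE)
      show "AE \<omega> in M. \<omega> \<in> {\<omega> \<in> space M. argmin (Lam (c n) \<omega>) / T n \<in> C} \<longrightarrow> \<omega> \<in> B1 \<union> B2 \<union> (?B3 \<union> ?B4)"
        using AE_ex_smallest_minimizer[OF cn] AE_space
      proof eventually_elim
        case (elim \<omega>)
        then obtain h where h: "is_smallest_minimizer (Lam (c n) \<omega>) h" by blast
        have ah: "argmin (Lam (c n) \<omega>) = h" by (rule argmin_eqI[OF h])
        have hm: "is_minimizer (Lam (c n) \<omega>) h" using h by (simp add: is_smallest_minimizer_def)
        have "\<omega> \<in> ?B4" if "h / T n \<in> C" "\<omega> \<notin> B1" "\<omega> \<notin> B2" "\<omega> \<notin> ?B3"
        proof -
          have hT: "\<bar>h\<bar> < real d * \<delta> * T n" using that(4) elim(2) by (simp add: ah)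
          have "near_min_in ?b d \<delta> (2 * (4 * \<eta>)) C (\<lambda>l. block (k n) d (q n) l \<omega>)"
            by (rule minimizer_near_min_in[OF Tn pos(1) qn B1(3) B2(3) C hm hT that(1)]) (use that elim(2) in auto)
          then show ?thesis using elim(2) by simp
        qed
        then show ?case unfolding Un_iff mem_Collect_eq ah by blast
      qed
      show "B1 \<union> B2 \<union> (?B3 \<union> ?B4) \<in> right.events" by (intro sets.Un B1(1) B2(1) B3 B4)
    qed
    also have "\<dots> \<le> right.prob (B1 \<union> B2) + right.prob (?B3 \<union> ?B4)"
      by (intro measure_Un_le sets.Un B1(1) B2(1) B3 B4)
    also have "\<dots> \<le> (right.prob B1 + right.prob B2) + (right.prob ?B3 + right.prob ?B4)"
      by (intro add_mono measure_Un_le B1(1) B2(1) B3 B4)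
    also have "\<dots> \<le> (2 * ((real d + 1) * (2 * ?\<beta>)) + e / 8)
        + ((A * (1 / (real d * \<delta>) ^ 3) + e / 16) + (lim.prob (grid_event d \<delta> (8 * \<eta>) C) + e / 16))"
    proof -
      have "(c n)\<^sup>2 * ?h1 ^ 3 = (real d * \<delta>) ^ 3"
      proof -
        have "(c n)\<^sup>2 = 1 / (T n ^ 3)" unfolding c[OF Tn] using Tn
          by (simp add: power2_eq_square power3_eq_cube power_divide)
        then show ?thesis using Tn by (simp add: power_mult_distrib)
      qed
      then have "right.prob ?B3 \<le> A * (1 / (real d * \<delta>) ^ 3 + 1 / ?h1)" using A[OF cn h1] by simp
      then have "right.prob ?B3 \<le> A * (1 / (real d * \<delta>) ^ 3) + e / 16" using elim(6) unfolding distrib_left by linarith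
      moreover have "p1 + p2 + (p3 + p4) \<le> 2 * x + e / 8 + ((y + e / 16) + (z + e / 16))"
        if "p1 \<le> x + e / 16" "p2 \<le> x + e / 16" "p3 \<le> y + e / 16" "p4 < z + e / 16" for p1 p2 p3 p4 x y z
        using that by linarith
      ultimately show ?thesis using B1(2) B2(2) elim(3) by blast
    qed
    also have "2 * ((real d + 1) * (2 * ?\<beta>)) = 4 * (real d + 1) * ?t + e / 4"
    proof -
      have *: "2 * (y * (2 * (t + e / (16 * y)))) = 4 * y * t + e / 4" if "0 < y" for y t :: real
        using that by (simp add: field_simps)
      show ?thesis by (rule *) simp
    qed
    finally show ?case using pos(3) by linarith
  qed
qed

lemma grid_event_measurable: assumes "0 < \<delta>" shows "grid_event d \<delta> \<eta> C \<in> lim.events"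
proof -
  have m: "(\<lambda>\<omega>. \<lambda>l\<in>{..<2 * d}. increment \<delta> d l \<omega>) \<in> measurable Q (PiM {..<2 * d} (\<lambda>_. borel))"
    using increment_indep[OF assms, of d] by (intro measurable_restrict) (auto simp: lim.indep_vars_def)
  have "grid_event d \<delta> \<eta> C = (\<lambda>\<omega>. \<lambda>l\<in>{..<2 * d}. increment \<delta> d l \<omega>) -` {x \<in> space (PiM {..<2 * d} (\<lambda>_. borel)). near_min_in (r * D / 2) d \<delta> \<eta> C x} \<inter> space Q"
    using near_min_in_restrict[of "r * D / 2" d \<delta> \<eta> C] by (auto simp: space_PiM grid_event_def)
  also have "\<dots> \<in> lim.events" by (rule measurable_sets[OF m near_min_in_measurable])
  finally show ?thesis .
qed

lemma argmin_Z_measurable[measurable]: "(\<lambda>\<omega>. argmin (lim.Z \<omega>)) \<in> borel_measurable Q"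
  by (rule borel_measurable_argmin_continuous) (use lim.Z_continuous in auto)

text \<open>If the unique minimizer \<open>l\<close> of \<open>Z\<close> lies outside the closed set \<open>C\<close>, then \<open>Z\<close> exceeds its
  minimum by a fixed amount on \<open>C\<close>, but comes close to it at grid points near \<open>l\<close>.\<close>

lemma eventually_not_in_grid_event:
  fixes d :: "nat \<Rightarrow> nat" and \<delta> \<eta> :: "nat \<Rightarrow> real"
  assumes \<omega>: "\<omega> \<in> space Q" and l: "is_minimizer (lim.Z \<omega>) l" "\<And>h. is_minimizer (lim.Z \<omega>) h \<Longrightarrow> h = l"
    and coercive: "\<exists>H>0. \<forall>t. H \<le> \<bar>t\<bar> \<longrightarrow> r * D / 2 / 2 * t\<^sup>2 \<le> lim.Z \<omega> t"
    and C: "closed C" "l \<notin> C"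
    and \<delta>: "\<And>k. 0 < \<delta> k" "\<delta> \<longlonglongrightarrow> 0" and \<eta>: "\<eta> \<longlonglongrightarrow> 0" and d: "filterlim (\<lambda>k. real (d k) * \<delta> k) at_top sequentially"
  shows "\<forall>\<^sub>F k in sequentially. \<omega> \<notin> grid_event (d k) (\<delta> k) (\<eta> k) C"
proof -
  let ?Z = "lim.Z \<omega>" and ?b = "r * D / 2"
  have b: "0 < ?b" by (rule lim.b)
  have cont: "continuous_on UNIV ?Z" by (rule lim.Z_continuous[OF \<omega>])
  obtain \<gamma> where \<gamma>: "0 < \<gamma>" "\<And>h. h \<in> C \<Longrightarrow> ?Z l + \<gamma> \<le> ?Z h"
  proof -
    obtain H where H: "0 < H" "\<And>t. H \<le> \<bar>t\<bar> \<Longrightarrow> ?b / 2 * t\<^sup>2 \<le> ?Z t" using coercive by blast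
    define H' where "H' = max H (max 1 (2 / ?b))"
    have l0: "?Z l \<le> 0" using l(1) lim.Z_0[OF \<omega>] by (metis is_minimizer_def)
    have out: "?Z l + 1 \<le> ?Z h" if h: "H' \<le> \<bar>h\<bar>" for h
    proof -
      have "1 \<le> \<bar>h\<bar>" "2 / ?b \<le> \<bar>h\<bar>" using h unfolding H'_def by linarith+
      then have "1 * (2 / ?b) \<le> \<bar>h\<bar> * \<bar>h\<bar>" using b by (intro mult_mono) auto
      then have "2 / ?b \<le> h\<^sup>2" by (simp add: power2_eq_square)
      then have "?b / 2 * (2 / ?b) \<le> ?b / 2 * h\<^sup>2" using b by (intro mult_left_mono) auto
      also have "\<dots> \<le> ?Z h" using h by (intro H(2)) (simp add: H'_def)
      finally have "?b / 2 * (2 / ?b) \<le> ?Z h" .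
      moreover have "x / 2 * (2 / x) = 1" if "0 < x" for x :: real using that by simp
      from this[OF b] have "?b / 2 * (2 / ?b) = 1" .
      ultimately show ?thesis using l0 by linarith
    qed
    show ?thesis
    proof (cases "C \<inter> {-H'..H'} = {}")
      case True
      show ?thesis
      proof (rule that[of 1])
        fix h assume "h \<in> C"
        then have "H' \<le> \<bar>h\<bar>" using True by force
        then show "?Z l + 1 \<le> ?Z h" by (rule out)
      qed simp
    next
      case False
      have "compact (C \<inter> {-H'..H'})" using C(1) by (intro closed_Int_compact) auto
      moreover have "continuous_on (C \<inter> {-H'..H'}) ?Z" using cont by (rule continuous_on_subset) simp
      ultimately obtain h0 where h0: "h0 \<in> C" "\<And>h. h \<in> C \<inter> {-H'..H'} \<Longrightarrow> ?Z h0 \<le> ?Z h"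
        using continuous_attains_inf[of "C \<inter> {-H'..H'}" ?Z] False by blast
      have "?Z l < ?Z h0"
      proof (rule ccontr)
        assume "\<not> ?Z l < ?Z h0"
        then have "is_minimizer ?Z h0" using l(1) unfolding is_minimizer_def by (meson not_less order_trans)
        then show False using l(2) C(2) h0(1) by blast
      qed
      show ?thesis
      proof (rule that[of "min 1 (?Z h0 - ?Z l)"])
        fix h assume h: "h \<in> C"
        show "?Z l + min 1 (?Z h0 - ?Z l) \<le> ?Z h"
        proof (cases "h \<in> {-H'..H'}")
          case True
          then show ?thesis using h0(2)[of h] h by auto
        next
          case False
          then have "H' \<le> \<bar>h\<bar>" by auto
          from out[OF this] show ?thesis by linarith
        qed
      qed (use \<open>?Z l < ?Z h0\<close> in simp)
    qed
  qed
  have "isCont ?Z l" using cont by (simp add: continuous_on_eq_continuous_at)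
  then have "\<forall>\<^sub>F x in at l. dist (?Z x) (?Z l) < \<gamma> / 2"
    unfolding isCont_def by (rule tendstoD) (use \<gamma> in simp)
  then obtain \<rho> where \<rho>: "0 < \<rho>" "\<And>x. x \<noteq> l \<Longrightarrow> dist x l < \<rho> \<Longrightarrow> dist (?Z x) (?Z l) < \<gamma> / 2"
    unfolding eventually_at by auto
  have "\<forall>\<^sub>F k in sequentially. \<delta> k < min \<rho> 1" using \<delta>(2) by (rule order_tendstoD) (use \<rho> in simp)
  moreover have "\<forall>\<^sub>F k in sequentially. \<eta> k < \<gamma> / 2" using \<eta> by (rule order_tendstoD) (use \<gamma> in simp)
  moreover have "\<forall>\<^sub>F k in sequentially. \<bar>l\<bar> + 1 < real (d k) * \<delta> k" using d by (simp add: filterlim_at_top_dense)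
  ultimately show ?thesis
  proof eventually_elim
    case (elim k)
    let ?d = "d k" and ?\<delta> = "\<delta> k"
    have \<delta>k: "0 < ?\<delta>" by (rule \<delta>(1))
    have path: "grid_path ?d (\<lambda>i. increment ?\<delta> ?d i \<omega>) z + ?b * (of_int z * ?\<delta>)\<^sup>2 = ?Z (of_int z * ?\<delta>)" if "\<bar>z\<bar> < int ?d" for z
      using grid_path_increment[OF that \<omega>] by (simp add: lim.Z_def)
    define z' where "z' = \<lfloor>l / ?\<delta>\<rfloor>"
    have "of_int z' \<le> l / ?\<delta>" "l / ?\<delta> < of_int z' + 1" unfolding z'_def by linarith+
    then have zl: "of_int z' * ?\<delta> \<le> l" "l < of_int z' * ?\<delta> + ?\<delta>" using \<delta>k by (simp_all add: field_simps)
    have z'd: "\<bar>z'\<bar> < int ?d"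
    proof -
      have "\<bar>of_int z' * ?\<delta>\<bar> < real ?d * ?\<delta>" using zl elim by linarith
      then have "of_int \<bar>z'\<bar> * ?\<delta> < real ?d * ?\<delta>" using \<delta>k by (simp add: abs_mult)
      then have "(of_int \<bar>z'\<bar> :: real) < real ?d" using \<delta>k by simp
      then show ?thesis by linarith
    qed
    have Zz': "?Z (of_int z' * ?\<delta>) < ?Z l + \<gamma> / 2"
    proof (cases "of_int z' * ?\<delta> = l")
      case False
      have "dist (of_int z' * ?\<delta>) l < \<rho>" using zl elim by (simp add: dist_real_def)
      from \<rho>(2)[OF False this] have "\<bar>?Z (of_int z' * ?\<delta>) - ?Z l\<bar> < \<gamma> / 2" by (simp only: dist_real_def)
      then show ?thesis by linarith
    qed (use \<gamma> in simp)
    show ?case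
    proof
      assume "\<omega> \<in> grid_event ?d ?\<delta> (\<eta> k) C"
      then obtain z where z: "\<bar>z\<bar> < int ?d" "of_int z * ?\<delta> \<in> C"
        and le: "\<And>y. \<bar>y\<bar> < int ?d \<Longrightarrow> ?Z (of_int z * ?\<delta>) \<le> ?Z (of_int y * ?\<delta>) + \<eta> k"
        unfolding grid_event_def near_min_in_def using path by auto
      show False using \<gamma>(2)[OF z(2)] le[OF z'd] Zz' elim(2) by linarith
    qed
  qed
qed

text \<open>The upper half of the portmanteau theorem for the minimizers, for closed sets that rounding
  to the grids \<open>s/m \<int>\<close> does not leave.\<close>

lemma eventually_prob_argmin_in_less:
  fixes T :: "nat \<Rightarrow> real" and s e :: real
  assumes T: "filterlim T at_top sequentially" and "0 < s" "0 < e"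
    and c: "\<And>n. 0 < T n \<Longrightarrow> c n = 1 / (T n * sqrt (T n))"
    and C: "closed C" "\<And>m u. 0 < m \<Longrightarrow> u \<in> C \<Longrightarrow> of_int (trunc_grid (s / real m) u) * (s / real m) \<in> C"
  shows "\<forall>\<^sub>F n in sequentially. right.prob {\<omega> \<in> space M. argmin (Lam (c n) \<omega>) / T n \<in> C}
    < lim.prob {\<omega> \<in> space Q. argmin (lim.Z \<omega>) \<in> C} + e"
proof -
  obtain A where A: "\<And>c h1. 0 < c \<Longrightarrow> 0 < h1 \<Longrightarrow>
      right.prob {\<omega> \<in> space M. h1 \<le> \<bar>argmin (Lam c \<omega>)\<bar>} \<le> A * (1 / (c\<^sup>2 * h1 ^ 3) + 1 / h1)"
    using prob_argmin_Lam_tail by blast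
  have Cm: "C \<in> sets borel" using C(1) by simp
  define \<eta> where "\<eta> k = 1 / real (Suc k)" for k
  have \<eta>: "0 < \<eta> k" for k by (simp add: \<eta>_def)
  \<comment> \<open>The window is \<open>[- s (k+1), s (k+1)]\<close>, the tolerance \<open>1 / (k+1)\<close>; the mesh is then chosen small enough
    for the oscillation within the blocks to be negligible.\<close>
  let ?P = "\<lambda>k m. k < m \<and> 8 * (s / real m * r * v) \<le> (\<eta> k)\<^sup>2 \<and> r * D / 2 * (s / real m)\<^sup>2 * (3 * real (m * Suc k) + 2) \<le> \<eta> k
      \<and> 4 * (real (m * Suc k) + 1) * (48 * sqrt (v * r) ^ 4 * (s / real m)\<^sup>2 / (\<eta> k) ^ 4) \<le> \<eta> k"
  have "\<forall>k. \<exists>m. ?P k m"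
  proof
    fix k
    have inv: "(\<lambda>m. 1 / real m) \<longlonglongrightarrow> 0" by (rule lim_1_over_n)
    have sq: "(\<lambda>m. (s / real m)\<^sup>2 * (a * real (m * Suc k) + a')) \<longlonglongrightarrow> 0" for a a' :: real
    proof -
      have "(\<lambda>m. s\<^sup>2 * a * real (Suc k) * (1 / real m) + s\<^sup>2 * a' * (1 / real m) * (1 / real m)) \<longlonglongrightarrow> s\<^sup>2 * a * real (Suc k) * 0 + s\<^sup>2 * a' * 0 * 0"
        by (intro tendsto_intros inv)
      then have "(\<lambda>m. s\<^sup>2 * a * real (Suc k) * (1 / real m) + s\<^sup>2 * a' * (1 / real m) * (1 / real m)) \<longlonglongrightarrow> 0" by simp
      then show ?thesis
      proof (rule Lim_transform_eventually)
        show "\<forall>\<^sub>F m in sequentially. s\<^sup>2 * a * real (Suc k) * (1 / real m) + s\<^sup>2 * a' * (1 / real m) * (1 / real m) = (s / real m)\<^sup>2 * (a * real (m * Suc k) + a')"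
          using eventually_gt_at_top[of 0] by eventually_elim (simp add: power2_eq_square field_simps)
      qed
    qed
    have "(\<lambda>m. 8 * s * r * v * (1 / real m)) \<longlonglongrightarrow> 8 * s * r * v * 0" by (intro tendsto_intros inv)
    then have "(\<lambda>m. 8 * (s / real m * r * v)) \<longlonglongrightarrow> 0" by (simp add: mult_ac)
    then have "\<forall>\<^sub>F m in sequentially. 8 * (s / real m * r * v) < (\<eta> k)\<^sup>2" by (rule order_tendstoD) (use \<eta>[of k] in simp)
    moreover have "(\<lambda>m. r * D / 2 * ((s / real m)\<^sup>2 * (3 * real (m * Suc k) + 2))) \<longlonglongrightarrow> r * D / 2 * 0"
      by (intro tendsto_intros sq)
    then have "(\<lambda>m. r * D / 2 * (s / real m)\<^sup>2 * (3 * real (m * Suc k) + 2)) \<longlonglongrightarrow> 0" by (simp add: mult.assoc)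
    then have "\<forall>\<^sub>F m in sequentially. r * D / 2 * (s / real m)\<^sup>2 * (3 * real (m * Suc k) + 2) < \<eta> k" by (rule order_tendstoD) (use \<eta>[of k] in simp)
    moreover have eq: "4 * (y + 1) * (48 * w * x / z) = 4 * (48 * w / z) * (x * (1 * y + 1))" for w x y z :: real
      by simp
    have "(\<lambda>m. 4 * (48 * sqrt (v * r) ^ 4 / (\<eta> k) ^ 4) * ((s / real m)\<^sup>2 * (1 * real (m * Suc k) + 1))) \<longlonglongrightarrow> 4 * (48 * sqrt (v * r) ^ 4 / (\<eta> k) ^ 4) * 0"
      by (intro tendsto_intros sq)
    then have "(\<lambda>m. 4 * (real (m * Suc k) + 1) * (48 * sqrt (v * r) ^ 4 * (s / real m)\<^sup>2 / (\<eta> k) ^ 4)) \<longlonglongrightarrow> 0"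
      unfolding eq by simp
    then have "\<forall>\<^sub>F m in sequentially. 4 * (real (m * Suc k) + 1) * (48 * sqrt (v * r) ^ 4 * (s / real m)\<^sup>2 / (\<eta> k) ^ 4) < \<eta> k" by (rule order_tendstoD) (use \<eta>[of k] in simp)
    ultimately have "\<forall>\<^sub>F m in sequentially. ?P k m"
      using eventually_gt_at_top[of k] by eventually_elim linarith
    then show "\<exists>m. ?P k m" by (rule eventually_happens'[OF sequentially_bot])
  qed
  from choice[OF this] obtain m where m: "\<And>k. ?P k (m k)" by blast
  define \<delta> where "\<delta> k = s / real (m k)" for k
  define d where "d k = m k * Suc k" for k
  have mk: "k < m k" for k using m[of k] by blast
  have m0: "0 < m k" for k using mk[of k] by simp
  have \<delta>: "0 < \<delta> k" for k using m0[of k] \<open>0 < s\<close> by (simp add: \<delta>_def)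
  have d\<delta>: "real (d k) * \<delta> k = s * real (Suc k)" for k 
    unfolding d_def \<delta>_def of_nat_mult using m0[of k] by (simp add: field_simps del: of_nat_Suc)
  have d0: "0 < d k" for k using m0[of k] by (simp add: d_def)
  have s_lim: "(\<lambda>k. s * (1 / real (Suc k))) \<longlonglongrightarrow> 0"
    using tendsto_mult[OF tendsto_const[of s] LIMSEQ_Suc[OF lim_1_over_n]] by simp
  have \<delta>_lim: "\<delta> \<longlonglongrightarrow> 0"
  proof (rule tendsto_sandwich[OF _ _ tendsto_const s_lim])
    show "\<forall>\<^sub>F k in sequentially. 0 \<le> \<delta> k" by (intro always_eventually allI less_imp_le \<delta>)
    show "\<forall>\<^sub>F k in sequentially. \<delta> k \<le> s * (1 / real (Suc k))"
    proof (rule always_eventually, rule allI)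
      fix k
      have "Suc k \<le> m k" using mk[of k] by simp
      then show "\<delta> k \<le> s * (1 / real (Suc k))" using \<open>0 < s\<close> by (simp add: \<delta>_def frac_le del: of_nat_Suc)
    qed
  qed
  have \<eta>_lim: "\<eta> \<longlonglongrightarrow> 0" unfolding \<eta>_def by (rule LIMSEQ_Suc[OF lim_1_over_n])
  have \<eta>8: "(\<lambda>k. 8 * \<eta> k) \<longlonglongrightarrow> 0" using tendsto_mult[OF tendsto_const[of 8] \<eta>_lim] by simp
  have d_lim: "filterlim (\<lambda>k. real (d k) * \<delta> k) at_top sequentially"
    unfolding d\<delta> using \<open>0 < s\<close>
    by (intro filterlim_tendsto_pos_mult_at_top[OF tendsto_const] filterlim_compose[OF filterlim_real_sequentially filterlim_Suc])
  have e4: "0 < e / 4" using \<open>0 < e\<close> by simp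
  have "\<forall>\<^sub>F k in sequentially. lim.prob (grid_event (d k) (\<delta> k) (8 * \<eta> k) C) < lim.prob {\<omega> \<in> space Q. argmin (lim.Z \<omega>) \<in> C} + e / 4"
  proof (rule lim.eventually_prob_less[OF grid_event_measurable[OF \<delta>] _ _ e4])
    show "{\<omega> \<in> space Q. argmin (lim.Z \<omega>) \<in> C} \<in> lim.events" using Cm by measurable
    show "AE \<omega> in Q. (\<forall>\<^sub>F k in sequentially. \<omega> \<notin> grid_event (d k) (\<delta> k) (8 * \<eta> k) C) \<or> \<omega> \<in> {\<omega> \<in> space Q. argmin (lim.Z \<omega>) \<in> C}"
      using lim.AE_ex1_minimizer lim.AE_Z_coercive AE_space
    proof eventually_elim
      case (elim \<omega>)
      then obtain l where l: "is_minimizer (lim.Z \<omega>) l" "\<And>h. is_minimizer (lim.Z \<omega>) h \<Longrightarrow> h = l" by blast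
      have "is_smallest_minimizer (lim.Z \<omega>) l" using l(1) l(2) unfolding is_smallest_minimizer_def by blast
      then have al: "argmin (lim.Z \<omega>) = l" by (rule argmin_eqI)
      show ?case
      proof (cases "l \<in> C")
        case True
        then show ?thesis using al elim(3) by simp
      next
        case False
        from eventually_not_in_grid_event[OF elim(3) l elim(2) C(1) False \<delta> \<delta>_lim \<eta>8 d_lim] show ?thesis ..
      qed
    qed
  qed
  moreover have "\<forall>\<^sub>F k in sequentially. \<eta> k < e / 4" by (rule order_tendstoD(2)[OF \<eta>_lim e4])
  moreover have "\<forall>\<^sub>F k in sequentially. A * (1 / (real (d k) * \<delta> k) ^ 3) < e / 4"
  proof -
    have "(\<lambda>k. A * inverse (real (d k) * \<delta> k) ^ 3) \<longlonglongrightarrow> A * 0 ^ 3"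
      by (intro tendsto_intros tendsto_inverse_0_at_top[OF d_lim])
    then have "(\<lambda>k. A * (1 / (real (d k) * \<delta> k) ^ 3)) \<longlonglongrightarrow> 0" by (simp add: inverse_eq_divide power_divide)
    then show ?thesis using e4 by (rule order_tendstoD)
  qed
  ultimately have "\<forall>\<^sub>F k in sequentially. lim.prob (grid_event (d k) (\<delta> k) (8 * \<eta> k) C) + \<eta> k + A * (1 / (real (d k) * \<delta> k) ^ 3) + e / 4
      < lim.prob {\<omega> \<in> space Q. argmin (lim.Z \<omega>) \<in> C} + e"
    by eventually_elim linarith
  then obtain k where k: "lim.prob (grid_event (d k) (\<delta> k) (8 * \<eta> k) C) + \<eta> k + A * (1 / (real (d k) * \<delta> k) ^ 3) + e / 4
      < lim.prob {\<omega> \<in> space Q. argmin (lim.Z \<omega>) \<in> C} + e"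
    using eventually_happens'[OF sequentially_bot] by blast
  have Pk: "8 * (\<delta> k * r * v) \<le> (\<eta> k)\<^sup>2" "r * D / 2 * (\<delta> k)\<^sup>2 * (3 * real (d k) + 2) \<le> \<eta> k"
    "4 * (real (d k) + 1) * (48 * sqrt (v * r) ^ 4 * (\<delta> k)\<^sup>2 / (\<eta> k) ^ 4) \<le> \<eta> k"
    using m[of k] unfolding \<delta>_def d_def by blast+
  have Ck: "\<And>u. u \<in> C \<Longrightarrow> of_int (trunc_grid (\<delta> k) u) * \<delta> k \<in> C"
    unfolding \<delta>_def by (rule C(2)[OF m0])
  have "\<forall>\<^sub>F n in sequentially. right.prob {\<omega> \<in> space M. argmin (Lam (c n) \<omega>) / T n \<in> C}
    \<le> lim.prob (grid_event (d k) (\<delta> k) (8 * \<eta> k) C) + 4 * (real (d k) + 1) * (48 * sqrt (v * r) ^ 4 * (\<delta> k)\<^sup>2 / \<eta> k ^ 4)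
      + A * (1 / (real (d k) * \<delta> k) ^ 3) + e / 4"
  proof (rule eventually_prob_argmin_in_le_grid_event[OF T \<delta> \<eta> e4 d0 _ Pk(1,2) _ Cm])
    show "c n = 1 / (T n * sqrt (T n))" if "0 < T n" for n using that by (rule c)
  qed (rule Ck A; assumption)+
  then show ?thesis
  proof eventually_elim
    case (elim n)
    then show ?case using k Pk(3) by linarith
  qed
qed

text \<open>Applied to \<open>{..x}\<close> and to \<open>{x..}\<close>, the upper bounds for closed sets enclose the distribution
  functions at \<open>x\<close>, unless the limit law has an atom there.\<close>

lemma weak_conv_argmin:
  fixes c :: "nat \<Rightarrow> real"
  assumes c: "\<And>n. 0 < c n" "c \<longlonglongrightarrow> 0"
  shows "weak_conv_m (\<lambda>n. distr M borel (\<lambda>\<omega>. c n powr (2 / 3) * argmin (Lam (c n) \<omega>)))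
    (distr Q borel (\<lambda>\<omega>. argmin (lim.Z \<omega>)))"
proof -
  define T where "T n = c n powr (- (2 / 3))" for n
  have Tpos: "0 < T n" for n using c(1)[of n] by (simp add: T_def)
  have T: "filterlim T at_top sequentially"
  proof -
    have "filterlim c (at_right 0) sequentially"
      unfolding filterlim_at by (intro conjI always_eventually allI c(2)) (metis c(1) greaterThan_iff less_irrefl)+
    moreover have "filterlim (\<lambda>x::real. x powr (- (2 / 3))) at_top (at_right 0)" by real_asymp
    ultimately show ?thesis unfolding T_def by (rule filterlim_compose[rotated])
  qed
  have cT: "c n = 1 / (T n * sqrt (T n))" for n
  proof -
    have "T n * sqrt (T n) = c n powr (- (2 / 3)) * c n powr (- (1 / 3))"
      using c(1)[of n] by (simp add: T_def powr_half_sqrt[symmetric] powr_powr)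
    also have "\<dots> = c n powr (- 1)" by (simp add: powr_add[symmetric])
    finally show ?thesis using c(1)[of n] by (simp add: powr_minus inverse_eq_divide)
  qed
  have scale: "c n powr (2 / 3) * h = h / T n" for n h
    by (simp add: T_def powr_minus inverse_eq_divide)
  let ?mu = "\<lambda>n. distr M borel (\<lambda>\<omega>. c n powr (2 / 3) * argmin (Lam (c n) \<omega>))" and ?nu = "distr Q borel (\<lambda>\<omega>. argmin (lim.Z \<omega>))"
  interpret nu: prob_space ?nu by (rule lim.prob_space_distr) simp
  have mu: "measure (?mu n) B = right.prob {\<omega> \<in> space M. argmin (Lam (c n) \<omega>) / T n \<in> B}" if "B \<in> sets borel" for n B
  proof -
    have "(\<lambda>\<omega>. c n powr (2 / 3) * argmin (Lam (c n) \<omega>)) -` B \<inter> space M = {\<omega> \<in> space M. argmin (Lam (c n) \<omega>) / T n \<in> B}"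
      unfolding scale by auto
    then show ?thesis using that by (simp add: measure_distr)
  qed
  have nu: "measure ?nu B = lim.prob {\<omega> \<in> space Q. argmin (lim.Z \<omega>) \<in> B}" if "B \<in> sets borel" for B
  proof -
    have "(\<lambda>\<omega>. argmin (lim.Z \<omega>)) -` B \<inter> space Q = {\<omega> \<in> space Q. argmin (lim.Z \<omega>) \<in> B}" by auto
    then show ?thesis using that by (simp add: measure_distr)
  qed
  show ?thesis unfolding weak_conv_m_def weak_conv_def
  proof (intro allI impI)
    fix x assume cont: "isCont (cdf ?nu) x"
    \<comment> \<open>A mesh unit of which \<open>x\<close> is an integer multiple.\<close>
    define s where "s = (if x = 0 then 1 else \<bar>x\<bar>)"
    have s: "0 < s" by (simp add: s_def)
    obtain j :: int where j: "x = of_int j * s"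
    proof -
      have "x = of_int (if x = 0 then 0 else if 0 < x then 1 else - 1) * s" by (auto simp: s_def)
      then show ?thesis by (rule that)
    qed
    have xm: "x = of_int (j * int m) * (s / real m)" if "0 < m" for m :: nat
      using that by (simp add: j)
    have le: "of_int (trunc_grid (s / real m) u) * (s / real m) \<in> {..x}" if "0 < m" "u \<in> {..x}" for m u
      using trunc_grid_le[of "s / real m" u "j * int m"] that s xm[OF that(1)] by auto
    have ge: "of_int (trunc_grid (s / real m) u) * (s / real m) \<in> {x..}" if "0 < m" "u \<in> {x..}" for m u
      using trunc_grid_ge[of "s / real m" "j * int m" u] that s xm[OF that(1)] by auto
    have x0: "measure ?nu {x} = 0"
    proof -
      interpret real_distribution ?nu by (rule lim.real_distribution_distr) simp
      show ?thesis using cont isCont_cdf by blast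
    qed
    have ge_nu: "measure ?nu {x..} = 1 - cdf ?nu x"
    proof -
      have "{x..} = {x} \<union> {x<..}" by auto
      then have "measure ?nu {x..} = measure ?nu {x} + measure ?nu {x<..}"
        by (simp only:) (rule nu.finite_measure_Union, auto)
      also have "measure ?nu {x<..} = 1 - cdf ?nu x"
        using nu.prob_compl[of "{..x}"] by (simp add: cdf_def Compl_eq_Diff_UNIV[symmetric])
      finally show ?thesis using x0 by simp
    qed
    show "(\<lambda>n. cdf (?mu n) x) \<longlonglongrightarrow> cdf ?nu x"
    proof (rule tendstoI)
      fix e :: real assume e: "0 < e"
      have "\<forall>\<^sub>F n in sequentially. measure (?mu n) {..x} < measure ?nu {..x} + e"
        using eventually_prob_argmin_in_less[OF T s e cT closed_atMost le] by (simp add: mu nu)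
      moreover have "\<forall>\<^sub>F n in sequentially. measure (?mu n) {x..} < measure ?nu {x..} + e"
        using eventually_prob_argmin_in_less[OF T s e cT closed_atLeast ge] by (simp add: mu nu)
      ultimately show "\<forall>\<^sub>F n in sequentially. dist (cdf (?mu n) x) (cdf ?nu x) < e"
      proof eventually_elim
        case (elim n)
        interpret mu: prob_space "?mu n" by (rule right.prob_space_distr) simp
        have "1 = measure (?mu n) ({..x} \<union> {x..})"
        proof -
          have "{..x} \<union> {x..} = UNIV" by auto
          then show ?thesis using mu.prob_space by simp
        qed
        also have "\<dots> \<le> measure (?mu n) {..x} + measure (?mu n) {x..}" by (rule measure_Un_le) auto
        finally show ?case using elim ge_nu by (simp add: dist_real_def cdf_def abs_less_iff)
      qed
    qed
  qed
qed

end

section \<open>The limit law of the smallest minimizer\<close>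

theorem theorem4p2:
  fixes f p\<^sub>X :: "real \<Rightarrow> real" and \<theta>0 \<beta>l0 \<beta>u0 \<xi>0 :: real
    and \<alpha> \<theta> \<beta>l \<beta>u \<xi> :: "nat \<Rightarrow> real"
    and P :: "'p measure" and X \<epsilon> :: "'p \<Rightarrow> real" and \<sigma>2 :: real
    and M :: "'m measure" and \<nu>p \<nu>m :: "real \<Rightarrow> 'm \<Rightarrow> nat" and \<epsilon>p \<epsilon>m :: "nat \<Rightarrow> 'm \<Rightarrow> real"
    and Q :: "'b measure" and W :: "real \<Rightarrow> 'b \<Rightarrow> real"
    and a0 b0 :: real and \<Lambda> :: "real \<Rightarrow> 'm \<Rightarrow> real \<Rightarrow> real" and Z :: "'b \<Rightarrow> real \<Rightarrow> real"
  assumes \<theta>0: "0 < \<theta>0" "\<theta>0 < 1"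
    and f: "\<And>x. f differentiable (at x)" "bounded (range f)" "mono f"
    and f_limits: "(f \<longlongrightarrow> \<beta>l0) at_bot" "(f \<longlongrightarrow> \<beta>u0) at_top"
    and \<alpha>: "\<And>n. 0 < \<alpha> n" "filterlim \<alpha> at_top sequentially"
    and P: "prob_space P"
    and X: "\<And>\<omega>. \<omega> \<in> space P \<Longrightarrow> X \<omega> \<in> {0..1}"
      "\<And>x. 0 \<le> p\<^sub>X x" "distributed P lborel X p\<^sub>X"
    and \<epsilon>: "\<epsilon> \<in> borel_measurable P" "prob_space.indep_var P borel X borel \<epsilon>"
      "integrable P (\<lambda>\<omega>. (\<epsilon> \<omega>)\<^sup>2)" "prob_space.expectation P \<epsilon> = 0"
      "\<sigma>2 = prob_space.variance P \<epsilon>"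
    and minimizer:
      "\<And>n. is_minimizer (stump_risk P X (\<lambda>\<omega>. f (\<alpha> n * (X \<omega> - \<theta>0)) + \<epsilon> \<omega>)) (\<theta> n, \<beta>l n, \<beta>u n)"
      "\<And>n v. is_minimizer (stump_risk P X (\<lambda>\<omega>. f (\<alpha> n * (X \<omega> - \<theta>0)) + \<epsilon> \<omega>)) v
              \<Longrightarrow> v = (\<theta> n, \<beta>l n, \<beta>u n)"
      "\<And>n. \<beta>l n \<noteq> \<beta>u n"
    and \<xi>: "\<And>n. \<xi> n = \<alpha> n * (\<theta> n - \<theta>0)"
    and \<xi>0: "\<xi>0 = inv f ((\<beta>l0 + \<beta>u0) / 2)"
    and A: "\<exists>U. open U \<and> \<xi>0 \<in> U \<and> f C1_differentiable_on U" "0 < deriv f \<xi>0"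
    and B: "\<exists>U. open U \<and> \<theta>0 \<in> U \<and> p\<^sub>X C1_differentiable_on U \<and> (\<forall>x\<in>U. p\<^sub>X x \<noteq> 0)"
    and C1: "0 < (INF n. Liminf at_infinity
              (\<lambda>h::real. ereal (1 / \<bar>h\<bar> * (LBINT t=0..h. f (t + \<xi> n) - f (\<xi> n)))))"
    and C2: "\<And>K. 0 < K \<Longrightarrow> 0 < (INF n. INF u\<in>{- K + \<xi> n..K + \<xi> n}. ereal (deriv f u))"
    and C3: "set_integrable lborel {..\<xi>0} (\<lambda>t. f t - \<beta>l0)"
      "set_integrable lborel {\<xi>0..} (\<lambda>t. f t - \<beta>u0)"
    and M: "prob_space M"
    and \<nu>p: "poisson_process M (p\<^sub>X \<theta>0) \<nu>p"
      "\<And>\<omega>. \<omega> \<in> space M \<Longrightarrow> right_cont_left_limits (\<lambda>t. \<nu>p t \<omega>)"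
    and \<nu>m: "poisson_process M (p\<^sub>X \<theta>0) \<nu>m"
      "\<And>\<omega>. \<omega> \<in> space M \<Longrightarrow> left_cont_right_limits (\<lambda>t. \<nu>m t \<omega>)"
    and \<epsilon>p: "prob_space.indep_vars M (\<lambda>_. borel) \<epsilon>p {1..}"
      "\<And>j. 1 \<le> j \<Longrightarrow> distr M borel (\<epsilon>p j) = distr P borel \<epsilon>"
    and \<epsilon>m: "prob_space.indep_vars M (\<lambda>_. borel) \<epsilon>m {1..}"
      "\<And>j. 1 \<le> j \<Longrightarrow> distr M borel (\<epsilon>m j) = distr P borel \<epsilon>"
    and independent: "prob_space.indep_sets M
      (\<lambda>k. [generated_events M (count_space UNIV) {0..} \<nu>p,
            generated_events M (count_space UNIV) {0..} \<nu>m,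
            generated_events M borel {1..} \<epsilon>p,
            generated_events M borel {1..} \<epsilon>m] ! k) {..<4}"
    and W: "prob_space Q" "two_sided_brownian_motion Q W"
    and \<Lambda>: "\<Lambda> = Lambda f \<xi>0 \<nu>p \<nu>m \<epsilon>p \<epsilon>m"
    and a0: "a0 = sqrt (\<sigma>2 * p\<^sub>X \<theta>0)"
    and b0: "b0 = p\<^sub>X \<theta>0 * deriv f \<xi>0 / 2"
    and Z: "Z = (\<lambda>\<omega> h. a0 * W h \<omega> + b0 * h\<^sup>2)"
  shows "(\<forall>c>0. (AE \<omega> in M. \<exists>h. is_smallest_minimizer (\<Lambda> c \<omega>) h) \<and>
                (\<lambda>\<omega>. argmin (\<Lambda> c \<omega>)) \<in> borel_measurable M) \<and>
    (AE \<omega> in Q. \<exists>!h. is_minimizer (Z \<omega>) h) \<and> (\<lambda>\<omega>. argmin (Z \<omega>)) \<in> borel_measurable Q \<and>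
    (\<forall>c. (\<forall>n. 0 < c n) \<and> c \<longlonglongrightarrow> 0 \<longrightarrow>
       weak_conv_m (\<lambda>n. distr M borel (\<lambda>\<omega>. c n powr (2 / 3) * argmin (\<Lambda> (c n) \<omega>)))
                   (distr Q borel (\<lambda>\<omega>. argmin (Z \<omega>))))"
proof -
  interpret P: prob_space P by (rule P)
  interpret M: prob_space M by (rule M)
  define r where "r = p\<^sub>X \<theta>0"
  define D where "D = deriv f \<xi>0"
  define \<phi>p where "\<phi>p x = f (\<xi>0 + x) - f \<xi>0" for x
  define \<phi>m where "\<phi>m x = f \<xi>0 - f (\<xi>0 - x)" for x
  have r: "0 < r"
  proof -
    obtain U where "\<theta>0 \<in> U" "\<forall>x\<in>U. p\<^sub>X x \<noteq> 0" using B by blast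
    then show ?thesis using X(2)[of \<theta>0] by (auto simp: r_def less_le)
  qed
  have D: "0 < D" using A(2) by (simp add: D_def)
  have \<sigma>2: "P.expectation (\<lambda>\<omega>. (\<epsilon> \<omega>)\<^sup>2) = \<sigma>2" using \<epsilon>(4,5) by simp
  have noise: "integrable M (\<lambda>\<omega>. (g \<omega>)\<^sup>2) \<and> M.expectation g = 0 \<and> M.expectation (\<lambda>\<omega>. (g \<omega>)\<^sup>2) = \<sigma>2"
    if g[measurable]: "g \<in> borel_measurable M" and d: "distr M borel g = distr P borel \<epsilon>" for g
  proof -
    note [measurable] = \<epsilon>(1)
    have "integrable (distr P borel \<epsilon>) (\<lambda>x. x\<^sup>2)" using \<epsilon>(3) by (subst integrable_distr_eq) auto
    then have int: "integrable M (\<lambda>\<omega>. (g \<omega>)\<^sup>2)" unfolding d[symmetric] by (subst (asm) integrable_distr_eq) auto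
    have transfer: "M.expectation (\<lambda>\<omega>. h (g \<omega>)) = P.expectation (\<lambda>\<omega>. h (\<epsilon> \<omega>))"
      if h: "h \<in> borel_measurable borel" for h :: "real \<Rightarrow> real"
    proof -
      have "M.expectation (\<lambda>\<omega>. h (g \<omega>)) = (\<integral>x. h x \<partial>distr M borel g)" by (rule integral_distr[OF g h, symmetric])
      also have "\<dots> = P.expectation (\<lambda>\<omega>. h (\<epsilon> \<omega>))" unfolding d by (rule integral_distr[OF \<epsilon>(1) h])
      finally show ?thesis .
    qed
    have "M.expectation g = 0" using transfer[of "\<lambda>x. x"] \<epsilon>(4) by simp
    moreover have "M.expectation (\<lambda>\<omega>. (g \<omega>)\<^sup>2) = \<sigma>2" using transfer[of "\<lambda>x. x\<^sup>2"] \<sigma>2 by simp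
    ultimately show ?thesis using int by blast
  qed
  have \<epsilon>pm: "\<epsilon>p j \<in> borel_measurable M" and \<epsilon>mm: "\<epsilon>m j \<in> borel_measurable M" if "1 \<le> j" for j
    using \<epsilon>p(1) \<epsilon>m(1) that by (auto simp: M.indep_vars_def)
  have der: "(f has_real_derivative D) (at \<xi>0)"
    using f(1) unfolding D_def by (simp add: DERIV_deriv_iff_real_differentiable)
  have cont: "continuous_on UNIV f"
    using f(1) by (intro continuous_at_imp_continuous_on ballI differentiable_imp_continuous_within) auto
  have slope: "((\<lambda>h. (f (\<xi>0 + h) - f \<xi>0) / h) \<longlongrightarrow> D) (at 0)" using der by (simp add: DERIV_def)
  have slope_p: "((\<lambda>x. \<phi>p x / x) \<longlongrightarrow> D) (at_right 0)"
    using slope unfolding \<phi>p_def by (rule tendsto_mono[OF at_le, rotated]) simp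
  have slope_m: "((\<lambda>x. \<phi>m x / x) \<longlongrightarrow> D) (at_right 0)"
  proof -
    have "filterlim (\<lambda>x::real. - x) (at 0) (at_right 0)"
      unfolding filterlim_at by (auto intro!: tendsto_eq_intros simp: eventually_at_filter)
    from filterlim_compose[OF slope this] have "((\<lambda>x. (f (\<xi>0 - x) - f \<xi>0) / (- x)) \<longlongrightarrow> D) (at_right 0)" by simp
    moreover have "(f (\<xi>0 - x) - f \<xi>0) / (- x) = \<phi>m x / x" for x by (simp add: \<phi>m_def minus_divide_left[symmetric] divide_minus_right diff_divide_distrib)
    ultimately show ?thesis by simp
  qed
  have right: "compound_walk M r \<sigma>2 D \<nu>p \<epsilon>p \<phi>p"
  proof (intro compound_walk.intro M compound_walk_axioms.intro)
    show "mono_on {0..} \<phi>p" using f(3) by (auto simp: mono_on_def \<phi>p_def dest: monoD)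
    show "\<phi>p 0 = 0" by (simp add: \<phi>p_def)
  qed (use r D \<nu>p(1) \<epsilon>p slope_p noise[OF \<epsilon>pm \<epsilon>p(2)] in \<open>auto simp: r_def\<close>)
  have left: "compound_walk M r \<sigma>2 D \<nu>m (\<lambda>j \<omega>. - \<epsilon>m j \<omega>) \<phi>m"
  proof (intro compound_walk.intro M compound_walk_axioms.intro)
    show "mono_on {0..} \<phi>m" using f(3) by (auto simp: mono_on_def \<phi>m_def dest: monoD)
    show "\<phi>m 0 = 0" by (simp add: \<phi>m_def)
    show "M.indep_vars (\<lambda>_. borel) (\<lambda>j \<omega>. - \<epsilon>m j \<omega>) {1..}"
      by (rule M.indep_vars_compose2[OF \<epsilon>m(1)]) auto
  qed (use r D \<nu>m(1) slope_m noise[OF \<epsilon>mm \<epsilon>m(2)] in \<open>auto simp: r_def\<close>)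
  have two: "two_sided_walk M r \<sigma>2 D \<nu>p \<nu>m \<epsilon>p \<epsilon>m \<phi>p \<phi>m (distr P borel \<epsilon>) (distr P borel \<epsilon>)"
  proof (intro two_sided_walk.intro right left two_sided_walk_axioms.intro)
    have fm: "f \<in> borel_measurable borel" using cont by (rule borel_measurable_continuous_onI)
    show "\<phi>p \<in> borel_measurable borel" "\<phi>m \<in> borel_measurable borel"
      unfolding \<phi>p_def[abs_def] \<phi>m_def[abs_def] using fm by measurable
    let ?F = "\<lambda>k. [generated_events M (count_space UNIV) {0..} \<nu>p, generated_events M (count_space UNIV) {0..} \<nu>m,
        generated_events M borel {1..} \<epsilon>p, generated_events M borel {1..} \<epsilon>m] ! k"
    let ?G = "case_bool (generated_events M borel {1..} \<epsilon>p) (generated_events M borel {1..} \<epsilon>m)"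
    \<comment> \<open>The noise families are the members \<open>2\<close> and \<open>3\<close> of the list.\<close>
    define h :: "bool \<Rightarrow> nat" where "h b = (if b then 2 else 3)" for b
    have FG: "?G b = ?F (h b)" for b by (cases b) (simp_all add: h_def)
    have h4: "h b \<in> {..<4}" for b by (simp add: h_def)
    have "M.indep_sets ?G UNIV"
    proof (rule M.indep_setsI)
      fix b
      have "?F k \<subseteq> M.events" if "k \<in> {..<4}" for k
        using independent that unfolding M.indep_sets_def by blast
      then show "?G b \<subseteq> M.events" unfolding FG using h4 by blast
    next
      fix A and J :: "bool set"
      assume J: "J \<noteq> {}" "finite J" and A: "\<forall>j\<in>J. A j \<in> ?G j"
      define A' where "A' k = A (k = 2)" for k :: nat
      have A'h: "A' (h b) = A b" for b by (simp add: A'_def h_def)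
      have "M.prob (\<Inter>k\<in>h ` J. A' k) = (\<Prod>k\<in>h ` J. M.prob (A' k))"
      proof (rule M.indep_setsD[OF independent])
        show "h ` J \<subseteq> {..<4}" using h4 by blast
        show "\<forall>k\<in>h ` J. A' k \<in> ?F k"
        proof
          fix k assume "k \<in> h ` J"
          then obtain b where b: "b \<in> J" "k = h b" by blast
          show "A' k \<in> ?F k" using A b(1) unfolding b(2) A'h FG[symmetric] by blast
        qed
      qed (use J in auto)
      moreover have "inj_on h J" by (auto simp: inj_on_def h_def split: if_splits)
      ultimately show "M.prob (\<Inter>j\<in>J. A j) = (\<Prod>j\<in>J. M.prob (A j))"
        by (simp add: prod.reindex A'h)
    qed
    then show "M.indep_set (generated_events M borel {1..} \<epsilon>p) (generated_events M borel {1..} \<epsilon>m)"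
      unfolding M.indep_set_def .
  qed (use \<nu>p(2) \<nu>m(2) \<epsilon>p(2) \<epsilon>m(2) in auto)
  have \<sigma>2_nonneg: "0 \<le> \<sigma>2" using \<sigma>2 by (metis Bochner_Integration.integral_nonneg zero_le_power2)
  interpret two_sided_limit M r \<sigma>2 D \<nu>p \<nu>m \<epsilon>p \<epsilon>m \<phi>p \<phi>m "distr P borel \<epsilon>" "distr P borel \<epsilon>" Q W
    by (intro two_sided_limit.intro two brownian_parabola.intro brownian.intro brownian_axioms.intro
      brownian_parabola_axioms.intro W) (use r D \<sigma>2_nonneg in auto)
  have \<Lambda>_eq: "\<Lambda> c = Lam c" for c
    by (intro ext) (simp add: \<Lambda> Lambda_def Lam_def right.walk_def left.walk_def right.noise_def left.noise_def
      right.drift_def left.drift_def \<phi>p_def \<phi>m_def sum.distrib[symmetric] algebra_simps)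
  have Z_eq: "Z = lim.Z"
    unfolding lim.Z_def[abs_def] by (simp add: Z a0 b0 r_def D_def)
  show ?thesis
    unfolding \<Lambda>_eq Z_eq
    using AE_ex_smallest_minimizer argmin_Lam_measurable lim.AE_ex1_minimizer argmin_Z_measurable weak_conv_argmin
    by blast
qed

end
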